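(* Let $\mathcal{G}=(V,E)$ be a decomposable graph on $V=\{1,\dots,p\}$ with cliques $C_1,\dots,C_K$ in a perfect elimination order, separators $S_k=H_{k-1}\cap C_k$ ($k=2,\dots,K$), $c_k=|C_k|$, $s_k=|S_k|$. Let $\mathbf{x}[1],\dots,\mathbf{x}[n]$ be i.i.d. zero-mean Gaussian vectors with concentration matrix $\mathbf{K}\in\mathcal{K}$, with $n\geq\max_k c_k$. Define $$\hat{\mathbf{K}}_{\mathrm{MVUE}}=\sum_{k=1}^K\left[(n-c_k-1)\mathbf{S}_k^{-1}\right]^0-\sum_{k=2}^K\left[(n-s_k-1)\mathbf{S}_{[k]}^{-1}\right]^0,\qquad \hat{\mathbf{K}}_{\mathrm{MLE}}=\sum_{k=1}^K\left[n\mathbf{S}_k^{-1}\right]^0-\sum_{k=2}^K\left[n\mathbf{S}_{[k]}^{-1}\right]^0.$$ Then for all $\mathbf{K}\in\mathcal{K}$, $$E\{\|\hat{\mathbf{K}}_{\mathrm{MVUE}}-\mathbf{K}\|^2\}\leq E\{\|\hat{\mathbf{K}}_{\mathrm{MLE}}-\mathbf{K}\|^2\},$$ where $\|\cdot\|$ is the Frobenius norm.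
   Context: A graph is complete if all its nodes are pairwise adjacent; a clique is a maximal complete subset. A set $c$ separates $a$ and $b$ if every path from $a$ to $b$ meets $c$. A triple $\{a,c,b\}$ of disjoint subsets is a decomposition of a graph on node set $V'$ if $V'=a\cup c\cup b$, $c$ separates $a$ and $b$, and $c$ is complete. A graph is decomposable if it is complete or can be recursively decomposed into two decomposable subgraphs $\mathcal{G}_{a\cup c}$ and $\mathcal{G}_{c\cup b}$. A sequence of cliques $C_1,\dots,C_K$ is a perfect elimination order if, with $H_j=C_1\cup\cdots\cup C_j$, $S_j=H_{j-1}\cap C_j$, $R_j=H_j\setminus H_{j-1}$, the triple $\{H_{j-1}\setminus S_j,S_j,R_j\}$ is a decomposition of the induced subgraph $\mathcal{G}_{H_j}$ for each $j=2,\dots,K$. $\mathcal{K}=\{\mathbf{K}\succeq\mathbf{0}: [\mathbf{K}]_{H_{j-1}\setminus S_j,R_j}=\mathbf{0},\ j=2,\dots,K\}$; the concentration matrix is $\mathbf{K}=(E\{\mathbf{x}\mathbf{x}^T\})^{-1}$. The sample covariance is $\overline{\mathbf{S}}=\sum_{i=1}^n\mathbf{x}[i]\mathbf{x}[i]^T$; $\mathbf{S}_k=[\overline{\mathbf{S}}]_{C_k,C_k}$ and $\mathbf{S}_{[k]}=[\overline{\mathbf{S}}]_{S_k,S_k}$. For a matrix $\mathbf{A}$ indexed by a subset $a\subseteq V$, $[\mathbf{A}]^0$ is the $p\times p$ matrix equal to $\mathbf{A}$ on the block $a\times a$ and zero elsewhere. *)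

theory Defs
  imports "HOL-Probability.Probability"
begin

section \<open>Graph notions (simple graph given by a symmetric irreflexive relation on a finite type)\<close>

definition complete_set :: "('v \<Rightarrow> 'v \<Rightarrow> bool) \<Rightarrow> 'v set \<Rightarrow> bool" where
  "complete_set E A \<longleftrightarrow> (\<forall>u\<in>A. \<forall>v\<in>A. u \<noteq> v \<longrightarrow> E u v)"

definition is_clique :: "('v \<Rightarrow> 'v \<Rightarrow> bool) \<Rightarrow> 'v set \<Rightarrow> 'v set \<Rightarrow> bool" where
  "is_clique E W C \<longleftrightarrow> C \<subseteq> W \<and> complete_set E C \<and>
     (\<forall>D. C \<subset> D \<and> D \<subseteq> W \<longrightarrow> \<not> complete_set E D)"

definition separates :: "('v \<Rightarrow> 'v \<Rightarrow> bool) \<Rightarrow> 'v set \<Rightarrow> 'v set \<Rightarrow> 'v set \<Rightarrow> 'v set \<Rightarrow> bool" where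
  "separates E W a c b \<longleftrightarrow>
     (\<forall>xs. xs \<noteq> [] \<and> set xs \<subseteq> W \<and> hd xs \<in> a \<and> last xs \<in> b \<and>
           (\<forall>i. i + 1 < length xs \<longrightarrow> E (xs ! i) (xs ! (i + 1)))
        \<longrightarrow> set xs \<inter> c \<noteq> {})"

definition is_decomposition :: "('v \<Rightarrow> 'v \<Rightarrow> bool) \<Rightarrow> 'v set \<Rightarrow> 'v set \<Rightarrow> 'v set \<Rightarrow> 'v set \<Rightarrow> bool" where
  "is_decomposition E W a c b \<longleftrightarrow>
     a \<inter> c = {} \<and> a \<inter> b = {} \<and> c \<inter> b = {} \<and> W = a \<union> c \<union> b \<and>
     separates E W a c b \<and> complete_set E c"

inductive decomposable :: "('v \<Rightarrow> 'v \<Rightarrow> bool) \<Rightarrow> 'v set \<Rightarrow> bool" for E where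
  complete: "complete_set E W \<Longrightarrow> decomposable E W"
| decomp: "is_decomposition E W a c b \<Longrightarrow> decomposable E (a \<union> c) \<Longrightarrow>
           decomposable E (c \<union> b) \<Longrightarrow> decomposable E W"

section \<open>Clique sequences (1-based indexing as in the paper)\<close>

definition clq :: "'v set list \<Rightarrow> nat \<Rightarrow> 'v set" where
  "clq Cs k = Cs ! (k - 1)"

definition hist :: "'v set list \<Rightarrow> nat \<Rightarrow> 'v set" where
  "hist Cs j = (\<Union>i\<in>{1..j}. clq Cs i)"

definition sepr :: "'v set list \<Rightarrow> nat \<Rightarrow> 'v set" where
  "sepr Cs j = hist Cs (j - 1) \<inter> clq Cs j"

definition resid :: "'v set list \<Rightarrow> nat \<Rightarrow> 'v set" where
  "resid Cs j = hist Cs j - hist Cs (j - 1)"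

definition perfect_elim_order :: "('v \<Rightarrow> 'v \<Rightarrow> bool) \<Rightarrow> 'v set list \<Rightarrow> bool" where
  "perfect_elim_order E Cs \<longleftrightarrow>
     (\<forall>j\<in>{2..length Cs}.
        is_decomposition E (hist Cs j) (hist Cs (j - 1) - sepr Cs j) (sepr Cs j) (resid Cs j))"

definition psd :: "real^'p^'p \<Rightarrow> bool" where
  "psd A \<longleftrightarrow> transpose A = A \<and> (\<forall>x. 0 \<le> x \<bullet> (A *v x))"

definition pos_def :: "real^'p^'p \<Rightarrow> bool" where
  "pos_def A \<longleftrightarrow> transpose A = A \<and> (\<forall>x. x \<noteq> 0 \<longrightarrow> 0 < x \<bullet> (A *v x))"

text \<open>The class of concentration matrices Markov w.r.t. the clique sequence.\<close>
definition conc_class :: "'p set list \<Rightarrow> (real^'p^'p) set" where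
  "conc_class Cs = {K. psd K \<and>
     (\<forall>j\<in>{2..length Cs}. \<forall>u\<in>hist Cs (j - 1) - sepr Cs j. \<forall>v\<in>resid Cs j. K $ u $ v = 0)}"

text \<open>pad_inv a A = [ (A restricted to a x a)^{-1} ]^0 : the p x p matrix equal to
  the inverse of the principal block A_{a,a} on a x a and zero elsewhere.\<close>
definition pad_inv :: "'p set \<Rightarrow> real^'p^'p \<Rightarrow> real^'p^'p" where
  "pad_inv a A = (THE B. (\<forall>i j. (i \<notin> a \<or> j \<notin> a) \<longrightarrow> B $ i $ j = 0) \<and>
      (\<forall>i\<in>a. \<forall>j\<in>a. (\<Sum>k\<in>a. A $ i $ k * B $ k $ j) = (if i = j then 1 else 0)))"

definition outer :: "real^'p \<Rightarrow> real^'p \<Rightarrow> real^'p^'p" where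
  "outer u v = (\<chi> i j. u $ i * v $ j)"

definition frob_norm :: "real^'p^'p \<Rightarrow> real" where
  "frob_norm A = sqrt (\<Sum>i\<in>UNIV. \<Sum>j\<in>UNIV. (A $ i $ j)^2)"

definition gauss_density :: "real^'p^'p \<Rightarrow> real^'p \<Rightarrow> real" where
  "gauss_density K x = sqrt (det K) / (2 * pi) powr (real CARD('p) / 2) * exp (- (x \<bullet> (K *v x)) / 2)"

definition sample_cov :: "nat \<Rightarrow> (nat \<Rightarrow> real^'p) \<Rightarrow> real^'p^'p" where
  "sample_cov n xs = (\<Sum>i\<in>{1..n}. outer (xs i) (xs i))"

definition K_mvue :: "'p set list \<Rightarrow> nat \<Rightarrow> (nat \<Rightarrow> real^'p) \<Rightarrow> real^'p^'p" where
  "K_mvue Cs n xs =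
     (\<Sum>k\<in>{1..length Cs}. (real n - real (card (clq Cs k)) - 1) *\<^sub>R pad_inv (clq Cs k) (sample_cov n xs))
   - (\<Sum>k\<in>{2..length Cs}. (real n - real (card (sepr Cs k)) - 1) *\<^sub>R pad_inv (sepr Cs k) (sample_cov n xs))"

definition K_mle :: "'p set list \<Rightarrow> nat \<Rightarrow> (nat \<Rightarrow> real^'p) \<Rightarrow> real^'p^'p" where
  "K_mle Cs n xs =
     (\<Sum>k\<in>{1..length Cs}. real n *\<^sub>R pad_inv (clq Cs k) (sample_cov n xs))
   - (\<Sum>k\<in>{2..length Cs}. real n *\<^sub>R pad_inv (sepr Cs k) (sample_cov n xs))"

end

theory Submission
  imports Defs
begin

text \<open>
  Write \<open>X\<^sub>a\<close> for the zero-padded inverse of the block \<open>S\<^sub>a\<^sub>a\<close> of the sample covariance, and let a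
  vertex \<open>v\<close> be added to \<open>A\<close> so that its neighbours \<open>a\<close> in \<open>A\<close> are complete. Then
  \<open>X\<^sub>a\<^sub>\<union>\<^sub>v = X\<^sub>a + b b\<^sup>T / r\<close>, where \<open>b\<close> and \<open>r\<close> are the regression coefficients and the residual
  sum of squares of \<open>v\<close> on \<open>a\<close>. Stein's identity, applied in the direction that moves only the
  innovation of \<open>v\<close>, gives the conditional mean of \<open>(n - |a| - 2) b b\<^sup>T / r - X\<^sub>a\<close> given the columns in
  \<open>A\<close>: it is constant, namely the increment of the marginal concentration matrix.

  Both estimators have the form \<open>\<Sum> \<phi>(C\<^sub>k) - \<Sum> \<phi>(S\<^sub>k)\<close>. By Moebius inversion such a sum depends only on
  the complete subsets of the graph, so the vertices may be added in any perfect order, starting from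
  any complete set \<open>a\<close>. Hence the conditional mean of the error \<open>MVUE - K\<close> given the columns in \<open>a\<close> is
  \<open>Y\<^sub>a = (n - |a| - 1) X\<^sub>a - const\<close>, with mean zero, and \<open>E Y\<^sub>a\<^sup>2\<close> increases with \<open>a\<close>. Entrywise,
  \<open>D = MLE - MVUE\<close> is a sum of increments \<open>(|a| + 2) X\<^sub>a\<^sub>\<union>\<^sub>v - (|a| + 1) X\<^sub>a\<close>, and
  \<open>E X\<^sub>a (MVUE - K) = E Y\<^sub>a\<^sup>2 / (n - |a| - 1)\<close>, so \<open>E D (MVUE - K) \<ge> 0\<close>, which is what is needed.

  If the risk of the MLE is infinite there is nothing to show; otherwise the diagonal of the MLE
  dominates that of \<open>n X\<^sub>a\<close>, which makes all \<open>X\<^sub>a\<close> square integrable and forces \<open>n > |a| + 1\<close>.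
\<close>

text \<open>Conditional means are not formed as such. A claim about the conditional mean given the
  columns in \<open>A\<close> is an identity of integrals against every square integrable
  \<open>h\<close> with \<open>depends_on n A h\<close>, which is what the orthogonality arguments
  consume. The inductions run from the full vertex set downwards, because the marginal concentration
  matrix and the projection for \<open>A\<close> are both computed from those for
  \<open>insert v A\<close>.

  Integrability is the obstacle: \<open>1 / r\<close> and the inverse blocks are unbounded, and when
  \<open>n\<close> is close to \<open>card a\<close> they need not be integrable. Stein's identity
  is therefore applied only to functions of at most exponential growth: \<open>h\<close> and the
  inverse block are truncated, \<open>r\<close> is replaced by \<open>r + \<epsilon>\<close>, and
  limits are taken afterwards. The same regularised identity also shows that \<open>r\<close> is
  almost surely nonzero, hence that the blocks are invertible.

  The number \<open>n - card a - 2\<close> is a count: the derivatives of the residuals add up to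
  \<open>n - card a\<close>, the trace of the residual projection, and differentiating
  \<open>1 / r\<close> costs 2.\<close>

section \<open>Perfect vertex orders of decomposable graphs\<close>

inductive simplicial_ext :: "('v \<Rightarrow> 'v \<Rightarrow> bool) \<Rightarrow> 'v set \<Rightarrow> 'v set \<Rightarrow> bool" for E where
  simplicial_ext_refl: "simplicial_ext E B B"
| simplicial_ext_step: "simplicial_ext E (insert v A) B \<Longrightarrow> v \<notin> A \<Longrightarrow>
    complete_set E {u\<in>A. E u v} \<Longrightarrow> simplicial_ext E A B"

lemma simplicial_ext_trans:
  assumes "simplicial_ext E A B" "simplicial_ext E B C"
  shows "simplicial_ext E A C"
  using assms by (induction rule: simplicial_ext.induct) (auto intro: simplicial_ext_step)

lemma simplicial_ext_subset: "simplicial_ext E A B \<Longrightarrow> A \<subseteq> B"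
  by (induction rule: simplicial_ext.induct) auto

lemma complete_set_mono: "complete_set E B \<Longrightarrow> A \<subseteq> B \<Longrightarrow> complete_set E A"
  by (auto simp: complete_set_def)

lemma simplicial_ext_complete:
  assumes "finite B" "complete_set E B" "A \<subseteq> B"
  shows "simplicial_ext E A B"
  using assms
proof (induction "card (B - A)" arbitrary: A)
  case 0
  then have "A = B" by (auto simp: finite_subset)
  then show ?case by (simp add: simplicial_ext_refl)
next
  case (Suc m)
  then obtain v where v: "v \<in> B - A"
    by (metis card.empty nat.distinct(1) ex_in_conv)
  have "card (B - insert v A) = m"
    using Suc v by (metis Diff_insert card_Diff_singleton diff_Suc_1)
  then have "simplicial_ext E (insert v A) B"
    using Suc v by (metis DiffD1 insert_subset)
  then show ?case
    by (rule simplicial_ext_step) (use v Suc.prems in \<open>auto intro: complete_set_mono[OF Suc.prems(2)]\<close>)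
qed

lemma no_edge_across:
  assumes dec: "is_decomposition E W a c b" and "u \<in> a" "v \<in> b"
  shows "\<not> E u v"
proof
  assume "E u v"
  have "separates E W a c b" and disj: "a \<inter> c = {}" "c \<inter> b = {}" and W: "W = a \<union> c \<union> b"
    using dec by (auto simp: is_decomposition_def)
  then have "set [u, v] \<inter> c \<noteq> {}"
    unfolding separates_def using assms \<open>E u v\<close>
    by (elim allE[of _ "[u, v]"] impE) (auto simp: less_Suc_eq)
  then show False using disj assms by auto
qed

text \<open>A vertex of \<open>B - A\<close> has no neighbour in \<open>D\<close>, so its
  neighbourhood at the moment of insertion is the same with or without \<open>D\<close>.\<close>

lemma simplicial_ext_union:
  assumes "simplicial_ext E A B" and "\<And>u v. u \<in> D \<Longrightarrow> v \<in> B - A \<Longrightarrow> \<not> E u v"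
    and "D \<inter> (B - A) = {}"
  shows "simplicial_ext E (D \<union> A) (D \<union> B)"
  using assms
proof (induction rule: simplicial_ext.induct)
  case (simplicial_ext_refl B)
  then show ?case by (simp add: simplicial_ext.simplicial_ext_refl)
next
  case (simplicial_ext_step v A B)
  have v: "v \<in> B" using simplicial_ext_subset[OF simplicial_ext_step.hyps(1)] by auto
  have "simplicial_ext E (insert v (D \<union> A)) (D \<union> B)"
    using simplicial_ext_step by auto
  moreover have "v \<notin> D \<union> A" using v simplicial_ext_step by auto
  moreover have "{u \<in> D \<union> A. E u v} = {u \<in> A. E u v}"
    using v simplicial_ext_step by auto
  ultimately show ?case
    using simplicial_ext_step.hyps by (auto intro: simplicial_ext.simplicial_ext_step)
qed

text \<open>Allowing every complete starting set is the strengthening that closes the induction. No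
  edge joins \<open>a\<close> and \<open>b\<close>, so a complete set lies in one of the two parts
  and is grown to that part; the other part is then added by the order that starts from the
  separator, which is complete as well.\<close>

lemma decomposable_simplicial_ext:
  fixes W :: "'v::finite set"
  assumes sym: "\<And>u v. E u v \<Longrightarrow> E v u"
    and "decomposable E W" "complete_set E A" "A \<subseteq> W"
  shows "simplicial_ext E A W"
  using assms(2-)
proof (induction arbitrary: A rule: decomposable.induct)
  case (complete W)
  then show ?case by (simp add: simplicial_ext_complete)
next
  case (decomp W a c b)
  have W: "W = a \<union> c \<union> b" and cc: "complete_set E c" and disj: "a \<inter> b = {}" "a \<inter> c = {}" "c \<inter> b = {}"
    using decomp.hyps(1) by (auto simp: is_decomposition_def)
  note ne = no_edge_across[OF decomp.hyps(1)]
  have 1: "simplicial_ext E (a \<union> c) W"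
    using simplicial_ext_union[OF decomp.IH(2)[OF cc], of a] ne disj W by (auto simp: Un_assoc)
  have "simplicial_ext E (b \<union> c) (b \<union> (a \<union> c))"
    using ne sym disj by (intro simplicial_ext_union decomp.IH(1)[OF cc]) auto
  then have 2: "simplicial_ext E (c \<union> b) W"
    using W by (simp add: Un_ac)
  have "A \<subseteq> a \<union> c \<or> A \<subseteq> c \<union> b"
  proof (rule ccontr)
    assume "\<not> ?thesis"
    then obtain u v where "u \<in> A" "u \<notin> c \<union> b" "v \<in> A" "v \<notin> a \<union> c" by blast
    then have "u \<in> a" "v \<in> b" "u \<noteq> v" using decomp.prems(2) W by auto
    then show False
      using ne \<open>u \<in> A\<close> \<open>v \<in> A\<close> decomp.prems(1) by (auto simp: complete_set_def)
  qed
  then show ?case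
    using decomp.IH decomp.prems 1 2 simplicial_ext_trans by metis
qed

lemma complete_subset_clique:
  fixes A :: "'v::finite set"
  assumes "complete_set E A"
  obtains C where "is_clique E UNIV C" "A \<subseteq> C"
proof -
  define F where "F = {C. complete_set E C \<and> A \<subseteq> C}"
  have "A \<in> F" using assms by (simp add: F_def)
  then have "\<exists>C\<in>F. \<forall>D\<in>F. C \<subseteq> D \<longrightarrow> C = D"
    by (intro finite_has_maximal) auto
  then obtain C where "C \<in> F" and max: "\<And>D. D \<in> F \<Longrightarrow> C \<subseteq> D \<Longrightarrow> C = D"
    by (elim bexE) simp
  then have C: "complete_set E C" "A \<subseteq> C" by (simp_all add: F_def)
  have "is_clique E UNIV C"
    unfolding is_clique_def
  proof (intro conjI allI impI notI)
    fix D assume D: "C \<subset> D \<and> D \<subseteq> UNIV" and "complete_set E D"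
    then have "D \<in> F" using C by (auto simp: F_def)
    then show False using max D by blast
  qed (use C in auto)
  then show ?thesis using C that by blast
qed

section \<open>Clique sums\<close>

text \<open>Induction on a bound for the cardinality: the value at a new set is what its proper
  subsets leave over.\<close>

lemma moebius_inverse:
  fixes \<phi> :: "'v::finite set \<Rightarrow> 'b::ab_group_add"
  obtains \<mu> where "\<And>c. \<phi> c = (\<Sum>a\<in>Pow c. \<mu> a)"
proof -
  have "\<exists>\<mu>. \<forall>c. card c \<le> m \<longrightarrow> \<phi> c = (\<Sum>a\<in>Pow c. \<mu> a)" for m
  proof (induction m)
    case 0
    show ?case by (intro exI[of _ "\<lambda>_. \<phi> {}"]) auto
  next
    case (Suc m)
    then obtain \<mu> where \<mu>: "\<And>c. card c \<le> m \<Longrightarrow> \<phi> c = (\<Sum>a\<in>Pow c. \<mu> a)" by blast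
    define \<mu>' where "\<mu>' c = (if card c \<le> m then \<mu> c else \<phi> c - (\<Sum>a\<in>Pow c - {c}. \<mu> a))" for c
    have small: "card a \<le> m" if "a \<in> Pow c - {c}" "card c \<le> Suc m" for a c :: "'v set"
      using that psubset_card_mono[of c a] by fastforce
    have "\<phi> c = (\<Sum>a\<in>Pow c. \<mu>' a)" if c: "card c \<le> Suc m" for c
    proof (cases "card c \<le> m")
      case True
      then have "\<mu>' a = \<mu> a" if "a \<in> Pow c" for a
        using that card_mono[of c a] by (auto simp: \<mu>'_def)
      then show ?thesis using \<mu>[OF True] by simp
    next
      case False
      have "(\<Sum>a\<in>Pow c. \<mu>' a) = \<mu>' c + (\<Sum>a\<in>Pow c - {c}. \<mu>' a)"
        by (subst sum.remove[of _ c]) auto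
      also have "(\<Sum>a\<in>Pow c - {c}. \<mu>' a) = (\<Sum>a\<in>Pow c - {c}. \<mu> a)"
        using small[OF _ c] by (intro sum.cong) (auto simp: \<mu>'_def)
      finally show ?thesis using False by (simp add: \<mu>'_def)
    qed
    then show ?case by blast
  qed
  from this[of "card (UNIV :: 'v set)"] show ?thesis
    using that by (auto simp: card_mono)
qed

text \<open>Without the empty set, the sum over the empty vertex set is zero, which starts the
  telescoping.\<close>

definition complete_subsets :: "('v \<Rightarrow> 'v \<Rightarrow> bool) \<Rightarrow> 'v set \<Rightarrow> 'v set set" where
  "complete_subsets E A = {a. a \<subseteq> A \<and> a \<noteq> {} \<and> complete_set E a}"

lemma sum_Pow_diff:
  fixes \<mu> :: "'v::finite set \<Rightarrow> 'b::ab_group_add"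
  assumes "T \<subseteq> C"
  shows "(\<Sum>a\<in>Pow C. \<mu> a) - (\<Sum>a\<in>Pow T. \<mu> a) = (\<Sum>a\<in>Pow C - Pow T. \<mu> a)"
  using assms by (subst sum_diff) auto

text \<open>A complete subset of \<open>H'\<close> that is not inside \<open>H\<close> contains a
  vertex of \<open>C - H\<close>, whose neighbours in \<open>H'\<close> all lie in \<open>C\<close>.
  Hence the new complete sets are exactly the subsets of \<open>C\<close> that are not subsets of
  \<open>H \<inter> C\<close>.\<close>

lemma complete_subsets_glue:
  fixes \<mu> :: "'v::finite set \<Rightarrow> 'b::ab_group_add"
  assumes sub: "H' = H \<union> C" and C: "complete_set E C"
    and across: "\<And>u v. u \<in> H - C \<Longrightarrow> v \<in> C - H \<Longrightarrow> \<not> E u v"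
  shows "sum \<mu> (complete_subsets E H') = sum \<mu> (complete_subsets E H)
           + ((\<Sum>a\<in>Pow C. \<mu> a) - (\<Sum>a\<in>Pow (H \<inter> C). \<mu> a))"
proof -
  have "a \<subseteq> C" if a: "a \<subseteq> H'" "complete_set E a" "\<not> a \<subseteq> H" for a
  proof
    fix u assume u: "u \<in> a"
    obtain v where v: "v \<in> a" "v \<notin> H" using a by blast
    then have "v \<in> C" using a sub by auto
    show "u \<in> C"
    proof (rule ccontr)
      assume "u \<notin> C"
      then have "u \<in> H - C" "E u v" using u v a sub \<open>v \<in> C\<close> by (auto simp: complete_set_def)
      then show False using across v \<open>v \<in> C\<close> by auto
    qed
  qed
  then have "complete_subsets E H' = complete_subsets E H \<union> (Pow C - Pow (H \<inter> C))"
    using sub complete_set_mono[OF C] by (auto simp: complete_subsets_def)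
  moreover have "complete_subsets E H \<inter> (Pow C - Pow (H \<inter> C)) = {}"
    by (auto simp: complete_subsets_def)
  ultimately show ?thesis
    by (simp add: sum.union_disjoint sum_Pow_diff del: Pow_Int_eq)
qed

lemma hist_simps: "hist Cs 0 = {}" "hist Cs (Suc j) = hist Cs j \<union> clq Cs (Suc j)"
  by (auto simp: hist_def atLeastAtMostSuc_conv)

lemma clq_in_set: "1 \<le> k \<Longrightarrow> k \<le> length Cs \<Longrightarrow> clq Cs k \<in> set Cs"
  by (auto simp: clq_def)

lemma peo_no_edge_across:
  assumes "perfect_elim_order E Cs" "1 \<le> j" "j \<le> length Cs"
    and "u \<in> hist Cs (j - 1) - clq Cs j" "v \<in> clq Cs j - hist Cs (j - 1)"
  shows "\<not> E u v"
proof (cases "j = 1")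
  case True
  then show ?thesis using assms by (simp add: hist_simps)
next
  case False
  then have "is_decomposition E (hist Cs j) (hist Cs (j - 1) - sepr Cs j) (sepr Cs j) (resid Cs j)"
    using assms by (auto simp: perfect_elim_order_def)
  then show ?thesis
    using assms hist_simps(2)[of Cs "j - 1"] 
    by (intro no_edge_across) (auto simp: sepr_def resid_def)
qed

text \<open>Each nonempty complete set is counted once, at the first clique that contains it. The
  right-hand side no longer mentions the cliques or their order, which later permits a different
  vertex order.\<close>

lemma clique_sum_eq:
  fixes \<phi> :: "'v::finite set \<Rightarrow> 'b::ab_group_add"
  assumes cl: "set Cs = {C. is_clique E UNIV C}" and peo: "perfect_elim_order E Cs"
    and \<phi>: "\<phi> {} = 0" and \<mu>: "\<And>c. \<phi> c = (\<Sum>a\<in>Pow c. \<mu> a)"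
  shows "(\<Sum>k\<in>{1..length Cs}. \<phi> (clq Cs k)) - (\<Sum>k\<in>{2..length Cs}. \<phi> (sepr Cs k))
         = sum \<mu> (complete_subsets E UNIV)"
proof -
  have *: "(\<Sum>k\<in>{1..j}. \<phi> (clq Cs k) - \<phi> (sepr Cs k)) = sum \<mu> (complete_subsets E (hist Cs j))"
    if "j \<le> length Cs" for j
    using that
  proof (induction j)
    case 0
    then show ?case by (auto simp: hist_simps complete_subsets_def intro!: sum.neutral)
  next
    case (Suc j)
    have C: "complete_set E (clq Cs (Suc j))"
      using clq_in_set[of "Suc j" Cs] Suc.prems cl by (auto simp: is_clique_def)
    have "sum \<mu> (complete_subsets E (hist Cs (Suc j))) = sum \<mu> (complete_subsets E (hist Cs j))
        + (\<phi> (clq Cs (Suc j)) - \<phi> (sepr Cs (Suc j)))"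
      using peo_no_edge_across[OF peo, of "Suc j"] Suc.prems
      unfolding \<mu> sepr_def by (subst complete_subsets_glue[OF hist_simps(2) C]) auto
    then show ?case using Suc by simp
  qed
  have "hist Cs (length Cs) = UNIV"
  proof -
    have "v \<in> hist Cs (length Cs)" for v
    proof -
      obtain C where C: "is_clique E UNIV C" "{v} \<subseteq> C"
        using complete_subset_clique[of E "{v}"] by (auto simp: complete_set_def)
      then have "C \<in> set Cs" using cl by simp
      then obtain i where "i < length Cs" "C = Cs ! i" by (auto simp: in_set_conv_nth)
      then show ?thesis using C by (auto simp: hist_def clq_def intro!: bexI[of _ "Suc i"])
    qed
    then show ?thesis by auto
  qed
  \<comment> \<open>The separator with index 1 is empty because \<open>hist Cs 0\<close> is, so
    including it costs \<open>\<phi> {} = 0\<close>.\<close>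
  moreover have "(\<Sum>k\<in>{1..length Cs}. \<phi> (sepr Cs k)) = (\<Sum>k\<in>{2..length Cs}. \<phi> (sepr Cs k))"
  proof (rule sum.mono_neutral_right)
    show "\<forall>k\<in>{1..length Cs} - {2..length Cs}. \<phi> (sepr Cs k) = 0"
    proof
      fix k assume "k \<in> {1..length Cs} - {2..length Cs}"
      then have "k = 1" by auto
      then show "\<phi> (sepr Cs k) = 0" by (simp add: sepr_def hist_simps \<phi>)
    qed
  qed auto
  ultimately show ?thesis using *[of "length Cs"] by (simp add: sum_subtractf)
qed

lemma complete_subsets_complete:
  fixes \<mu> :: "'v::finite set \<Rightarrow> 'b::ab_group_add"
  assumes "complete_set E a"
  shows "sum \<mu> (complete_subsets E a) = (\<Sum>b\<in>Pow a. \<mu> b) - (\<Sum>b\<in>Pow {}. \<mu> b)"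
proof -
  have "sum \<mu> (complete_subsets E a) = sum \<mu> (complete_subsets E {})
           + ((\<Sum>b\<in>Pow a. \<mu> b) - (\<Sum>b\<in>Pow ({} \<inter> a). \<mu> b))"
    using assms by (intro complete_subsets_glue) auto
  moreover have "complete_subsets E {} = {}" by (auto simp: complete_subsets_def)
  ultimately show ?thesis by simp
qed

lemma complete_insert_nbrs:
  assumes sym: "\<And>u v. E u v \<Longrightarrow> E v u" and "complete_set E {u\<in>A. E u v}"
  shows "complete_set E (insert v {u\<in>A. E u v})"
  using assms unfolding complete_set_def by blast

lemma complete_subsets_insert:
  fixes \<mu> :: "'v::finite set \<Rightarrow> 'b::ab_group_add"
  assumes sym: "\<And>u v. E u v \<Longrightarrow> E v u" and "v \<notin> A" and c: "complete_set E {u\<in>A. E u v}"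
  shows "sum \<mu> (complete_subsets E (insert v A)) = sum \<mu> (complete_subsets E A)
    + ((\<Sum>a\<in>Pow (insert v {u\<in>A. E u v}). \<mu> a) - (\<Sum>a\<in>Pow {u\<in>A. E u v}. \<mu> a))"
proof -
  have 1: "A \<inter> insert v {u\<in>A. E u v} = {u\<in>A. E u v}" using assms by auto
  have "complete_set E (insert v {u\<in>A. E u v})"
    using sym c by (rule complete_insert_nbrs)
  then show ?thesis
    by (subst complete_subsets_glue[of _ A "insert v {u\<in>A. E u v}"]) (auto simp: 1)
qed

text \<open>\<open>conc_class\<close> prescribes zeros only between a residual and the earlier
  vertices outside the separator. At the first \<open>j\<close> for which \<open>hist Cs j\<close>
  contains both \<open>u\<close> and \<open>v\<close>, the clique \<open>clq Cs j\<close> cannot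
  contain both, since they are not adjacent. So one of them is new and the other lies in the history
  outside the clique: a prescribed zero, up to symmetry.\<close>

lemma conc_class_zero:
  fixes E :: "'p::finite \<Rightarrow> 'p \<Rightarrow> bool"
  assumes sym: "\<And>u v. E u v \<Longrightarrow> E v u"
    and cl: "set Cs = {C. is_clique E UNIV C}" 
    and K: "K \<in> conc_class Cs" and uv: "u \<noteq> v" "\<not> E u v"
  shows "K $ u $ v = 0"
proof -
  have "transpose K = K"
    using K by (simp add: conc_class_def psd_def)
  then have Ksym: "K $ i $ j = K $ j $ i" for i j
    by (metis transpose_def vec_lambda_beta)
  have zero: "K $ a $ b = 0" if "1 \<le> j" "j \<le> length Cs" "a \<in> hist Cs (j-1) - clq Cs j" "b \<in> clq Cs j - hist Cs (j-1)"
    for j a b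
  proof -
    have "j \<noteq> 1" using that by (auto simp: hist_simps)
    then have "j \<in> {2..length Cs}" using that by auto
    moreover have "a \<in> hist Cs (j-1) - sepr Cs j" "b \<in> resid Cs j"
      using that hist_simps(2)[of Cs "j-1"] by (auto simp: sepr_def resid_def)
    ultimately show ?thesis using K unfolding conc_class_def by blast
  qed
  have "\<exists>j\<le>length Cs. w \<in> hist Cs j" for w
  proof -
    obtain C where C: "is_clique E UNIV C" "{w} \<subseteq> C"
      using complete_subset_clique[of E "{w}"] by (auto simp: complete_set_def)
    then have "C \<in> set Cs" using cl by simp
    then obtain i where "i < length Cs" "C = Cs ! i" by (auto simp: in_set_conv_nth)
    then show ?thesis using C by (auto simp: hist_def clq_def intro!: exI[of _ "Suc i"] bexI[of _ "Suc i"])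
  qed
  then obtain j1 j2 where "j1 \<le> length Cs" "j2 \<le> length Cs" "u \<in> hist Cs j1" "v \<in> hist Cs j2" by metis
  moreover have mono: "hist Cs i \<subseteq> hist Cs j" if "i \<le> j" for i j
    unfolding hist_def using that by (intro UN_mono) auto
  ultimately have ex: "{u,v} \<subseteq> hist Cs (max j1 j2)" "max j1 j2 \<le> length Cs"
    using subsetD[OF mono[OF max.cobounded1]] subsetD[OF mono[OF max.cobounded2]] by auto
  define P where "P i \<longleftrightarrow> {u,v} \<subseteq> hist Cs i" for i
  define j where "j = (LEAST i. P i)"
  have "P (max j1 j2)" using ex(1) by (simp add: P_def)
  then have j: "{u,v} \<subseteq> hist Cs j" and "j \<le> max j1 j2"
    using LeastI[of P "max j1 j2"] Least_le[of P "max j1 j2"] by (simp_all add: P_def j_def)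
  then have jle: "j \<le> length Cs" using ex(2) by linarith
  have j0: "1 \<le> j" using j by (cases j) (simp_all add: hist_simps)
  have "\<not> P (j - 1)"
    using not_less_Least[of "j - 1" P] j0 unfolding j_def[symmetric] by simp
  then have "\<not> {u,v} \<subseteq> hist Cs (j - 1)" by (simp add: P_def)
  moreover have "complete_set E (clq Cs j)" using clq_in_set[OF j0 jle] cl by (simp add: is_clique_def)
  then have "\<not> {u,v} \<subseteq> clq Cs j" using uv by (auto simp: complete_set_def)
  moreover have "hist Cs j = hist Cs (j-1) \<union> clq Cs j" using hist_simps(2)[of Cs "j-1"] j0 by simp
  ultimately consider "u \<in> hist Cs (j-1) - clq Cs j" "v \<in> clq Cs j - hist Cs (j-1)"
    | "v \<in> hist Cs (j-1) - clq Cs j" "u \<in> clq Cs j - hist Cs (j-1)"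
    using j by blast
  then show ?thesis
    by cases (metis zero[OF j0 jle] Ksym)+
qed

section \<open>Inverses of principal blocks\<close>

definition block_inverse :: "'p::finite set \<Rightarrow> real^'p^'p \<Rightarrow> real^'p^'p \<Rightarrow> bool" where
  "block_inverse a A B \<longleftrightarrow> (\<forall>i j. (i \<notin> a \<or> j \<notin> a) \<longrightarrow> B $ i $ j = 0) \<and>
      (\<forall>i\<in>a. \<forall>j\<in>a. (\<Sum>k\<in>a. A $ i $ k * B $ k $ j) = (if i = j then 1 else 0))"

text \<open>Completing the block by ones on the diagonal gives a matrix over the full index type
  with the determinant of the block, so that Cramer's rule applies to blocks.\<close>

definition fill_identity :: "'p::finite set \<Rightarrow> real^'p^'p \<Rightarrow> real^'p^'p" where
  "fill_identity a A = (\<chi> i j. if i \<in> a \<and> j \<in> a then A $ i $ j else if i = j then 1 else 0)"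

text \<open>A quotient of polynomials in the entries of the block, hence measurable and a function
  of the block alone. For a singular block, division by zero makes it the zero matrix.\<close>

definition cramer_inverse :: "'p::finite set \<Rightarrow> real^'p^'p \<Rightarrow> real^'p^'p" where
  "cramer_inverse a A = (\<chi> i j. if i \<in> a \<and> j \<in> a
     then det (\<chi> k l. if l = i then (if k = j then 1 else 0) else fill_identity a A $ k $ l)
       / det (fill_identity a A) else 0)"

lemma sum_UNIV_subset:
  fixes f :: "'p::finite \<Rightarrow> real"
  assumes "\<And>k. k \<notin> a \<Longrightarrow> f k = 0"
  shows "(\<Sum>k\<in>UNIV. f k) = (\<Sum>k\<in>a. f k)"
  using assms by (intro sum.mono_neutral_right) auto

lemma block_inverse_cramer:
  assumes "det (fill_identity a A) \<noteq> 0"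
  shows "block_inverse a A (cramer_inverse a A)"
  unfolding block_inverse_def
proof (intro conjI ballI allI impI)
  fix i j assume "i \<notin> a \<or> j \<notin> a"
  then show "cramer_inverse a A $ i $ j = 0" by (auto simp: cramer_inverse_def)
next
  fix i j assume i: "i \<in> a" and j: "j \<in> a"
  define x where "x = (\<chi> k. det (\<chi> i l. if l = k then (axis j 1 :: real^'a) $ i else fill_identity a A $ i $ l)
       / det (fill_identity a A))"
  have "fill_identity a A *v x = axis j 1"
    using cramer[OF assms, of x "axis j 1"] by (simp add: x_def)
  then have "(\<Sum>k\<in>UNIV. fill_identity a A $ i $ k * x $ k) = (if i = j then 1 else 0)"
    by (simp add: matrix_vector_mult_def vec_eq_iff axis_def)
  also have "(\<Sum>k\<in>UNIV. fill_identity a A $ i $ k * x $ k) = (\<Sum>k\<in>a. fill_identity a A $ i $ k * x $ k)"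
    using i by (intro sum_UNIV_subset) (auto simp: fill_identity_def)
  also have "\<dots> = (\<Sum>k\<in>a. A $ i $ k * cramer_inverse a A $ k $ j)"
  proof (intro sum.cong refl arg_cong2[of _ _ _ _ "(*)"])
    fix k assume k: "k \<in> a"
    show "fill_identity a A $ i $ k = A $ i $ k" using i k by (simp add: fill_identity_def)
    have "(\<chi> i l. if l = k then (axis j 1 :: real^'a) $ i else fill_identity a A $ i $ l)
      = (\<chi> i l. if l = k then (if i = j then 1 else 0) else fill_identity a A $ i $ l)"
      by (auto simp: vec_eq_iff axis_def)
    then show "x $ k = cramer_inverse a A $ k $ j"
      using j k by (simp add: x_def cramer_inverse_def)
  qed
  finally show "(\<Sum>k\<in>a. A $ i $ k * cramer_inverse a A $ k $ j) = (if i = j then 1 else 0)" .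
qed

lemma block_inverse_zero: "block_inverse a A B \<Longrightarrow> i \<notin> a \<or> j \<notin> a \<Longrightarrow> B $ i $ j = 0"
  by (auto simp: block_inverse_def)

text \<open>The completed candidate is a right inverse of the completed block. Invertibility of an
  enlarged block can thus be read off from an explicit formula for its inverse.\<close>

lemma block_inverse_det:
  assumes "block_inverse a A B"
  shows "det (fill_identity a A) \<noteq> 0"
proof -
  have "fill_identity a A ** fill_identity a B = mat 1"
  proof -
    have "(\<Sum>k\<in>UNIV. fill_identity a A $ i $ k * fill_identity a B $ k $ j) = (if i = j then 1 else 0)" for i j
    proof (cases "i \<in> a")
      case True
      then have "(\<Sum>k\<in>UNIV. fill_identity a A $ i $ k * fill_identity a B $ k $ j)
        = (\<Sum>k\<in>a. fill_identity a A $ i $ k * fill_identity a B $ k $ j)"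
        by (intro sum_UNIV_subset) (auto simp: fill_identity_def)
      also have "\<dots> = (\<Sum>k\<in>a. A $ i $ k * fill_identity a B $ k $ j)"
        using True by (intro sum.cong) (auto simp: fill_identity_def)
      also have "\<dots> = (if i = j then 1 else 0)"
      proof (cases "j \<in> a")
        case jt: True
        then have "(\<Sum>k\<in>a. A $ i $ k * fill_identity a B $ k $ j) = (\<Sum>k\<in>a. A $ i $ k * B $ k $ j)"
          by (intro sum.cong) (auto simp: fill_identity_def)
        then show ?thesis using assms True jt by (auto simp: block_inverse_def)
      next
        case False
        then show ?thesis using True by (auto simp: fill_identity_def intro!: sum.neutral)
      qed
      finally show ?thesis .
    next
      case False
      then have "(\<Sum>k\<in>UNIV. fill_identity a A $ i $ k * fill_identity a B $ k $ j)
        = (\<Sum>k\<in>{i}. fill_identity a A $ i $ k * fill_identity a B $ k $ j)"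
        by (intro sum_UNIV_subset) (auto simp: fill_identity_def)
      then show ?thesis using False by (auto simp: fill_identity_def)
    qed
    then show ?thesis by (simp add: matrix_matrix_mult_def mat_def vec_eq_iff)
  qed
  then have "det (fill_identity a A) * det (fill_identity a B) = 1"
    by (metis det_I det_mul)
  then show ?thesis by auto
qed

lemma block_inverse_mult:
  assumes B: "block_inverse a A B" and "i \<in> a"
  shows "(A *v (B *v z)) $ i = z $ i"
proof -
  have "(A *v (B *v z)) $ i = (\<Sum>k\<in>UNIV. A $ i $ k * (\<Sum>j\<in>UNIV. B $ k $ j * z $ j))"
    by (simp add: matrix_vector_mult_def)
  also have "\<dots> = (\<Sum>k\<in>a. A $ i $ k * (\<Sum>j\<in>UNIV. B $ k $ j * z $ j))"
    using block_inverse_zero[OF B] by (intro sum_UNIV_subset) (simp add: sum.neutral)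
  also have "\<dots> = (\<Sum>k\<in>a. A $ i $ k * (\<Sum>j\<in>a. B $ k $ j * z $ j))"
    using block_inverse_zero[OF B]
    by (intro sum.cong refl arg_cong2[of _ _ _ _ "(*)"] sum_UNIV_subset) simp
  also have "\<dots> = (\<Sum>j\<in>a. (\<Sum>k\<in>a. A $ i $ k * B $ k $ j) * z $ j)"
    by (simp add: sum_distrib_left sum_distrib_right mult.assoc) (rule sum.swap)
  also have "\<dots> = (\<Sum>j\<in>a. (if i = j then 1 else 0) * z $ j)"
    using B \<open>i \<in> a\<close> by (intro sum.cong refl) (simp add: block_inverse_def)
  also have "\<dots> = (\<Sum>j\<in>a. if i = j then z $ j else 0)" by (intro sum.cong) auto
  also have "\<dots> = z $ i" using \<open>i \<in> a\<close> by simp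
  finally show ?thesis .
qed

lemma block_inverse_mult_supp:
  assumes B: "block_inverse a A B" and "i \<notin> a"
  shows "(B *v z) $ i = 0"
proof -
  have "B $ i $ j = 0" for j using block_inverse_zero[OF B] assms(2) by blast
  then show ?thesis by (simp add: matrix_vector_mult_def)
qed

lemma sym_dot: "transpose A = A \<Longrightarrow> x \<bullet> (A *v y) = (A *v x) \<bullet> (y :: real^'p::finite)"
  by (metis dot_lmul_matrix transpose_matrix_vector)

lemma dot_supp_cong:
  fixes x y z :: "real^'p::finite"
  assumes "\<And>i. i \<notin> a \<Longrightarrow> x $ i = 0" "\<And>i. i \<in> a \<Longrightarrow> y $ i = z $ i"
  shows "x \<bullet> y = x \<bullet> z"
  unfolding inner_vec_def
proof (intro sum.cong refl)
  fix i
  show "x $ i \<bullet> y $ i = x $ i \<bullet> z $ i" using assms by (cases "i \<in> a") simp_all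
qed

text \<open>Both sides equal \<open>(A *v (B *v x)) \<bullet> (B' *v y)\<close>, by symmetry of
  \<open>A\<close>. Although only a right inverse is asked for, this one identity yields uniqueness,
  symmetry and the left inverse property.\<close>

lemma block_inverse_dot:
  assumes A: "transpose A = A" and B: "block_inverse a A B" and B': "block_inverse a A B'"
  shows "x \<bullet> (B' *v y) = (B *v x) \<bullet> y"
proof -
  have "x \<bullet> (B' *v y) = (A *v (B *v x)) \<bullet> (B' *v y)"
    using dot_supp_cong[of a "B' *v y" "A *v (B *v x)" x] block_inverse_mult[OF B]
      block_inverse_mult_supp[OF B'] by (simp add: inner_commute)
  also have "\<dots> = (B *v x) \<bullet> (A *v (B' *v y))"
    using sym_dot[OF A] by simp
  also have "\<dots> = (B *v x) \<bullet> y"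
    using block_inverse_mult[OF B'] block_inverse_mult_supp[OF B] by (intro dot_supp_cong[of a])
  finally show ?thesis .
qed

lemma matrix_nth: "A $ i $ j = axis i 1 \<bullet> (A *v axis j (1::real))"
  by (simp add: inner_axis' matrix_vector_mult_basis column_def)

lemma block_inverse_unique:
  assumes A: "transpose A = A" and B: "block_inverse a A B" and B': "block_inverse a A B'"
  shows "B = B'"
proof -
  have "x \<bullet> (B' *v y) = x \<bullet> (B *v y)" for x y
    using block_inverse_dot[OF A B B'] block_inverse_dot[OF A B B] by simp
  then show ?thesis by (simp add: vec_eq_iff matrix_nth)
qed

lemma block_inverse_sym:
  assumes A: "transpose A = A" and B: "block_inverse a A B"
  shows "transpose B = B"
proof -
  have "B $ j $ i = B $ i $ j" for i j
    using block_inverse_dot[OF A B B, of "axis j 1" "axis i 1"]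
    by (metis inner_commute matrix_nth)
  then show ?thesis by (simp add: transpose_def vec_eq_iff)
qed

lemma pad_inv_eq:
  assumes A: "transpose A = A" and B: "block_inverse a A B"
  shows "pad_inv a A = B"
  unfolding pad_inv_def block_inverse_def[symmetric]
  by (rule the_equality, rule B) (rule block_inverse_unique[OF A _ B])

lemma block_inverse_mult_left:
  assumes A: "transpose A = A" and B: "block_inverse a A B" and z: "\<And>i. i \<notin> a \<Longrightarrow> z $ i = 0"
  shows "B *v (A *v z) = z"
proof -
  have "x \<bullet> (B *v (A *v z)) = x \<bullet> z" for x
  proof -
    have "x \<bullet> (B *v (A *v z)) = (A *v (B *v x)) \<bullet> z"
      using block_inverse_dot[OF A B B, of x "A *v z"] sym_dot[OF A] by simp
    also have "\<dots> = z \<bullet> x"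
      using dot_supp_cong[of a z "A *v (B *v x)" x] z block_inverse_mult[OF B] by (simp add: inner_commute)
    finally show ?thesis by (simp add: inner_commute)
  qed
  then show ?thesis by (metis vector_eq_ldot)
qed

text \<open>Here \<open>b\<close> holds the negated regression coefficients of \<open>v\<close> on \<open>a\<close>, and
  \<open>b \<bullet> (A *v b)\<close> is the residual sum of squares (the Schur complement).\<close>
lemma block_inverse_insert:
  assumes A: "transpose A = A" and B: "block_inverse a A B" and v: "v \<notin> a"
    and b: "b = axis v 1 - B *v (A *v axis v 1)" and r: "r = b \<bullet> (A *v b)" "r \<noteq> 0"
  shows "block_inverse (insert v a) A (\<chi> i j. B $ i $ j + b $ i * b $ j / r)"
proof -
  have bv: "b $ v = 1" using block_inverse_mult_supp[OF B v] by (simp add: b axis_def)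
  have b0: "b $ i = 0" if "i \<notin> insert v a" for i
    using that block_inverse_mult_supp[OF B, of i] by (simp add: b axis_def)
  have Ab: "(A *v b) $ i = 0" if "i \<in> a" for i
    using block_inverse_mult[OF B that] by (simp add: b matrix_vector_mult_diff_distrib)
  \<comment> \<open>\<open>A *v b\<close> vanishes on \<open>a\<close>, and \<open>b\<close>
    vanishes outside \<open>insert v a\<close> with \<open>b $ v = 1\<close>, so only one term of
    the quadratic form survives.\<close>
  have rv: "(A *v b) $ v = r"
  proof -
    have "r = b \<bullet> ((A *v b) $ v *\<^sub>R axis v 1)"
      unfolding r using b0 Ab by (intro dot_supp_cong[of "insert v a"]) (auto simp: axis_def v)
    then show ?thesis by (simp add: inner_axis bv)
  qed
  have col: "(\<Sum>k\<in>insert v a. A $ i $ k * (B $ k $ j + b $ k * b $ j / r))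
     = (A *v (B *v axis j 1)) $ i + (A *v b) $ i * b $ j / r" for i j
  proof -
    have "(\<Sum>k\<in>insert v a. A $ i $ k * (B $ k $ j + b $ k * b $ j / r)) =
      (\<Sum>k\<in>UNIV. A $ i $ k * (B $ k $ j + b $ k * b $ j / r))"
      using b0 block_inverse_zero[OF B] by (intro sum_UNIV_subset[symmetric]) auto
    also have "\<dots> = (\<Sum>k\<in>UNIV. A $ i $ k * B $ k $ j) + (\<Sum>k\<in>UNIV. A $ i $ k * b $ k) * b $ j / r"
      by (simp add: algebra_simps sum.distrib sum_distrib_left sum_divide_distrib)
    finally show ?thesis
      by (simp add: matrix_vector_mult_basis) (simp add: matrix_vector_mult_def column_def)
  qed
  show ?thesis
    unfolding block_inverse_def
  proof (intro conjI ballI allI impI)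
    fix i j assume "i \<notin> insert v a \<or> j \<notin> insert v a"
    then show "(\<chi> i j. B $ i $ j + b $ i * b $ j / r) $ i $ j = 0"
      using b0 block_inverse_zero[OF B] by auto
  next
    fix i j assume i: "i \<in> insert v a" and j: "j \<in> insert v a"
    have "(A *v (B *v axis j 1)) $ i + (A *v b) $ i * b $ j / r = (if i = j then 1 else 0)"
    proof (cases "i = v")
      case False
      then have "i \<in> a" using i by auto
      then show ?thesis
        using block_inverse_mult[OF B, of i "axis j 1"] Ab by (auto simp: axis_def)
    next
      case True
      have Bv: "B *v axis v 1 = 0"
        using block_inverse_zero[OF B] v by (simp add: vec_eq_iff matrix_vector_mult_basis column_def)
      show ?thesis
      proof (cases "j = v")
        case True
        then show ?thesis using \<open>i = v\<close> rv r Bv by (simp add: bv)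
      next
        case False
        \<comment> \<open>In row \<open>v\<close> and column \<open>j\<close> of \<open>a\<close>,
          symmetry turns \<open>(A *v (B *v axis j 1)) $ v\<close> into \<open>- b $ j\<close>,
          which cancels the rank-one term.\<close>
        have "b $ j = axis j 1 \<bullet> b" by (simp add: inner_axis')
        also have "\<dots> = - (axis j 1 \<bullet> (B *v (A *v axis v 1)))"
          using False by (simp add: b inner_diff_right inner_axis_axis)
        also have "\<dots> = - ((A *v (B *v axis j 1)) $ v)"
          using block_inverse_dot[OF A B B, of "axis j 1" "A *v axis v 1"] sym_dot[OF A, of "B *v axis j 1" "axis v 1"]
          by (simp add: inner_axis)
        finally show ?thesis using \<open>i = v\<close> False rv r by simp
      qed
    qed
    then show "(\<Sum>k\<in>insert v a. A $ i $ k * (\<chi> i j. B $ i $ j + b $ i * b $ j / r) $ k $ j) = (if i = j then 1 else 0)"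
      using col[of i j] by simp
  qed
qed

section \<open>Integration by parts for Gaussian samples\<close>

lemma lborel_integrable_translate:
  fixes f :: "'a::euclidean_space \<Rightarrow> real"
  assumes "integrable lborel f"
  shows "integrable lborel (\<lambda>x. f (c + x))" "(\<integral>x. f (c + x) \<partial>lborel) = (\<integral>x. f x \<partial>lborel)"
proof -
  have [measurable]: "f \<in> borel_measurable borel" using assms by auto
  have "integrable (distr lborel borel ((+) c)) f" using assms by (simp add: lborel_distr_plus)
  then show "integrable lborel (\<lambda>x. f (c + x))"
    by (subst (asm) integrable_distr_eq) auto
  have "(\<integral>x. f x \<partial>distr lborel borel ((+) c)) = (\<integral>x. f (c + x) \<partial>lborel)"
    by (subst integral_distr) auto
  then show "(\<integral>x. f (c + x) \<partial>lborel) = (\<integral>x. f x \<partial>lborel)" by (simp add: lborel_distr_plus)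
qed

text \<open>Averaging the derivative over a unit step gives a difference of translates, which has
  integral zero; no decay at infinity is needed.\<close>
lemma integral_directional_derivative:
  fixes F G :: "'a::euclidean_space \<Rightarrow> real"
  assumes F: "integrable lborel F" and G: "integrable lborel G"
    and der: "\<And>x. ((\<lambda>\<tau>. F (x + \<tau> *\<^sub>R w)) has_real_derivative G x) (at 0)"
  shows "(\<integral>x. G x \<partial>lborel) = 0"
proof -
  have [measurable]: "G \<in> borel_measurable borel" using G by auto
  define f where "f \<tau> x = indicator {0..1} \<tau> * G (\<tau> *\<^sub>R w + x)" for \<tau> :: real and x
  have int: "integrable (lborel \<Otimes>\<^sub>M lborel) (case_prod f)"
  proof (rule lborel_pair.Fubini_integrable)
    show "case_prod f \<in> borel_measurable (lborel \<Otimes>\<^sub>M lborel)"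
      unfolding f_def by measurable
    have "(\<integral>x. norm (case_prod f (\<tau>, x)) \<partial>lborel) = indicator {0..1} \<tau> * (\<integral>x. norm (G x) \<partial>lborel)" for \<tau>
      using lborel_integrable_translate(2)[OF integrable_norm[OF G], of "\<tau> *\<^sub>R w"]
      by (simp add: f_def abs_mult)
    then show "integrable lborel (\<lambda>\<tau>. \<integral>x. norm (case_prod f (\<tau>, x)) \<partial>lborel)"
      by (simp add: integrable_real_indicator)
    show "AE \<tau> in lborel. integrable lborel (\<lambda>x. case_prod f (\<tau>, x))"
      using lborel_integrable_translate(1)[OF G] by (simp add: f_def)
  qed
  have "(\<integral>x. (\<integral>\<tau>. f \<tau> x \<partial>lborel) \<partial>lborel) = (\<integral>\<tau>. (\<integral>x. f \<tau> x \<partial>lborel) \<partial>lborel)"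
    using lborel_pair.integral_fst[OF int] lborel_pair.integral_snd[OF int] by simp
  also have "\<dots> = (\<integral>\<tau>. indicator {0..1} \<tau> * (\<integral>x. G x \<partial>lborel) \<partial>(lborel :: real measure))"
    using lborel_integrable_translate(2)[OF G] by (simp add: f_def)
  also have "\<dots> = (\<integral>x. G x \<partial>lborel)" by simp
  finally have 1: "(\<integral>x. (\<integral>\<tau>. f \<tau> x \<partial>lborel) \<partial>lborel) = (\<integral>x. G x \<partial>lborel)" .
  \<comment> \<open>The fundamental theorem of calculus gives a gauge integral. Fubini makes almost
    every slice Lebesgue integrable, and for those slices the two integrals agree.\<close>
  have "AE x in lborel. (\<integral>\<tau>. f \<tau> x \<partial>lborel) = F (w + x) - F x"
    using lborel_pair.AE_integrable_snd[OF int]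
  proof eventually_elim
    case (elim x)
    then have si: "set_integrable lborel {0..1} (\<lambda>\<tau>. G (\<tau> *\<^sub>R w + x))"
      by (simp add: set_integrable_def f_def)
    have "((\<lambda>\<tau>. F (x + \<tau> *\<^sub>R w)) has_real_derivative G (\<sigma> *\<^sub>R w + x)) (at \<sigma>)" for \<sigma>
    proof -
      have "((\<lambda>\<tau>. \<tau> - \<sigma>) has_real_derivative 1) (at \<sigma>)"
        by (auto intro!: derivative_eq_intros)
      then have "((\<lambda>\<tau>. F ((x + \<sigma> *\<^sub>R w) + (\<tau> - \<sigma>) *\<^sub>R w)) has_real_derivative G (x + \<sigma> *\<^sub>R w) * 1) (at \<sigma>)"
        by (rule DERIV_chain'[where g="\<lambda>\<tau>. F ((x + \<sigma> *\<^sub>R w) + \<tau> *\<^sub>R w)"])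
           (use der[of "x + \<sigma> *\<^sub>R w"] in simp)
      then show ?thesis by (simp add: algebra_simps)
    qed
    then have "((\<lambda>\<tau>. G (\<tau> *\<^sub>R w + x)) has_integral (F (x + 1 *\<^sub>R w) - F (x + 0 *\<^sub>R w))) {0..1}"
      by (intro fundamental_theorem_of_calculus)
         (auto intro: has_vector_derivative_at_within simp: has_real_derivative_iff_has_vector_derivative)
    then have "integral {0..1} (\<lambda>\<tau>. G (\<tau> *\<^sub>R w + x)) = F (w + x) - F x"
      by (simp add: integral_unique add.commute)
    with set_borel_integral_eq_integral(2)[OF si] show ?case
      by (simp add: set_lebesgue_integral_def f_def)
  qed
  then have "(\<integral>x. (\<integral>\<tau>. f \<tau> x \<partial>lborel) \<partial>lborel) = (\<integral>x. F (w + x) - F x \<partial>lborel)"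
    using int F by (intro integral_cong_AE) (auto simp: f_def intro: borel_measurable_diff)
  also have "\<dots> = 0"
    using lborel_integrable_translate[OF F, of w] F by simp
  finally show ?thesis using 1 by simp
qed

section \<open>Functions of at most exponential growth in the sample\<close>

text \<open>The class is closed under products without bookkeeping of degrees, and its bound
  factorises over the observations, so integrability reduces to a single Gaussian vector.\<close>

definition exp_bounded :: "nat \<Rightarrow> ((nat \<Rightarrow> 'v::real_normed_vector) \<Rightarrow> real) \<Rightarrow> bool" where
  "exp_bounded n f \<longleftrightarrow> (\<exists>C k. 0 \<le> C \<and> 0 \<le> k \<and> (\<forall>y. \<bar>f y\<bar> \<le> C * exp (k * (\<Sum>s\<in>{1..n}. norm (y s)))))"

lemma exp_boundedI:
  assumes "\<And>y. \<bar>f y\<bar> \<le> C * exp (k * (\<Sum>s\<in>{1..n}. norm (y s)))" "0 \<le> C" "0 \<le> k"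
  shows "exp_bounded n f"
  using assms by (auto simp: exp_bounded_def)

lemma exp_boundedE:
  assumes "exp_bounded n f"
  obtains C k where "0 \<le> C" "0 \<le> k" "\<And>y. \<bar>f y\<bar> \<le> C * exp (k * (\<Sum>s\<in>{1..n}. norm (y s)))"
  using assms by (auto simp: exp_bounded_def)

lemma exp_bounded_bounded: "(\<And>y. \<bar>f y\<bar> \<le> C) \<Longrightarrow> exp_bounded n f"
  by (rule exp_boundedI[of f C 0]) (auto intro: order.trans[OF abs_ge_zero])

lemma exp_bounded_const [intro]: "exp_bounded n (\<lambda>_. c)"
  by (rule exp_bounded_bounded[of _ "\<bar>c\<bar>"]) simp

lemma exp_bounded_add [intro]:
  assumes "exp_bounded n f" "exp_bounded n g"
  shows "exp_bounded n (\<lambda>y. f y + g y)"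
proof -
  obtain C k D l where *: "0 \<le> C" "0 \<le> k" "\<And>y. \<bar>f y\<bar> \<le> C * exp (k * (\<Sum>s\<in>{1..n}. norm (y s)))"
    "0 \<le> D" "0 \<le> l" "\<And>y. \<bar>g y\<bar> \<le> D * exp (l * (\<Sum>s\<in>{1..n}. norm (y s)))"
    using assms by (metis exp_boundedE)
  show ?thesis
  proof (rule exp_boundedI[of _ "C + D" "max k l"])
    fix y :: "nat \<Rightarrow> 'a"
    let ?r = "\<Sum>s\<in>{1..n}. norm (y s)"
    have r: "0 \<le> ?r" by (simp add: sum_nonneg)
    have "\<bar>f y + g y\<bar> \<le> C * exp (k * ?r) + D * exp (l * ?r)"
      using *(3)[of y] *(6)[of y] by linarith
    also have "\<dots> \<le> C * exp (max k l * ?r) + D * exp (max k l * ?r)"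
      using * r by (intro add_mono mult_left_mono) (auto intro: mult_right_mono)
    finally show "\<bar>f y + g y\<bar> \<le> (C + D) * exp (max k l * ?r)" by (simp add: algebra_simps)
  qed (use * in auto)
qed

lemma exp_bounded_mult [intro]:
  assumes "exp_bounded n f" "exp_bounded n g"
  shows "exp_bounded n (\<lambda>y. f y * g y)"
proof -
  obtain C k D l where *: "0 \<le> C" "0 \<le> k" "\<And>y. \<bar>f y\<bar> \<le> C * exp (k * (\<Sum>s\<in>{1..n}. norm (y s)))"
    "0 \<le> D" "0 \<le> l" "\<And>y. \<bar>g y\<bar> \<le> D * exp (l * (\<Sum>s\<in>{1..n}. norm (y s)))"
    using assms by (metis exp_boundedE)
  show ?thesis
  proof (rule exp_boundedI[of _ "C * D" "k + l"])
    fix y :: "nat \<Rightarrow> 'a"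
    let ?r = "\<Sum>s\<in>{1..n}. norm (y s)"
    have "\<bar>f y * g y\<bar> \<le> (C * exp (k * ?r)) * (D * exp (l * ?r))"
      unfolding abs_mult using * by (intro mult_mono) auto
    then show "\<bar>f y * g y\<bar> \<le> (C * D) * exp ((k + l) * ?r)" by (simp add: algebra_simps exp_add)
  qed (use * in auto)
qed

lemma exp_bounded_uminus [intro]: "exp_bounded n f \<Longrightarrow> exp_bounded n (\<lambda>y. - f y)"
  by (auto simp: exp_bounded_def)

lemma exp_bounded_diff [intro]:
  "exp_bounded n f \<Longrightarrow> exp_bounded n g \<Longrightarrow> exp_bounded n (\<lambda>y. f y - g y)"
  using exp_bounded_add[of n f "\<lambda>y. - g y"] by auto

lemma exp_bounded_sum [intro]:
  "(\<And>i. i \<in> I \<Longrightarrow> exp_bounded n (f i)) \<Longrightarrow> exp_bounded n (\<lambda>y. \<Sum>i\<in>I. f i y)"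
  by (induction I rule: infinite_finite_induct) auto

lemma exp_bounded_component [intro]:
  fixes i :: "'p::finite"
  assumes "t \<in> {1..n}"
  shows "exp_bounded n (\<lambda>y. (y t :: real^'p) $ i)"
proof (rule exp_boundedI[of _ 1 1])
  fix y :: "nat \<Rightarrow> real^'p"
  have "\<bar>y t $ i\<bar> \<le> norm (y t)" by (rule component_le_norm_cart)
  also have "\<dots> \<le> (\<Sum>s\<in>{1..n}. norm (y s))" using assms by (intro member_le_sum) auto
  also have "\<dots> \<le> exp (\<Sum>s\<in>{1..n}. norm (y s))"
    using exp_ge_add_one_self[of "\<Sum>s\<in>{1..n}. norm (y s)"] by linarith
  finally show "\<bar>y t $ i\<bar> \<le> 1 * exp (1 * (\<Sum>s\<in>{1..n}. norm (y s)))" by simp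
qed auto

section \<open>Gaussian vectors: integrability and Stein's identity\<close>

locale gaussian_sample =
  fixes K :: "real^'p::finite^'p" and n :: nat
  assumes pos_def: "pos_def K"
    and prob: "prob_space (density lborel (\<lambda>v. ennreal (gauss_density K v)))"
begin

definition gauss :: "(real^'p) measure" where
  "gauss = density lborel (\<lambda>v. ennreal (gauss_density K v))"

definition samples :: "(nat \<Rightarrow> real^'p) measure" where
  "samples = PiM {1..n} (\<lambda>_. gauss)"

lemma prob_gauss: "prob_space gauss"
  using prob by (simp add: gauss_def)

lemma prob_samples: "prob_space samples"
  unfolding samples_def by (intro prob_space_PiM prob_gauss)

lemma sets_gauss [measurable_cong, simp]: "sets gauss = sets borel"
  by (simp add: gauss_def)

lemma space_gauss [simp]: "space gauss = UNIV"
  by (simp add: gauss_def)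

lemma sets_samples [measurable_cong]: "sets samples = sets (PiM {1..n} (\<lambda>_. borel))"
  unfolding samples_def by (intro sets_PiM_cong) auto

lemma K_sym: "transpose K = K"
  using pos_def by (simp add: pos_def_def)

lemma K_pos: "x \<noteq> 0 \<Longrightarrow> 0 < x \<bullet> (K *v x)"
  using pos_def by (simp add: pos_def_def)

lemma quadratic_measurable [measurable]:
  "(\<lambda>x. x \<bullet> (K *v x)) \<in> borel_measurable borel" "(\<lambda>x. x \<bullet> (K *v w)) \<in> borel_measurable borel"
  by (intro borel_measurable_continuous_onI continuous_intros
      linear_continuous_on matrix_vector_mul_linear linear_linear)+

lemma gauss_density_measurable [measurable]: "gauss_density K \<in> borel_measurable borel"
  unfolding gauss_density_def by measurable

text \<open>Total mass one forces the constant to be positive: otherwise the density, cut off at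
  zero by \<open>ennreal\<close>, would vanish identically.\<close>

lemma density_const:
  obtains c where "c > 0" "\<And>x. gauss_density K x = c * exp (- (x \<bullet> (K *v x)) / 2)"
proof -
  define c where "c = sqrt (det K) / (2 * pi) powr (real CARD('p) / 2)"
  have eq: "gauss_density K x = c * exp (- (x \<bullet> (K *v x)) / 2)" for x
    by (simp add: gauss_density_def c_def)
  have "c > 0"
  proof (rule ccontr)
    assume "\<not> c > 0"
    then have "ennreal (gauss_density K x) = 0" for x
      unfolding eq by (intro ennreal_neg mult_nonpos_nonneg) auto
    then have "emeasure gauss (space gauss) = 0"
      unfolding gauss_def by (simp add: emeasure_density)
    then show False using prob_space.emeasure_space_1[OF prob_gauss] by simp
  qed
  then show ?thesis using eq that by blast
qed

lemma quadratic_lower_bound: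
  obtains l where "l > 0" "\<And>x. l * (norm x)\<^sup>2 \<le> x \<bullet> (K *v x)"
proof -
  have "continuous_on (sphere 0 1) (\<lambda>x. x \<bullet> (K *v x))"
    by (intro continuous_intros linear_continuous_on matrix_vector_mul_linear linear_linear)
  moreover have "sphere (0 :: real^'p) 1 \<noteq> {}" by simp
  ultimately obtain z where z: "z \<in> sphere 0 1" "\<And>x. x \<in> sphere 0 1 \<Longrightarrow> z \<bullet> (K *v z) \<le> x \<bullet> (K *v x)"
    using continuous_attains_inf[OF compact_sphere] by blast
  show ?thesis
  proof
    have "z \<noteq> 0" using z(1) by auto
    then show "0 < z \<bullet> (K *v z)" by (rule K_pos)
    fix x :: "real^'p"
    show "z \<bullet> (K *v z) * (norm x)\<^sup>2 \<le> x \<bullet> (K *v x)"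
    proof (cases "x = 0")
      case False
      define u where "u = inverse (norm x) *\<^sub>R x"
      have "u \<in> sphere 0 1" using False by (simp add: u_def)
      then have "z \<bullet> (K *v z) * (norm x)\<^sup>2 \<le> u \<bullet> (K *v u) * (norm x)\<^sup>2"
        by (intro mult_right_mono z) auto
      also have "\<dots> = (norm x *\<^sub>R u) \<bullet> (K *v (norm x *\<^sub>R u))"
        by (simp add: matrix_vector_mult_scaleR power2_eq_square)
      also have "norm x *\<^sub>R u = x" using False by (simp add: u_def)
      finally show ?thesis .
    qed simp
  qed
qed

text \<open>Half of the Gaussian exponent is still integrable, by rescaling with
  \<open>1 / sqrt 2\<close>; the other half is kept to absorb factors
  \<open>exp (k * norm x)\<close>.\<close>

lemma integrable_exp_quadratic:
  "integrable lborel (\<lambda>x. exp (- (x \<bullet> (K *v x)) / 2))"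
  "integrable lborel (\<lambda>x. exp (- (x \<bullet> (K *v x)) / 4))"
proof -
  obtain c where c: "c > 0" "\<And>x. gauss_density K x = c * exp (- (x \<bullet> (K *v x)) / 2)"
    using density_const by metis
  have "(\<integral>\<^sup>+x. ennreal (c * exp (- (x \<bullet> (K *v x)) / 2)) \<partial>lborel) = emeasure gauss (space gauss)"
    unfolding gauss_def by (simp add: emeasure_density c(2))
  also have "\<dots> = 1" by (rule prob_space.emeasure_space_1[OF prob_gauss])
  finally have "integrable lborel (\<lambda>x. c * exp (- (x \<bullet> (K *v x)) / 2))"
    using c by (intro integrableI_nonneg) auto
  then show 1: "integrable lborel (\<lambda>x. exp (- (x \<bullet> (K *v x)) / 2))"
    using c by simp
  define s where "s = (1 / sqrt 2 :: real)"
  have s: "s \<noteq> 0" "s * s = 1 / 2" by (auto simp: s_def)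
  have "integrable (density (distr lborel borel (\<lambda>x. 0 + s *\<^sub>R x)) (\<lambda>_. ennreal (\<bar>s\<bar> ^ DIM(real^'p))))
    (\<lambda>x. exp (- (x \<bullet> (K *v x)) / 2))"
    using 1 lborel_affine[OF s(1), of "0 :: real^'p"] by metis
  then have "integrable lborel (\<lambda>x. \<bar>s\<bar> ^ DIM(real^'p) *\<^sub>R exp (- ((s *\<^sub>R x) \<bullet> (K *v (s *\<^sub>R x))) / 2))"
    by (subst (asm) integrable_density) (auto simp: integrable_distr_eq)
  also have "(\<lambda>x. (s *\<^sub>R x) \<bullet> (K *v (s *\<^sub>R x))) = (\<lambda>x. (x \<bullet> (K *v x)) / 2)"
    using s by (simp add: matrix_vector_mult_scaleR fun_eq_iff flip: mult.assoc)
  finally show "integrable lborel (\<lambda>x. exp (- (x \<bullet> (K *v x)) / 4))"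
    using s by simp
qed

lemma integrable_exp_norm_quadratic:
  assumes "0 \<le> k"
  shows "integrable lborel (\<lambda>x. exp (k * norm x) * exp (- (x \<bullet> (K *v x)) / 2))"
proof -
  obtain l where l: "l > 0" "\<And>x. l * (norm x)\<^sup>2 \<le> x \<bullet> (K *v x)"
    using quadratic_lower_bound by metis
  show ?thesis
  proof (rule Bochner_Integration.integrable_bound)
    show "integrable lborel (\<lambda>x. exp (k\<^sup>2 / l) * exp (- (x \<bullet> (K *v x)) / 4))"
      by (intro integrable_mult_right integrable_exp_quadratic)
    show "AE x in lborel. norm (exp (k * norm x) * exp (- (x \<bullet> (K *v x)) / 2))
        \<le> norm (exp (k\<^sup>2 / l) * exp (- (x \<bullet> (K *v x)) / 4))"
    proof (rule AE_I2)
      fix x :: "real^'p"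
      \<comment> \<open>Completing the square bounds \<open>k * norm x\<close> by
        \<open>k\<^sup>2 / l\<close> plus a quarter of \<open>l * (norm x)\<^sup>2\<close>, hence by
        \<open>k\<^sup>2 / l\<close> plus a quarter of the quadratic form.\<close>
      have "0 \<le> (l * norm x / 2 - k)\<^sup>2 / l" using l by simp
      also have "\<dots> = l * (norm x)\<^sup>2 / 4 - k * norm x + k\<^sup>2 / l"
        using l by (simp add: power2_eq_square field_simps)
      finally have "k * norm x - (x \<bullet> (K *v x)) / 2 \<le> k\<^sup>2 / l - (x \<bullet> (K *v x)) / 4"
        using l(2)[of x] by linarith
      then show "norm (exp (k * norm x) * exp (- (x \<bullet> (K *v x)) / 2))
        \<le> norm (exp (k\<^sup>2 / l) * exp (- (x \<bullet> (K *v x)) / 4))"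
        by (simp flip: exp_add)
    qed
  qed measurable
qed

lemma integrable_bounded_quadratic:
  assumes [measurable]: "f \<in> borel_measurable borel" and f: "\<And>x. \<bar>f x\<bar> \<le> C * exp (k * norm x)"
    and "0 \<le> k"
  shows "integrable lborel (\<lambda>x. f x * exp (- (x \<bullet> (K *v x)) / 2))"
proof (rule Bochner_Integration.integrable_bound)
  show "integrable lborel (\<lambda>x. C * (exp (k * norm x) * exp (- (x \<bullet> (K *v x)) / 2)))"
    using assms by (intro integrable_mult_right integrable_exp_norm_quadratic)
  have "\<bar>f x\<bar> * exp (- (x \<bullet> (K *v x)) / 2) \<le> \<bar>C * (exp (k * norm x) * exp (- (x \<bullet> (K *v x)) / 2))\<bar>" for x
  proof -
    have "\<bar>f x\<bar> \<le> \<bar>C\<bar> * exp (k * norm x)"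
      by (rule order.trans[OF f[of x]]) (simp add: mult_right_mono)
    then have "\<bar>f x\<bar> * exp (- (x \<bullet> (K *v x)) / 2) \<le> \<bar>C\<bar> * exp (k * norm x) * exp (- (x \<bullet> (K *v x)) / 2)"
      by (rule mult_right_mono) simp
    then show ?thesis by (simp only: abs_mult abs_exp_cancel mult.assoc)
  qed
  then show "AE x in lborel. norm (f x * exp (- (x \<bullet> (K *v x)) / 2))
      \<le> norm (C * (exp (k * norm x) * exp (- (x \<bullet> (K *v x)) / 2)))"
    by (simp add: abs_mult)
qed measurable

lemma integral_gauss:
  assumes [measurable]: "f \<in> borel_measurable borel"
    and c: "c > 0" "\<And>x. gauss_density K x = c * exp (- (x \<bullet> (K *v x)) / 2)"
  shows "integrable gauss f \<longleftrightarrow> integrable lborel (\<lambda>x. f x * exp (- (x \<bullet> (K *v x)) / 2))"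
    and "(\<integral>x. f x \<partial>gauss) = c * (\<integral>x. f x * exp (- (x \<bullet> (K *v x)) / 2) \<partial>lborel)"
proof -
  have eq: "gauss_density K x * f x = c * (f x * exp (- (x \<bullet> (K *v x)) / 2))" for x
    by (simp add: c)
  have nn: "AE x in lborel. 0 \<le> gauss_density K x" using c by simp
  show "integrable gauss f \<longleftrightarrow> integrable lborel (\<lambda>x. f x * exp (- (x \<bullet> (K *v x)) / 2))"
    unfolding gauss_def by (subst integrable_density) (use c(1) nn in \<open>simp_all add: eq\<close>)
  show "(\<integral>x. f x \<partial>gauss) = c * (\<integral>x. f x * exp (- (x \<bullet> (K *v x)) / 2) \<partial>lborel)"
    unfolding gauss_def by (subst integral_density) (use nn in \<open>simp_all add: eq\<close>)
qed

lemma integrable_gauss_bounded: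
  assumes "f \<in> borel_measurable borel" "\<And>x. \<bar>f x\<bar> \<le> C * exp (k * norm x)" "0 \<le> k"
  shows "integrable gauss f"
proof -
  obtain c where c: "c > 0" "\<And>x. gauss_density K x = c * exp (- (x \<bullet> (K *v x)) / 2)"
    using density_const by metis
  show ?thesis
    unfolding integral_gauss(1)[OF assms(1) c] by (rule integrable_bounded_quadratic[OF assms])
qed

text \<open>Along \<open>w\<close>, the product of \<open>f\<close> with the Gaussian exponential
  has derivative \<open>g x - f x * (x \<bullet> (K *v w))\<close> times that exponential, and a
  directional derivative integrates to zero.\<close>

lemma stein_single:
  assumes f: "f \<in> borel_measurable borel" "\<And>x. \<bar>f x\<bar> \<le> C * exp (k * norm x)"
    and g: "g \<in> borel_measurable borel" "\<And>x. \<bar>g x\<bar> \<le> D * exp (k * norm x)"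
    and k: "0 \<le> k"
    and der: "\<And>x. ((\<lambda>\<tau>. f (x + \<tau> *\<^sub>R w)) has_real_derivative g x) (at 0)"
  shows "(\<integral>x. g x \<partial>gauss) = (\<integral>x. f x * (x \<bullet> (K *v w)) \<partial>gauss)"
proof -
  note [measurable] = f(1) g(1)
  obtain c where c: "c > 0" "\<And>x. gauss_density K x = c * exp (- (x \<bullet> (K *v x)) / 2)"
    using density_const by metis
  define \<rho> where "\<rho> x = exp (- (x \<bullet> (K *v x)) / 2)" for x
  have bound: "\<bar>f x * (x \<bullet> (K *v w))\<bar> \<le> (\<bar>C\<bar> * norm (K *v w)) * exp ((k + 1) * norm x)" for x
  proof -
    have "\<bar>x \<bullet> (K *v w)\<bar> \<le> norm x * norm (K *v w)" by (rule Cauchy_Schwarz_ineq2)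
    also have "\<dots> \<le> exp (norm x) * norm (K *v w)"
      using exp_ge_add_one_self[of "norm x"] by (intro mult_right_mono) (linarith, simp)
    finally have 1: "\<bar>x \<bullet> (K *v w)\<bar> \<le> exp (norm x) * norm (K *v w)" .
    have "\<bar>f x\<bar> \<le> \<bar>C\<bar> * exp (k * norm x)"
      by (rule order.trans[OF f(2)[of x]]) (simp add: mult_right_mono)
    from mult_mono[OF this 1] have "\<bar>f x * (x \<bullet> (K *v w))\<bar> \<le> (\<bar>C\<bar> * exp (k * norm x)) * (exp (norm x) * norm (K *v w))"
      by (simp add: abs_mult)
    also have "\<dots> = (\<bar>C\<bar> * norm (K *v w)) * exp ((k + 1) * norm x)"
      by (simp add: algebra_simps exp_add)
    finally show ?thesis .
  qed
  have i1: "integrable lborel (\<lambda>x. f x * \<rho> x)" "integrable lborel (\<lambda>x. g x * \<rho> x)"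
    "integrable lborel (\<lambda>x. f x * (x \<bullet> (K *v w)) * \<rho> x)"
    unfolding \<rho>_def using k
    by (intro integrable_bounded_quadratic[OF _ f(2)] integrable_bounded_quadratic[OF _ g(2)]
        integrable_bounded_quadratic[OF _ bound]; simp; fail)+
  have "(\<integral>x. g x * \<rho> x - f x * (x \<bullet> (K *v w)) * \<rho> x \<partial>lborel) = 0"
  proof (rule integral_directional_derivative[where w=w])
    fix x
    have "((\<lambda>\<tau>. (x + \<tau> *\<^sub>R w) \<bullet> (K *v (x + \<tau> *\<^sub>R w))) has_real_derivative 2 * (x \<bullet> (K *v w))) (at 0)"
    proof -
      have "w \<bullet> (K *v x) = x \<bullet> (K *v w)" using sym_dot[OF K_sym, of w x] by (simp add: inner_commute)
      then have "(\<lambda>\<tau>. (x + \<tau> *\<^sub>R w) \<bullet> (K *v (x + \<tau> *\<^sub>R w))) =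
        (\<lambda>\<tau>. x \<bullet> (K *v x) + \<tau> * (2 * (x \<bullet> (K *v w))) + \<tau> * \<tau> * (w \<bullet> (K *v w)))"
        by (simp add: fun_eq_iff matrix_vector_right_distrib matrix_vector_mult_scaleR inner_add_left inner_add_right algebra_simps)
      then show ?thesis by (auto intro!: derivative_eq_intros)
    qed
    then have "((\<lambda>\<tau>. \<rho> (x + \<tau> *\<^sub>R w)) has_real_derivative \<rho> x * (- (x \<bullet> (K *v w)))) (at 0)"
      unfolding \<rho>_def by (auto intro!: derivative_eq_intros)
    from DERIV_mult[OF der[of x] this]
    show "((\<lambda>\<tau>. f (x + \<tau> *\<^sub>R w) * \<rho> (x + \<tau> *\<^sub>R w)) has_real_derivative
       g x * \<rho> x - f x * (x \<bullet> (K *v w)) * \<rho> x) (at 0)"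
      by (simp add: algebra_simps)
  qed (use i1 in auto)
  then show ?thesis
    using i1 integral_gauss(2)[OF g(1) c] integral_gauss(2)[OF _ c, of "\<lambda>x. f x * (x \<bullet> (K *v w))"]
    by (simp add: \<rho>_def)
qed

lemma sigma_finite_gauss: "product_sigma_finite (\<lambda>_ :: nat. gauss)"
  using prob_space_imp_sigma_finite[OF prob_gauss] by (simp add: product_sigma_finite_def)

lemma integrable_exp_bounded:
  assumes [measurable]: "f \<in> borel_measurable samples" and "exp_bounded n f"
  shows "integrable samples f"
proof -
  interpret product_sigma_finite "\<lambda>_ :: nat. gauss" by (rule sigma_finite_gauss)
  obtain C k where *: "0 \<le> C" "0 \<le> k" "\<And>y. \<bar>f y\<bar> \<le> C * exp (k * (\<Sum>s\<in>{1..n}. norm (y s)))"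
    using assms by (metis exp_boundedE)
  have "integrable samples (\<lambda>y. \<Prod>s\<in>{1..n}. exp (k * norm (y s)))"
    unfolding samples_def
    by (intro product_integrable_prod integrable_gauss_bounded[where C=1 and k=k]) (use * in auto)
  then have "integrable samples (\<lambda>y. C * exp (k * (\<Sum>s\<in>{1..n}. norm (y s))))"
    by (simp add: exp_sum sum_distrib_left)
  then show ?thesis
    by (rule Bochner_Integration.integrable_bound) (use * in \<open>auto simp: abs_mult\<close>)
qed

lemma stein:
  assumes t: "t \<in> {1..n}"
    and f: "f \<in> borel_measurable samples" "exp_bounded n f"
    and g: "g \<in> borel_measurable samples" "exp_bounded n g"
    and der: "\<And>y. ((\<lambda>\<tau>. f (y(t := y t + \<tau> *\<^sub>R w))) has_real_derivative g y) (at 0)"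
  shows "(\<integral>y. g y \<partial>samples) = (\<integral>y. f y * (y t \<bullet> (K *v w)) \<partial>samples)"
proof -
  interpret product_sigma_finite "\<lambda>_ :: nat. gauss" by (rule sigma_finite_gauss)
  define J where "J = {1..n} - {t}"
  have J: "insert t J = {1..n}" "t \<notin> J" "finite J" using t by (auto simp: J_def)
  have S: "samples = PiM (insert t J) (\<lambda>_. gauss)" by (simp add: samples_def J)
  have [measurable]: "(\<lambda>y. y t) \<in> samples \<rightarrow>\<^sub>M borel"
    using t unfolding samples_def by measurable
  note [measurable] = f(1) g(1)
  have lin: "exp_bounded n (\<lambda>y. y t \<bullet> (K *v w))"
    unfolding inner_vec_def inner_real_def using t
    by (intro exp_bounded_sum exp_bounded_mult exp_bounded_component exp_bounded_const)
  have fl: "integrable samples (\<lambda>y. f y * (y t \<bullet> (K *v w)))"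
    using f(2) lin by (intro integrable_exp_bounded) (measurable, rule exp_bounded_mult)
  have gi: "integrable samples g" by (rule integrable_exp_bounded[OF g])
  obtain C k D l where *: "0 \<le> C" "0 \<le> k" "\<And>y. \<bar>f y\<bar> \<le> C * exp (k * (\<Sum>s\<in>{1..n}. norm (y s)))"
    "0 \<le> D" "0 \<le> l" "\<And>y. \<bar>g y\<bar> \<le> D * exp (l * (\<Sum>s\<in>{1..n}. norm (y s)))"
    using f(2) g(2) by (metis exp_boundedE)
  \<comment> \<open>With the other observations frozen, their norms only change the constant in the
    exponential bound, so the identity for one vector applies on each fibre.\<close>
  have inner_eq: "(\<integral>u. g (y(t := u)) \<partial>gauss) = (\<integral>u. f (y(t := u)) * (u \<bullet> (K *v w)) \<partial>gauss)"
    if y: "y \<in> space (PiM J (\<lambda>_. gauss))" for y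
  proof -
    have upd: "(\<lambda>u. y(t := u)) \<in> borel \<rightarrow>\<^sub>M samples"
    proof -
      have "(\<lambda>u. y(t := u)) \<in> gauss \<rightarrow>\<^sub>M samples"
        unfolding S using y J(2) by (rule measurable_component_update)
      then show ?thesis by (simp add: measurable_cong_sets[OF sets_gauss refl])
    qed
    define a where "a = (\<Sum>s\<in>J. norm (y s))"
    have a: "0 \<le> a" by (simp add: a_def sum_nonneg)
    have sum: "(\<Sum>s\<in>{1..n}. norm ((y(t := u)) s)) = norm u + a" for u
    proof -
      have "(\<Sum>s\<in>insert t J. norm ((y(t := u)) s)) = norm u + (\<Sum>s\<in>J. norm ((y(t := u)) s))"
        by (simp add: sum.insert[OF J(3,2)])
      also have "(\<Sum>s\<in>J. norm ((y(t := u)) s)) = a"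
        unfolding a_def using J by (intro sum.cong) auto
      finally show ?thesis by (simp add: J)
    qed
    have bnd: "\<bar>h (y(t := u))\<bar> \<le> (C' * exp (k' * a)) * exp (max k l * norm u)"
      if h: "\<And>y. \<bar>h y\<bar> \<le> C' * exp (k' * (\<Sum>s\<in>{1..n}. norm (y s)))" "0 \<le> C'" and k': "k' \<le> max k l"
      for h :: "_ \<Rightarrow> real" and C' k' u
    proof -
      have "\<bar>h (y(t := u))\<bar> \<le> C' * (exp (k' * a) * exp (k' * norm u))"
        using h(1)[of "y(t := u)"] by (simp only: sum flip: exp_add) (simp add: algebra_simps)
      also have "\<dots> \<le> C' * (exp (k' * a) * exp (max k l * norm u))"
        using h k' by (intro mult_left_mono) (auto intro: mult_right_mono)
      finally show ?thesis by (simp add: mult.assoc)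
    qed
    show ?thesis
    proof (rule stein_single)
      show "(\<lambda>u. f (y(t := u))) \<in> borel_measurable borel" "(\<lambda>u. g (y(t := u))) \<in> borel_measurable borel"
        using measurable_compose[OF upd f(1)] measurable_compose[OF upd g(1)] by simp_all
      show "\<bar>f (y(t := u))\<bar> \<le> (C * exp (k * a)) * exp (max k l * norm u)" for u
        using * by (intro bnd) auto
      show "\<bar>g (y(t := u))\<bar> \<le> (D * exp (l * a)) * exp (max k l * norm u)" for u
        using * by (intro bnd) auto
      show "((\<lambda>\<tau>. f (y(t := u + \<tau> *\<^sub>R w))) has_real_derivative g (y(t := u))) (at 0)" for u
        using der[of "y(t := u)"] by simp
    qed (use * in auto)
  qed
  have "(\<integral>y. (\<integral>u. g (y(t := u)) \<partial>gauss) \<partial>PiM J (\<lambda>_. gauss))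
    = (\<integral>y. (\<integral>u. f (y(t := u)) * ((y(t := u)) t \<bullet> (K *v w)) \<partial>gauss) \<partial>PiM J (\<lambda>_. gauss))"
    by (rule Bochner_Integration.integral_cong[OF refl]) (simp add: inner_eq)
  then show ?thesis
    using product_integral_insert[OF J(3,2), of g] product_integral_insert[OF J(3,2), of "\<lambda>y. f y * (y t \<bullet> (K *v w))"]
      gi fl unfolding S by simp
qed

end

section \<open>Regression of one variable on a complete set\<close>

text \<open>A pointwise substitute for measurability with respect to the columns in
  \<open>A\<close>; it gives directly the invariance under shifts that fix these columns.\<close>

definition depends_on :: "nat \<Rightarrow> 'p set \<Rightarrow> ((nat \<Rightarrow> real^'p::finite) \<Rightarrow> 'b) \<Rightarrow> bool" where
  "depends_on n A f \<longleftrightarrow> (\<forall>y y'. (\<forall>t\<in>{1..n}. \<forall>k\<in>A. y t $ k = y' t $ k) \<longrightarrow> f y = f y')"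

lemma sample_cov_nth: "sample_cov n y $ i $ j = (\<Sum>t\<in>{1..n}. y t $ i * y t $ j)"
  by (simp add: sample_cov_def outer_def sum_component)

lemma sample_cov_sym: "transpose (sample_cov n y) = sample_cov n y"
  by (simp add: transpose_def vec_eq_iff sample_cov_nth mult.commute)

lemma sample_cov_vec: "(sample_cov n y *v z) $ i = (\<Sum>t\<in>{1..n}. (y t \<bullet> z) * y t $ i)"
proof -
  have "(sample_cov n y *v z) $ i = (\<Sum>j\<in>UNIV. \<Sum>t\<in>{1..n}. y t $ i * y t $ j * z $ j)"
    by (simp add: matrix_vector_mult_def sample_cov_nth sum_distrib_right)
  also have "\<dots> = (\<Sum>t\<in>{1..n}. \<Sum>j\<in>UNIV. y t $ i * y t $ j * z $ j)" by (rule sum.swap)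
  also have "\<dots> = (\<Sum>t\<in>{1..n}. (y t \<bullet> z) * y t $ i)"
    by (simp add: inner_vec_def sum_distrib_left mult_ac)
  finally show ?thesis .
qed

lemma sample_cov_inner: "z' \<bullet> (sample_cov n y *v z) = (\<Sum>t\<in>{1..n}. (y t \<bullet> z) * (y t \<bullet> z'))"
proof -
  have "z' \<bullet> (sample_cov n y *v z) = (\<Sum>i\<in>UNIV. \<Sum>t\<in>{1..n}. (y t \<bullet> z) * (y t $ i * z' $ i))"
    by (simp add: inner_vec_def[of z'] sample_cov_vec sum_distrib_left mult_ac)
  also have "\<dots> = (\<Sum>t\<in>{1..n}. \<Sum>i\<in>UNIV. (y t \<bullet> z) * (y t $ i * z' $ i))" by (rule sum.swap)
  also have "\<dots> = (\<Sum>t\<in>{1..n}. (y t \<bullet> z) * (y t \<bullet> z'))"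
    by (simp add: inner_vec_def[of _ z'] sum_distrib_left)
  finally show ?thesis .
qed

context gaussian_sample
begin

abbreviation "S y \<equiv> sample_cov n y"

lemma measurable_coordinate [measurable]:
  assumes "t \<in> {1..n}"
  shows "(\<lambda>y. y t $ i) \<in> borel_measurable samples"
proof -
  have "(\<lambda>y. y t) \<in> samples \<rightarrow>\<^sub>M gauss"
    unfolding samples_def using assms by (rule measurable_component_singleton)
  then have "(\<lambda>y. y t) \<in> borel_measurable samples"
    by (simp add: measurable_cong_sets[OF refl sets_gauss])
  moreover have "(\<lambda>x::real^'p. x $ i) \<in> borel_measurable borel"
    by (intro borel_measurable_continuous_onI continuous_intros)
  ultimately show ?thesis by (rule measurable_compose)
qed

lemma measurable_sample_cov [measurable]: "(\<lambda>y. sample_cov n y $ i $ j) \<in> borel_measurable samples"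
  unfolding sample_cov_nth by (intro borel_measurable_sum borel_measurable_times measurable_coordinate)

lemma exp_bounded_sample_cov: "exp_bounded n (\<lambda>y. sample_cov n y $ i $ j)"
  unfolding sample_cov_nth by (intro exp_bounded_sum exp_bounded_mult exp_bounded_component)

end

section \<open>Stein identities for one regression step\<close>

text \<open>The direction \<open>w\<close> moves column \<open>v\<close>, fixes the columns in
  \<open>A\<close>, and its score \<open>y t \<bullet> (K *v w)\<close> involves only
  \<open>v\<close> and \<open>a\<close>; its entries outside \<open>insert v A\<close> are left free
  to achieve this. \<open>P\<close> is a bounded version of the inverse block, and the bounded
  weight \<open>h\<close> vanishes wherever \<open>P\<close> is not the true inverse, so growth
  bounds hold everywhere and least squares algebra holds wherever \<open>h\<close> is
  nonzero.\<close>

locale regression = gaussian_sample K n for K :: "real^'p::finite^'p" and n +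
  fixes a A :: "'p set" and v :: 'p and w :: "real^'p" and P :: "(nat \<Rightarrow> real^'p) \<Rightarrow> real^'p^'p"
    and h :: "(nat \<Rightarrow> real^'p) \<Rightarrow> real" and N :: real
  assumes a_subset: "a \<subseteq> A" and v_notin: "v \<notin> A"
    and w_A: "\<And>k. k \<in> A \<Longrightarrow> w $ k = 0" and w_v: "w $ v = 1"
    and Kw: "\<And>i. i \<notin> insert v a \<Longrightarrow> (K *v w) $ i = 0"
    and P_measurable [measurable]: "\<And>i j. (\<lambda>y. P y $ i $ j) \<in> borel_measurable samples"
    and P_bound: "\<And>y i j. \<bar>P y $ i $ j\<bar> \<le> N"
    and P_dep: "depends_on n A P"
    and P_sym: "\<And>y. transpose (P y) = P y"
    and P_zero: "\<And>y i j. i \<notin> a \<or> j \<notin> a \<Longrightarrow> P y $ i $ j = 0"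
    and h_measurable [measurable]: "h \<in> borel_measurable samples"
    and h_bound: "\<And>y. \<bar>h y\<bar> \<le> N"
    and h_dep: "depends_on n A h"
    and h_inverse: "\<And>y. h y \<noteq> 0 \<Longrightarrow> block_inverse a (sample_cov n y) (P y)"
begin

text \<open>Where \<open>h\<close> is nonzero these are the quantities of least squares:
  \<open>e\<close> are the residuals, \<open>r\<close> is their sum of squares, and
  \<open>p t y \<bullet> y s\<close> is an entry of the hat matrix.\<close>

definition b where "b y = axis v 1 - P y *v (S y *v axis v 1)"
definition e where "e t y = b y \<bullet> y t"
definition r where "r y = (\<Sum>s\<in>{1..n}. (e s y)\<^sup>2)"
definition p where "p t y = P y *v y t"

lemma v_notin_a: "v \<notin> a"
  using a_subset v_notin by auto

lemma P_vec_zero: "i \<notin> a \<Longrightarrow> (P y *v z) $ i = 0"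
  using P_zero by (simp add: matrix_vector_mult_def)

lemma P_vec_cong:
  assumes "\<And>i. i \<in> a \<Longrightarrow> z $ i = z' $ i"
  shows "P y *v z = P y *v z'"
proof -
  have "P y $ i $ j * z $ j = P y $ i $ j * z' $ j" for i j
    using assms P_zero by (cases "j \<in> a") auto
  then show ?thesis unfolding matrix_vector_mult_def by presburger
qed

lemma P_w: "(P y *v z) \<bullet> w = 0"
proof -
  have "(P y *v z) \<bullet> w = (P y *v z) \<bullet> 0"
    by (rule dot_supp_cong[of a]) (use P_vec_zero w_A a_subset in auto)
  then show ?thesis by simp
qed

lemma b_v: "b y $ v = 1"
  using P_vec_zero[OF v_notin_a] by (simp add: b_def axis_def)

lemma b_zero: "i \<notin> insert v a \<Longrightarrow> b y $ i = 0"
  using P_vec_zero[of i y] by (auto simp: b_def axis_def)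

lemma b_w: "b y \<bullet> w = 1"
  by (simp add: b_def inner_diff_left P_w inner_axis' w_v)

lemma r_nonneg: "0 \<le> r y"
  by (simp add: r_def sum_nonneg)

lemma r_eq: "r y = b y \<bullet> (S y *v b y)"
  by (simp add: r_def sample_cov_inner e_def power2_eq_square inner_commute)

lemma P_inner_commute: "x \<bullet> (P y *v z) = (P y *v x) \<bullet> z"
  by (rule sym_dot[OF P_sym])

lemma p_eq: "p t y $ i = (P y *v axis i 1) \<bullet> y t"
  unfolding p_def P_inner_commute[symmetric] by (simp add: inner_axis')

text \<open>\<open>P\<close> and \<open>h\<close> do not see the shift, and
  \<open>S y *v axis v 1\<close> gains \<open>\<tau> *\<^sub>R y t\<close> on \<open>a\<close>.
  Hence the coefficients move linearly, and the residuals move along column \<open>t\<close> of the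
  identity minus the hat matrix.\<close>

lemma
  assumes t: "t \<in> {1..n}"
  defines "moved y \<tau> \<equiv> y(t := y t + \<tau> *\<^sub>R w)"
  shows h_shift: "h (moved y \<tau>) = h y"
    and b_shift: "b (moved y \<tau>) = b y - \<tau> *\<^sub>R p t y"
    and p_shift: "p t (moved y \<tau>) = p t y"
    and e_shift: "e s (moved y \<tau>) = e s y + \<tau> * ((if s = t then 1 else 0) - p t y \<bullet> y s)"
proof -
  have eqA: "moved y \<tau> s $ k = y s $ k" if "k \<in> A" for s k
    using w_A[OF that] by (simp add: moved_def)
  have P: "P (moved y \<tau>) = P y"
    using P_dep eqA unfolding depends_on_def by blast
  show "h (moved y \<tau>) = h y"
    using h_dep eqA unfolding depends_on_def by blast
  have "(S (moved y \<tau>) *v axis v 1) $ k = (S y *v axis v 1 + \<tau> *\<^sub>R y t) $ k" if "k \<in> a" for k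
  proof -
    have "(S (moved y \<tau>) *v axis v 1) $ k = (\<Sum>s\<in>{1..n}. moved y \<tau> s $ v * y s $ k)"
      unfolding sample_cov_vec using eqA[of k] that a_subset by (auto simp: inner_axis)
    also have "\<dots> = (\<Sum>s\<in>{1..n}. y s $ v * y s $ k + (if s = t then \<tau> * y t $ k else 0))"
      by (intro sum.cong refl) (auto simp: moved_def w_v algebra_simps)
    also have "\<dots> = (S y *v axis v 1) $ k + \<tau> * y t $ k"
      using t by (simp add: sum.distrib sample_cov_vec inner_axis)
    finally show ?thesis by simp
  qed
  then show b: "b (moved y \<tau>) = b y - \<tau> *\<^sub>R p t y"
    using P_vec_cong[of "S (moved y \<tau>) *v axis v 1" "S y *v axis v 1 + \<tau> *\<^sub>R y t" y]
    by (simp add: b_def P p_def matrix_vector_right_distrib matrix_vector_mult_scaleR)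
  show "p t (moved y \<tau>) = p t y"
    unfolding p_def P by (rule P_vec_cong) (use eqA a_subset in auto)
  have "moved y \<tau> s = y s + (if s = t then \<tau> *\<^sub>R w else 0)" by (simp add: moved_def)
  then show "e s (moved y \<tau>) = e s y + \<tau> * ((if s = t then 1 else 0) - p t y \<bullet> y s)"
    using P_w[of y "y t"]
    by (simp add: e_def b inner_add_right inner_diff_left b_w p_def[symmetric] algebra_simps)
qed

lemma S_b_zero:
  assumes "h y \<noteq> 0" "i \<in> a"
  shows "(S y *v b y) $ i = 0"
  using block_inverse_mult[OF h_inverse[OF assms(1)] assms(2), of "S y *v axis v 1"]
  by (simp add: b_def matrix_vector_mult_diff_distrib)

lemma sum_e_P:
  assumes "h y \<noteq> 0"
  shows "(\<Sum>s\<in>{1..n}. e s y * ((P y *v z) \<bullet> y s)) = 0"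
proof -
  have "(\<Sum>s\<in>{1..n}. e s y * ((P y *v z) \<bullet> y s)) = (P y *v z) \<bullet> (S y *v b y)"
    by (simp add: sample_cov_inner e_def inner_commute)
  also have "\<dots> = (P y *v z) \<bullet> 0"
    by (rule dot_supp_cong[of a]) (use P_vec_zero S_b_zero[OF assms] in auto)
  finally show ?thesis by simp
qed

text \<open>The normal equations make \<open>S y *v b y\<close> vanish on \<open>a\<close>, and
  \<open>K *v w\<close> is supported on \<open>insert v a\<close>. Only the entry at
  \<open>v\<close> survives, where \<open>S y *v b y\<close> equals \<open>r y\<close>.\<close>

lemma sum_e_gamma:
  assumes "h y \<noteq> 0"
  shows "(\<Sum>t\<in>{1..n}. e t y * (y t \<bullet> (K *v w))) = (K *v w) $ v * r y"
proof -
  have 1: "x \<bullet> (S y *v b y) = x $ v * (S y *v b y) $ v" if "\<And>i. i \<notin> insert v a \<Longrightarrow> x $ i = 0" for x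
  proof -
    have "x \<bullet> (S y *v b y) = x \<bullet> ((S y *v b y) $ v *\<^sub>R axis v 1)"
      by (rule dot_supp_cong[of "insert v a"]) (use that S_b_zero[OF assms] v_notin_a in \<open>auto simp: axis_def\<close>)
    then show ?thesis by (simp add: inner_axis)
  qed
  have "(\<Sum>t\<in>{1..n}. e t y * (y t \<bullet> (K *v w))) = (K *v w) \<bullet> (S y *v b y)"
    by (simp add: sample_cov_inner e_def inner_commute)
  then show ?thesis using 1[OF Kw] 1[OF b_zero] by (simp add: r_eq b_v)
qed

text \<open>\<open>P y\<close> inverts \<open>S y\<close> on vectors supported in \<open>a\<close>;
  the remaining multiple of \<open>axis v 1\<close> in \<open>K *v w\<close> produces the
  coefficients \<open>b\<close>.\<close>

lemma sum_p_gamma: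
  assumes "h y \<noteq> 0"
  shows "(\<Sum>t\<in>{1..n}. p t y $ i * (y t \<bullet> (K *v w))) = (K *v w) $ i - (K *v w) $ v * b y $ i"
proof -
  define g where "g = K *v w"
  note B = h_inverse[OF assms]
  have "(\<Sum>t\<in>{1..n}. p t y $ i * (y t \<bullet> g)) = (P y *v axis i 1) \<bullet> (S y *v g)"
    unfolding p_eq sample_cov_inner by (intro sum.cong refl) (simp add: inner_commute mult.commute)
  also have "\<dots> = axis i 1 \<bullet> (P y *v (S y *v g))" by (simp add: P_inner_commute)
  also have "P y *v (S y *v g) = P y *v (S y *v (g - g $ v *\<^sub>R axis v 1)) + g $ v *\<^sub>R (P y *v (S y *v axis v 1))"
    by (simp add: matrix_vector_mult_diff_distrib matrix_vector_mult_scaleR)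
  also have "P y *v (S y *v (g - g $ v *\<^sub>R axis v 1)) = g - g $ v *\<^sub>R axis v 1"
    by (rule block_inverse_mult_left[OF sample_cov_sym B]) (use Kw in \<open>auto simp: g_def axis_def\<close>)
  also have "P y *v (S y *v axis v 1) = axis v 1 - b y" by (simp add: b_def)
  finally show ?thesis by (simp add: g_def inner_axis' algebra_simps)
qed

lemma sum_p_p:
  assumes "h y \<noteq> 0"
  shows "(\<Sum>t\<in>{1..n}. p t y $ i * p t y $ j) = P y $ i $ j"
proof -
  note B = h_inverse[OF assms]
  have "(\<Sum>t\<in>{1..n}. p t y $ i * p t y $ j) = (P y *v axis i 1) \<bullet> (S y *v (P y *v axis j 1))"
    unfolding p_eq sample_cov_inner by (intro sum.cong refl) (simp add: inner_commute mult.commute)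
  also have "\<dots> = axis i 1 \<bullet> (P y *v (S y *v (P y *v axis j 1)))" by (simp add: P_inner_commute)
  also have "P y *v (S y *v (P y *v axis j 1)) = P y *v axis j 1"
    by (rule block_inverse_mult_left[OF sample_cov_sym B]) (rule P_vec_zero)
  finally show ?thesis by (simp flip: matrix_nth)
qed

text \<open>The trace of the hat matrix; this is how \<open>card a\<close> enters the degrees of
  freedom.\<close>

lemma sum_leverage:
  assumes "h y \<noteq> 0"
  shows "(\<Sum>t\<in>{1..n}. p t y \<bullet> y t) = real (card a)"
proof -
  note B = h_inverse[OF assms]
  have "(\<Sum>t\<in>{1..n}. p t y \<bullet> y t) = (\<Sum>t\<in>{1..n}. \<Sum>i\<in>UNIV. \<Sum>k\<in>UNIV. P y $ i $ k * y t $ k * y t $ i)"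
    by (simp add: p_def inner_vec_def matrix_vector_mult_def sum_distrib_right)
  also have "\<dots> = (\<Sum>i\<in>UNIV. \<Sum>k\<in>UNIV. \<Sum>t\<in>{1..n}. P y $ i $ k * y t $ k * y t $ i)"
    by (subst sum.swap) (intro sum.cong refl sum.swap)
  also have "\<dots> = (\<Sum>i\<in>UNIV. \<Sum>k\<in>UNIV. S y $ i $ k * P y $ k $ i)"
  proof (intro sum.cong refl)
    fix i k
    have "P y $ i $ k = P y $ k $ i" using P_sym[of y] by (metis transpose_def vec_lambda_beta)
    then show "(\<Sum>t\<in>{1..n}. P y $ i $ k * y t $ k * y t $ i) = S y $ i $ k * P y $ k $ i"
      by (simp add: sample_cov_nth sum_distrib_left sum_distrib_right mult_ac)
  qed
  also have "\<dots> = (\<Sum>i\<in>a. \<Sum>k\<in>UNIV. S y $ i $ k * P y $ k $ i)"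
    by (rule sum_UNIV_subset) (simp add: P_zero)
  also have "\<dots> = (\<Sum>i\<in>a. \<Sum>k\<in>a. S y $ i $ k * P y $ k $ i)"
    by (intro sum.cong refl sum_UNIV_subset) (simp add: P_zero)
  also have "\<dots> = (\<Sum>i\<in>a. 1)"
    using B by (intro sum.cong refl) (simp add: block_inverse_def)
  finally show ?thesis by simp
qed

lemma b_nth: "b y $ i = (if i = v then 1 else 0) - (\<Sum>k\<in>UNIV. P y $ i $ k * S y $ k $ v)"
  unfolding b_def matrix_vector_mult_basis by (simp add: matrix_vector_mult_def column_def axis_def)

lemma e_eq: "e t y = (\<Sum>i\<in>UNIV. b y $ i * y t $ i)"
  by (simp add: e_def inner_vec_def)

lemma p_nth: "p t y $ i = (\<Sum>k\<in>UNIV. P y $ i $ k * y t $ k)"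
  by (simp add: p_def matrix_vector_mult_def)

lemma p_inner: "p t y \<bullet> y t = (\<Sum>i\<in>UNIV. p t y $ i * y t $ i)"
  by (simp add: inner_vec_def)

lemma b_measurable [measurable]: "(\<lambda>y. b y $ i) \<in> borel_measurable samples"
  unfolding b_nth by measurable

lemma e_measurable [measurable]: "t \<in> {1..n} \<Longrightarrow> e t \<in> borel_measurable samples"
  unfolding e_eq[abs_def] by measurable

lemma p_measurable [measurable]: "t \<in> {1..n} \<Longrightarrow> (\<lambda>y. p t y $ i) \<in> borel_measurable samples"
  unfolding p_nth by measurable

lemma r_measurable [measurable]: "r \<in> borel_measurable samples"
  unfolding r_def[abs_def] by measurable

lemma p_inner_measurable [measurable]: "t \<in> {1..n} \<Longrightarrow> (\<lambda>y. p t y \<bullet> y t) \<in> borel_measurable samples"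
  unfolding p_inner by measurable

lemma gamma_measurable [measurable]: "t \<in> {1..n} \<Longrightarrow> (\<lambda>y. y t \<bullet> g) \<in> borel_measurable samples"
  unfolding inner_vec_def by measurable

lemma exp_bounded_h: "exp_bounded n h"
  using h_bound by (rule exp_bounded_bounded)

lemma exp_bounded_P: "exp_bounded n (\<lambda>y. P y $ i $ j)"
  using P_bound by (rule exp_bounded_bounded)

lemma exp_bounded_b: "exp_bounded n (\<lambda>y. b y $ i)"
  unfolding b_nth by (intro exp_bounded_diff exp_bounded_const exp_bounded_sum exp_bounded_mult
      exp_bounded_P exp_bounded_sample_cov)

lemma exp_bounded_e: "t \<in> {1..n} \<Longrightarrow> exp_bounded n (e t)"
  unfolding e_eq[abs_def] by (intro exp_bounded_sum exp_bounded_mult exp_bounded_b exp_bounded_component)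

lemma exp_bounded_p: "t \<in> {1..n} \<Longrightarrow> exp_bounded n (\<lambda>y. p t y $ i)"
  unfolding p_nth by (intro exp_bounded_sum exp_bounded_mult exp_bounded_P exp_bounded_component)

lemma exp_bounded_p_inner: "t \<in> {1..n} \<Longrightarrow> exp_bounded n (\<lambda>y. p t y \<bullet> y t)"
  unfolding p_inner by (intro exp_bounded_sum exp_bounded_mult exp_bounded_p exp_bounded_component)

lemma exp_bounded_gamma: "t \<in> {1..n} \<Longrightarrow> exp_bounded n (\<lambda>y. y t \<bullet> (g :: real^'p))"
  unfolding inner_vec_def inner_real_def
  by (intro exp_bounded_sum exp_bounded_mult exp_bounded_const exp_bounded_component)

lemma exp_bounded_reg:
  assumes "0 < \<epsilon>"
  shows "exp_bounded n (\<lambda>y. 1 / (r y + \<epsilon>))"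
proof (rule exp_bounded_bounded[of _ "1 / \<epsilon>"])
  show "\<bar>1 / (r y + \<epsilon>)\<bar> \<le> 1 / \<epsilon>" for y
    using assms r_nonneg[of y] by (auto intro!: frac_le)
qed

text \<open>Stein's identity for all observations at once, in the direction that moves only the
  innovation of \<open>v\<close>.\<close>
lemma stein_sum:
  assumes "\<And>t. t \<in> {1..n} \<Longrightarrow> f t \<in> borel_measurable samples"
    and "\<And>t. t \<in> {1..n} \<Longrightarrow> exp_bounded n (f t)"
    and "\<And>t. t \<in> {1..n} \<Longrightarrow> g t \<in> borel_measurable samples"
    and "\<And>t. t \<in> {1..n} \<Longrightarrow> exp_bounded n (g t)"
    and "\<And>t y. t \<in> {1..n} \<Longrightarrow> ((\<lambda>\<tau>. f t (y(t := y t + \<tau> *\<^sub>R w))) has_real_derivative g t y) (at 0)"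
  shows "(\<integral>y. (\<Sum>t\<in>{1..n}. g t y) \<partial>samples) = (\<integral>y. (\<Sum>t\<in>{1..n}. f t y * (y t \<bullet> (K *v w))) \<partial>samples)"
proof -
  have "(\<integral>y. (\<Sum>t\<in>{1..n}. g t y) \<partial>samples) = (\<Sum>t\<in>{1..n}. \<integral>y. g t y \<partial>samples)"
    using assms by (intro Bochner_Integration.integral_sum integrable_exp_bounded)
  also have "\<dots> = (\<Sum>t\<in>{1..n}. \<integral>y. f t y * (y t \<bullet> (K *v w)) \<partial>samples)"
    using assms by (intro sum.cong refl stein)
  also have "\<dots> = (\<integral>y. (\<Sum>t\<in>{1..n}. f t y * (y t \<bullet> (K *v w))) \<partial>samples)"
    using assms by (intro Bochner_Integration.integral_sum[symmetric] integrable_exp_bounded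
        exp_bounded_mult exp_bounded_gamma borel_measurable_times gamma_measurable)
  finally show ?thesis .
qed

text \<open>Of the factors \<open>h\<close>, \<open>p t $ i\<close> and \<open>b $ j\<close>, only
  \<open>b\<close> moves along \<open>w\<close>, by \<open>- p t\<close>, and the products of the
  \<open>p t\<close> sum to \<open>P\<close>. In effect, the conditional covariance of the
  coefficients is \<open>P\<close> divided by \<open>(K *v w) $ v\<close>.\<close>

lemma regression_first:
  "(\<integral>y. h y * ((K *v w) $ v * b y $ i - (K *v w) $ i) * b y $ j \<partial>samples) = (\<integral>y. h y * P y $ i $ j \<partial>samples)"
proof -
  define f where "f t y = h y * p t y $ i * b y $ j" for t y
  define g where "g t y = - (h y * p t y $ i * p t y $ j)" for t y
  have "(\<integral>y. (\<Sum>t\<in>{1..n}. g t y) \<partial>samples) = (\<integral>y. (\<Sum>t\<in>{1..n}. f t y * (y t \<bullet> (K *v w))) \<partial>samples)"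
  proof (rule stein_sum)
    fix t assume t: "t \<in> {1..n}"
    show "f t \<in> borel_measurable samples" "g t \<in> borel_measurable samples"
      unfolding f_def[abs_def] g_def[abs_def] using t by measurable
    show "exp_bounded n (f t)" "exp_bounded n (g t)"
      unfolding f_def[abs_def] g_def[abs_def]
      by (intro exp_bounded_uminus exp_bounded_mult exp_bounded_h exp_bounded_p[OF t] exp_bounded_b)+
    show "((\<lambda>\<tau>. f t (y(t := y t + \<tau> *\<^sub>R w))) has_real_derivative g t y) (at 0)" for y
      unfolding f_def g_def h_shift[OF t] p_shift[OF t] b_shift[OF t]
      by (auto intro!: derivative_eq_intros)
  qed
  moreover have "(\<Sum>t\<in>{1..n}. g t y) = - (h y * P y $ i $ j)" for y
    using sum_p_p[of y i j]
    by (cases "h y = 0") (simp_all add: g_def sum_negf mult.assoc flip: sum_distrib_left)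
  moreover have "(\<Sum>t\<in>{1..n}. f t y * (y t \<bullet> (K *v w))) = - (h y * ((K *v w) $ v * b y $ i - (K *v w) $ i) * b y $ j)" for y
  proof -
    have eq: "(\<Sum>t\<in>{1..n}. f t y * (y t \<bullet> (K *v w))) = h y * b y $ j * (\<Sum>t\<in>{1..n}. p t y $ i * (y t \<bullet> (K *v w)))"
      by (simp add: f_def sum_distrib_left mult_ac)
    show ?thesis
    proof (cases "h y = 0")
      case False
      show ?thesis unfolding eq sum_p_gamma[OF False] by (simp add: algebra_simps)
    qed (simp add: f_def)
  qed
  ultimately show ?thesis by simp
qed

text \<open>Stein's identity for \<open>h * b $ i * b $ j * e t / (r + \<epsilon>)\<close>. The
  derivatives of \<open>b\<close> cancel in the sum because residuals are orthogonal to the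
  regressors, those of \<open>e t\<close> add up to \<open>n - card a\<close>, and \<open>r\<close>
  has derivative \<open>2 * e t\<close>, which gives the squared denominator. The summand \<epsilon>
  keeps the reciprocal bounded.\<close>

lemma regression_second:
  assumes \<epsilon>: "0 < \<epsilon>"
  shows "(\<integral>y. h y * b y $ i * b y $ j * ((real n - real (card a)) / (r y + \<epsilon>) - 2 * r y / (r y + \<epsilon>)\<^sup>2) \<partial>samples)
    = (\<integral>y. h y * b y $ i * b y $ j * ((K *v w) $ v * (r y / (r y + \<epsilon>))) \<partial>samples)"
proof -
  define q where "q y = 1 / (r y + \<epsilon>)" for y
  have rpos: "r y + \<epsilon> > 0" for y using r_nonneg[of y] \<epsilon> by linarith
  have qb: "exp_bounded n q" unfolding q_def[abs_def] by (rule exp_bounded_reg[OF \<epsilon>])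
  have [measurable]: "q \<in> borel_measurable samples" unfolding q_def[abs_def] by measurable
  define f where "f t y = h y * b y $ i * b y $ j * e t y * q y" for t y
  define g where "g t y = h y * ((- (p t y $ i) * b y $ j - b y $ i * p t y $ j) * e t y * q y
      + b y $ i * b y $ j * (1 - p t y \<bullet> y t) * q y - b y $ i * b y $ j * e t y * (2 * e t y) * (q y * q y))" for t y
  have "(\<integral>y. (\<Sum>t\<in>{1..n}. g t y) \<partial>samples) = (\<integral>y. (\<Sum>t\<in>{1..n}. f t y * (y t \<bullet> (K *v w))) \<partial>samples)"
  proof (rule stein_sum)
    fix t assume t: "t \<in> {1..n}"
    show "f t \<in> borel_measurable samples" "g t \<in> borel_measurable samples"
      unfolding f_def[abs_def] g_def[abs_def] using t by measurable
    show "exp_bounded n (f t)" "exp_bounded n (g t)"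
      unfolding f_def[abs_def] g_def[abs_def]
      by (intro exp_bounded_uminus exp_bounded_mult exp_bounded_h exp_bounded_p[OF t] exp_bounded_b
          exp_bounded_add exp_bounded_diff exp_bounded_const qb exp_bounded_e[OF t] exp_bounded_p_inner[OF t])+
    fix y
    show "((\<lambda>\<tau>. f t (y(t := y t + \<tau> *\<^sub>R w))) has_real_derivative g t y) (at 0)"
    \<comment> \<open>\<open>h\<close> is constant along the shift, so where it vanishes the whole
      function does; elsewhere the normal equations are available.\<close>
    proof (cases "h y = 0")
      case True
      then show ?thesis unfolding f_def g_def h_shift[OF t] by simp
    next
      case False
      define c where "c s = (if s = t then 1 else 0) - p t y \<bullet> y s" for s
      have rs: "r (y(t := y t + \<tau> *\<^sub>R w)) = (\<Sum>s\<in>{1..n}. (e s y + \<tau> * c s)\<^sup>2)" for \<tau>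
        unfolding r_def e_shift[OF t] c_def ..
      have "((\<lambda>\<tau>. r (y(t := y t + \<tau> *\<^sub>R w))) has_real_derivative (\<Sum>s\<in>{1..n}. 2 * e s y * c s)) (at 0)"
        unfolding rs by (auto intro!: derivative_eq_intros sum.cong)
      also have "(\<Sum>s\<in>{1..n}. 2 * e s y * c s)
        = (\<Sum>s\<in>{1..n}. (if s = t then 2 * e t y else 0) - 2 * (e s y * (p t y \<bullet> y s)))"
        by (intro sum.cong refl) (auto simp: c_def algebra_simps)
      also have "\<dots> = 2 * e t y"
        using sum_e_P[OF False, of "y t"] t unfolding p_def[symmetric]
        by (simp add: sum_subtractf flip: sum_distrib_left)
      finally have dr: "((\<lambda>\<tau>. r (y(t := y t + \<tau> *\<^sub>R w))) has_real_derivative 2 * e t y) (at 0)" .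
      have dq: "((\<lambda>\<tau>. q (y(t := y t + \<tau> *\<^sub>R w))) has_real_derivative - (2 * e t y) * (q y * q y)) (at 0)"
        unfolding q_def using rpos[of y]
        by (auto intro!: derivative_eq_intros dr simp: divide_simps power2_eq_square)
      have db: "((\<lambda>\<tau>. b (y(t := y t + \<tau> *\<^sub>R w)) $ l) has_real_derivative - (p t y $ l)) (at 0)" for l
        unfolding b_shift[OF t] by (auto intro!: derivative_eq_intros)
      have de: "((\<lambda>\<tau>. e t (y(t := y t + \<tau> *\<^sub>R w))) has_real_derivative 1 - p t y \<bullet> y t) (at 0)"
        unfolding e_shift[OF t] by (auto intro!: derivative_eq_intros)
      show ?thesis
        unfolding f_def g_def h_shift[OF t]
        by (auto intro!: derivative_eq_intros dq db de simp: algebra_simps)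
    qed
  qed
  moreover have "(\<Sum>t\<in>{1..n}. g t y)
     = h y * b y $ i * b y $ j * ((real n - real (card a)) / (r y + \<epsilon>) - 2 * r y / (r y + \<epsilon>)\<^sup>2)" for y
  proof (cases "h y = 0")
    case False
    have e_p_zero: "(\<Sum>t\<in>{1..n}. e t y * p t y $ l) = 0" for l
      using sum_e_P[OF False, of "axis l 1"] by (simp add: p_eq)
    have "g t y = h y * (- (b y $ j * q y) * (e t y * p t y $ i) - b y $ i * q y * (e t y * p t y $ j)
        + b y $ i * b y $ j * q y * (1 - p t y \<bullet> y t) - 2 * b y $ i * b y $ j * (q y * q y) * (e t y)\<^sup>2)" for t
      by (simp add: g_def algebra_simps power2_eq_square)
    then have "(\<Sum>t\<in>{1..n}. g t y) = h y * (- (b y $ j * q y) * (\<Sum>t\<in>{1..n}. e t y * p t y $ i)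
        - b y $ i * q y * (\<Sum>t\<in>{1..n}. e t y * p t y $ j)
        + b y $ i * b y $ j * q y * (\<Sum>t\<in>{1..n}. 1 - p t y \<bullet> y t)
        - 2 * b y $ i * b y $ j * (q y * q y) * r y)"
      by (simp only: sum_distrib_left[symmetric] sum.distrib sum_subtractf r_def)
    also have "\<dots> = h y * (b y $ i * b y $ j * q y * (real n - real (card a))
        - 2 * b y $ i * b y $ j * (q y * q y) * r y)"
      by (simp only: e_p_zero sum_subtractf sum_leverage[OF False]) simp
    finally show ?thesis by (simp add: q_def power2_eq_square algebra_simps)
  qed (simp add: g_def)
  moreover have "(\<Sum>t\<in>{1..n}. f t y * (y t \<bullet> (K *v w)))
     = h y * b y $ i * b y $ j * ((K *v w) $ v * (r y / (r y + \<epsilon>)))" for y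
  proof (cases "h y = 0")
    case False
    have "(\<Sum>t\<in>{1..n}. f t y * (y t \<bullet> (K *v w)))
        = h y * b y $ i * b y $ j * q y * (\<Sum>t\<in>{1..n}. e t y * (y t \<bullet> (K *v w)))"
      by (simp add: f_def sum_distrib_left mult_ac)
    then show ?thesis unfolding sum_e_gamma[OF False] by (simp add: q_def)
  qed (simp add: f_def)
  ultimately show ?thesis by simp
qed

end

section \<open>Almost surely nonzero residuals and removal of \<epsilon>\<close>

context regression
begin

lemma omega_pos: "0 < (K *v w) $ v"
proof -
  have "(K *v w) \<bullet> w = (K *v w) \<bullet> axis v 1"
    by (rule dot_supp_cong[of "insert v a"]) (use Kw w_v w_A a_subset v_notin_a in \<open>auto simp: axis_def\<close>)
  moreover have "w \<noteq> 0" using w_v by auto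
  ultimately show ?thesis using K_pos[of w] by (simp add: inner_commute[of w] inner_axis)
qed

lemma integrable_h_mult:
  assumes "f \<in> borel_measurable samples" "exp_bounded n f"
  shows "integrable samples (\<lambda>y. h y * f y)"
  using assms by (intro integrable_exp_bounded exp_bounded_mult exp_bounded_h borel_measurable_times h_measurable)

text \<open>For \<open>i = j = v\<close>, where \<open>b $ v = 1\<close>, the regularised identity
  is multiplied by \<epsilon>. Its left integrand then tends to \<open>h * (n - card a)\<close> on
  \<open>r = 0\<close> and to zero elsewhere, while the right-hand side is of order \<epsilon>.
  Since \<open>card a < n\<close>, the weight \<open>h\<close> has no mass on
  \<open>r = 0\<close>.\<close>

lemma residual_nonzero:
  assumes card: "card a < n" and h: "\<And>y. 0 \<le> h y"
  shows "AE y in samples. h y \<noteq> 0 \<longrightarrow> r y \<noteq> 0"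
proof -
  interpret prob_space samples by (rule prob_samples)
  define m where "m = real n - real (card a)"
  have m: "1 \<le> m" using card by (simp add: m_def)
  define \<epsilon> where "\<epsilon> k = 1 / (real k + 1)" for k
  have \<epsilon>: "0 < \<epsilon> k" for k by (simp add: \<epsilon>_def)
  have \<epsilon>0: "\<epsilon> \<longlonglongrightarrow> 0" unfolding \<epsilon>_def by real_asymp
  define F where "F k y = h y * (m * (\<epsilon> k / (r y + \<epsilon> k)) - 2 * (r y / (r y + \<epsilon> k)) * (\<epsilon> k / (r y + \<epsilon> k)))" for k y
  define G where "G y = h y * (m * (if r y = 0 then 1 else 0))" for y
  have frac: "0 \<le> r y / (r y + \<epsilon> k) \<and> r y / (r y + \<epsilon> k) \<le> 1 \<and> 0 \<le> \<epsilon> k / (r y + \<epsilon> k) \<and> \<epsilon> k / (r y + \<epsilon> k) \<le> 1" for k y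
    using \<epsilon>[of k] r_nonneg[of y] by (auto simp: divide_simps)
  have [measurable]: "F k \<in> borel_measurable samples" "G \<in> borel_measurable samples" for k
    unfolding F_def[abs_def] G_def[abs_def] by measurable
  have N: "0 \<le> N" using h_bound[of undefined] by linarith
  have bound: "\<bar>F k y\<bar> \<le> N * (m + 2)" for k y
  proof -
    have "\<bar>m * u - 2 * q * u\<bar> \<le> m + 2" if "0 \<le> u" "u \<le> 1" "0 \<le> q" "q \<le> 1" for u q
      using mult_left_mono[of u 1 m] mult_mono[of q 1 u 1] mult_nonneg_nonneg[of m u] mult_nonneg_nonneg[of q u]
        that m by linarith
    then have "\<bar>m * (\<epsilon> k / (r y + \<epsilon> k)) - 2 * (r y / (r y + \<epsilon> k)) * (\<epsilon> k / (r y + \<epsilon> k))\<bar> \<le> m + 2"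
      using frac[of y k] by blast
    then show ?thesis unfolding F_def abs_mult using h_bound[of y] N by (intro mult_mono) auto
  qed
  have G: "integrable samples G"
  proof (rule integrable_const_bound[of _ "N * m"])
    show "AE y in samples. norm (G y) \<le> N * m"
      using h_bound m N by (auto simp: G_def abs_mult intro!: mult_right_mono)
  qed measurable
  have "(\<lambda>k. \<integral>y. F k y \<partial>samples) \<longlonglongrightarrow> (\<integral>y. G y \<partial>samples)"
  proof (rule integral_dominated_convergence[where w="\<lambda>_. N * (m + 2)"])
    show "AE y in samples. (\<lambda>k. F k y) \<longlonglongrightarrow> G y"
    proof (rule AE_I2)
      fix y
      show "(\<lambda>k. F k y) \<longlonglongrightarrow> G y"
      proof (cases "r y = 0")
        case True
        have "\<epsilon> k \<noteq> 0" for k using \<epsilon>[of k] by simp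
        then show ?thesis using True by (simp add: F_def G_def)
      next
        case False
        have "(\<lambda>k. F k y) \<longlonglongrightarrow> h y * (m * (0 / (r y + 0)) - 2 * (r y / (r y + 0)) * (0 / (r y + 0)))"
          unfolding F_def using False by (intro tendsto_intros \<epsilon>0) auto
        then show ?thesis using False by (simp add: G_def)
      qed
    qed
  qed (use bound in auto)
  moreover have "(\<lambda>k. \<integral>y. F k y \<partial>samples) \<longlonglongrightarrow> 0"
  proof (rule tendsto_0_le[where K=1])
    show "(\<lambda>k. \<epsilon> k * ((K *v w) $ v * N)) \<longlonglongrightarrow> 0"
      using tendsto_mult_left_zero[OF \<epsilon>0] .
    show "\<forall>\<^sub>F k in sequentially. norm (\<integral>y. F k y \<partial>samples) \<le> norm (\<epsilon> k * ((K *v w) $ v * N)) * 1"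
    proof (rule always_eventually, rule allI)
      fix k
      have Feq: "F k y = \<epsilon> k * (h y * b y $ v * b y $ v * (m / (r y + \<epsilon> k) - 2 * r y / (r y + \<epsilon> k)\<^sup>2))" for y
        by (simp add: F_def b_v power2_eq_square algebra_simps)
      have "(\<integral>y. F k y \<partial>samples) = \<epsilon> k * (\<integral>y. h y * b y $ v * b y $ v * (m / (r y + \<epsilon> k) - 2 * r y / (r y + \<epsilon> k)\<^sup>2) \<partial>samples)"
        unfolding Feq by simp
      also have "\<dots> = \<epsilon> k * (\<integral>y. h y * ((K *v w) $ v * (r y / (r y + \<epsilon> k))) \<partial>samples)"
        using regression_second[OF \<epsilon>[of k], of v v] by (simp add: m_def b_v)
      finally have eq: "(\<integral>y. F k y \<partial>samples) = \<epsilon> k * (\<integral>y. h y * ((K *v w) $ v * (r y / (r y + \<epsilon> k))) \<partial>samples)" .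
      have le: "h y * ((K *v w) $ v * (r y / (r y + \<epsilon> k))) \<le> (K *v w) $ v * N" for y
      proof -
        have "h y * ((K *v w) $ v * u) \<le> N * ((K *v w) $ v * 1)" if "0 \<le> u" "u \<le> 1" for u
          using h_bound[of y] h[of y] N omega_pos that by (intro mult_mono) auto
        from this[of "r y / (r y + \<epsilon> k)"] show ?thesis using frac[of y k] by (simp add: mult.commute)
      qed
      have ge: "0 \<le> h y * ((K *v w) $ v * (r y / (r y + \<epsilon> k)))" for y
        using h[of y] frac[of y k] omega_pos by (intro mult_nonneg_nonneg) auto
      have "(\<integral>y. h y * ((K *v w) $ v * (r y / (r y + \<epsilon> k))) \<partial>samples) \<le> (\<integral>y. (K *v w) $ v * N \<partial>samples)"
      proof (rule integral_mono)
        show "integrable samples (\<lambda>y. h y * ((K *v w) $ v * (r y / (r y + \<epsilon> k))))"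
        proof (rule integrable_const_bound[of _ "(K *v w) $ v * N"])
          show "AE y in samples. norm (h y * ((K *v w) $ v * (r y / (r y + \<epsilon> k)))) \<le> (K *v w) $ v * N"
          proof (rule AE_I2)
            fix y show "norm (h y * ((K *v w) $ v * (r y / (r y + \<epsilon> k)))) \<le> (K *v w) $ v * N"
              using le[of y] ge[of y] by (simp only: real_norm_def abs_of_nonneg)
          qed
        qed measurable
      qed (use le in auto)
      moreover have "0 \<le> (\<integral>y. h y * ((K *v w) $ v * (r y / (r y + \<epsilon> k))) \<partial>samples)"
        using ge by (intro integral_nonneg_AE) auto
      ultimately show "norm (\<integral>y. F k y \<partial>samples) \<le> norm (\<epsilon> k * ((K *v w) $ v * N)) * 1"
        unfolding eq using \<epsilon>[of k] N omega_pos by (simp add: abs_mult mult_left_mono prob_space)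
    qed
  qed
  ultimately have "(\<integral>y. G y \<partial>samples) = 0" by (rule LIMSEQ_unique)
  moreover have "AE y in samples. 0 \<le> G y"
    using h m by (simp add: G_def)
  ultimately have "AE y in samples. G y = 0"
    using integral_nonneg_eq_0_iff_AE[OF G] by blast
  then show ?thesis
    by eventually_elim (use m in \<open>auto simp: G_def\<close>)
qed

text \<open>As \<open>r / (r + \<epsilon>)\<close> is at most 1, a multiple of the integrable
  quotient dominates the regularised integrands. The term
  \<open>2 * r / (r + \<epsilon>)\<^sup>2\<close> tends to \<open>2 / r\<close>, which lowers the
  factor by 2.\<close>

lemma regression_limit:
  assumes r0: "AE y in samples. h y \<noteq> 0 \<longrightarrow> r y \<noteq> 0"
    and int: "integrable samples (\<lambda>y. h y * b y $ i * b y $ j / r y)"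
  shows "(real n - real (card a) - 2) * (\<integral>y. h y * b y $ i * b y $ j / r y \<partial>samples)
     = (K *v w) $ v * (\<integral>y. h y * b y $ i * b y $ j \<partial>samples)"
proof -
  define m where "m = real n - real (card a)"
  define \<epsilon> where "\<epsilon> k = 1 / (real k + 1)" for k
  have \<epsilon>: "0 < \<epsilon> k" for k by (simp add: \<epsilon>_def)
  have \<epsilon>0: "\<epsilon> \<longlonglongrightarrow> 0" unfolding \<epsilon>_def by real_asymp
  define c where "c y = h y * b y $ i * b y $ j" for y
  have [measurable]: "c \<in> borel_measurable samples" unfolding c_def[abs_def] by measurable
  have c: "integrable samples c"
    using integrable_h_mult[of "\<lambda>y. b y $ i * b y $ j"]
    by (simp add: c_def[abs_def] exp_bounded_mult exp_bounded_b mult.assoc)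
  have r0': "AE y in samples. c y \<noteq> 0 \<longrightarrow> r y > 0"
    using r0 by eventually_elim (use r_nonneg in \<open>auto simp: c_def less_le\<close>)
  have frac: "0 \<le> r y / (r y + \<epsilon> k)" "r y / (r y + \<epsilon> k) \<le> 1" for k y
    using \<epsilon>[of k] r_nonneg[of y] by (auto simp: divide_simps)
  have "(\<lambda>k. \<integral>y. c y * (m / (r y + \<epsilon> k) - 2 * r y / (r y + \<epsilon> k)\<^sup>2) \<partial>samples)
      \<longlonglongrightarrow> (\<integral>y. (m - 2) * (c y / r y) \<partial>samples)"
  proof (rule integral_dominated_convergence[where w="\<lambda>y. (\<bar>m\<bar> + 2) * \<bar>c y / r y\<bar>"])
    show "integrable samples (\<lambda>y. (\<bar>m\<bar> + 2) * \<bar>c y / r y\<bar>)"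
      using int by (intro integrable_mult_right integrable_abs) (simp add: c_def)
    show "AE y in samples. (\<lambda>k. c y * (m / (r y + \<epsilon> k) - 2 * r y / (r y + \<epsilon> k)\<^sup>2)) \<longlonglongrightarrow> (m - 2) * (c y / r y)"
      using r0'
    proof eventually_elim
      case (elim y)
      show ?case
      proof (cases "c y = 0")
        case False
        then have "(\<lambda>k. c y * (m / (r y + \<epsilon> k) - 2 * r y / (r y + \<epsilon> k)\<^sup>2))
          \<longlonglongrightarrow> c y * (m / (r y + 0) - 2 * r y / (r y + 0)\<^sup>2)"
          using elim by (intro tendsto_intros \<epsilon>0) auto
        also have "c y * (m / (r y + 0) - 2 * r y / (r y + 0)\<^sup>2) = (m - 2) * (c y / r y)"
          using elim False by (simp add: power2_eq_square field_simps)
        finally show ?thesis .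
      qed simp
    qed
    show "AE y in samples. norm (c y * (m / (r y + \<epsilon> k) - 2 * r y / (r y + \<epsilon> k)\<^sup>2)) \<le> (\<bar>m\<bar> + 2) * \<bar>c y / r y\<bar>" for k
      using r0'
    proof eventually_elim
      case (elim y)
      show ?case
      proof (cases "c y = 0")
        case False
        then have r: "r y > 0" using elim by simp
        have "m / (r y + \<epsilon> k) - 2 * r y / (r y + \<epsilon> k)\<^sup>2 = (m - 2 * (r y / (r y + \<epsilon> k))) * (1 / (r y + \<epsilon> k))"
          by (simp add: power2_eq_square algebra_simps)
        also have "\<bar>\<dots>\<bar> \<le> (\<bar>m\<bar> + 2) * (1 / r y)"
          unfolding abs_mult
        proof (intro mult_mono)
          show "\<bar>m - 2 * (r y / (r y + \<epsilon> k))\<bar> \<le> \<bar>m\<bar> + 2" using frac[of y k] by linarith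
          show "\<bar>1 / (r y + \<epsilon> k)\<bar> \<le> 1 / r y" using r \<epsilon>[of k] by (simp add: frac_le)
        qed auto
        finally have "\<bar>c y\<bar> * \<bar>m / (r y + \<epsilon> k) - 2 * r y / (r y + \<epsilon> k)\<^sup>2\<bar> \<le> \<bar>c y\<bar> * ((\<bar>m\<bar> + 2) * (1 / r y))"
          by (rule mult_left_mono) simp
        then show ?thesis using r by (simp add: abs_mult mult_ac)
      qed simp
    qed
  qed measurable
  moreover have "(\<lambda>k. \<integral>y. c y * (m / (r y + \<epsilon> k) - 2 * r y / (r y + \<epsilon> k)\<^sup>2) \<partial>samples)
      \<longlonglongrightarrow> (\<integral>y. (K *v w) $ v * c y \<partial>samples)"
  proof -
    have "(\<lambda>k. \<integral>y. c y * ((K *v w) $ v * (r y / (r y + \<epsilon> k))) \<partial>samples) \<longlonglongrightarrow> (\<integral>y. (K *v w) $ v * c y \<partial>samples)"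
    proof (rule integral_dominated_convergence[where w="\<lambda>y. (K *v w) $ v * \<bar>c y\<bar>"])
      show "AE y in samples. (\<lambda>k. c y * ((K *v w) $ v * (r y / (r y + \<epsilon> k)))) \<longlonglongrightarrow> (K *v w) $ v * c y"
        using r0'
      proof eventually_elim
        case (elim y)
        show ?case
        proof (cases "c y = 0")
          case False
          then have "(\<lambda>k. c y * ((K *v w) $ v * (r y / (r y + \<epsilon> k)))) \<longlonglongrightarrow> c y * ((K *v w) $ v * (r y / (r y + 0)))"
            using elim by (intro tendsto_intros \<epsilon>0) auto
          then show ?thesis using elim False by (simp add: mult.commute)
        qed simp
      qed
      show "AE y in samples. norm (c y * ((K *v w) $ v * (r y / (r y + \<epsilon> k)))) \<le> (K *v w) $ v * \<bar>c y\<bar>" for k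
      proof (rule AE_I2)
        fix y
        have nn: "0 \<le> (K *v w) $ v * (r y / (r y + \<epsilon> k))"
          using frac(1)[of y k] omega_pos by (intro mult_nonneg_nonneg) auto
        have "\<bar>c y\<bar> * ((K *v w) $ v * (r y / (r y + \<epsilon> k))) \<le> \<bar>c y\<bar> * ((K *v w) $ v * 1)"
          using frac[of y k] omega_pos by (intro mult_left_mono) auto
        then show "norm (c y * ((K *v w) $ v * (r y / (r y + \<epsilon> k)))) \<le> (K *v w) $ v * \<bar>c y\<bar>"
          unfolding real_norm_def abs_mult[of "c y"] abs_of_nonneg[OF nn] by (simp add: mult.commute)
      qed
      show "integrable samples (\<lambda>y. (K *v w) $ v * \<bar>c y\<bar>)"
        using c by (intro integrable_mult_right integrable_abs)
    qed measurable
    then show ?thesis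
      unfolding c_def m_def using regression_second[OF \<epsilon>, of i j] by simp
  qed
  ultimately have "(\<integral>y. (m - 2) * (c y / r y) \<partial>samples) = (\<integral>y. (K *v w) $ v * c y \<partial>samples)"
    by (rule LIMSEQ_unique)
  then show ?thesis
    unfolding integral_mult_right_zero by (simp add: c_def m_def)
qed

lemma regression_identity:
  assumes "AE y in samples. h y \<noteq> 0 \<longrightarrow> r y \<noteq> 0"
    and "integrable samples (\<lambda>y. h y * b y $ i * b y $ j / r y)"
  shows "(real n - real (card a) - 2) * (\<integral>y. h y * b y $ i * b y $ j / r y \<partial>samples)
     - (\<integral>y. h y * P y $ i $ j \<partial>samples)
     = (K *v w) $ i * (K *v w) $ j / (K *v w) $ v * (\<integral>y. h y \<partial>samples)"
proof -
  define g where "g = K *v w"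
  have eb: "integrable samples (\<lambda>y. h y * b y $ i * b y $ j)" "integrable samples (\<lambda>y. h y * b y $ i)" for i j
    using integrable_h_mult[of "\<lambda>y. b y $ i * b y $ j"] integrable_h_mult[of "\<lambda>y. b y $ i"]
    by (simp_all add: exp_bounded_mult exp_bounded_b mult.assoc)
  have first: "g $ v * (\<integral>y. h y * b y $ i * b y $ j \<partial>samples) - g $ i * (\<integral>y. h y * b y $ j \<partial>samples)
     = (\<integral>y. h y * P y $ i $ j \<partial>samples)" for i j
  proof -
    have "(\<integral>y. h y * (g $ v * b y $ i - g $ i) * b y $ j \<partial>samples)
        = (\<integral>y. g $ v * (h y * b y $ i * b y $ j) - g $ i * (h y * b y $ j) \<partial>samples)"
      by (intro Bochner_Integration.integral_cong refl) (simp add: algebra_simps)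
    also have "\<dots> = g $ v * (\<integral>y. h y * b y $ i * b y $ j \<partial>samples) - g $ i * (\<integral>y. h y * b y $ j \<partial>samples)"
      by (subst Bochner_Integration.integral_diff) (use eb in auto)
    finally show ?thesis using regression_first[of i j] by (simp add: g_def)
  qed
  \<comment> \<open>Column \<open>v\<close> of \<open>P\<close> is zero and
    \<open>b $ v = 1\<close>, so the first identity at \<open>v\<close> says that
    \<open>b $ j\<close> has conditional mean \<open>g $ j / g $ v\<close>.\<close>
  have v: "g $ v * (\<integral>y. h y * b y $ j \<partial>samples) = g $ j * (\<integral>y. h y \<partial>samples)"
    using first[of j v] v_notin_a by (simp add: b_v P_zero)
  have "g $ v \<noteq> 0" using omega_pos by (simp add: g_def)
  then show ?thesis
    using regression_limit[OF assms] first[of i j] v unfolding g_def[symmetric] by (simp add: field_simps)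
qed

end

section \<open>Marginal concentration matrices\<close>

text \<open>The last conjunct says that \<open>Q\<close> is the inverse of the \<open>A\<close>-block of the inverse of \<open>K\<close>,
  padded with zeros.\<close>
definition marginal_concentration :: "('p \<Rightarrow> 'p \<Rightarrow> bool) \<Rightarrow> real^'p::finite^'p \<Rightarrow> 'p set \<Rightarrow> real^'p^'p \<Rightarrow> bool" where
  "marginal_concentration E K A Q \<longleftrightarrow> transpose Q = Q \<and> (\<forall>i j. i \<notin> A \<or> j \<notin> A \<longrightarrow> Q $ i $ j = 0)
     \<and> (\<forall>i j. i \<noteq> j \<longrightarrow> \<not> E i j \<longrightarrow> Q $ i $ j = 0)
     \<and> (\<forall>z. (\<forall>i. i \<notin> A \<longrightarrow> z $ i = 0) \<longrightarrow> (\<exists>w. (\<forall>i\<in>A. w $ i = z $ i) \<and> K *v w = Q *v z))"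

lemma matrix_vector_axis: "(Q *v axis v (1::real)) $ i = Q $ i $ v"
  by (simp add: matrix_vector_mult_basis column_def)

lemma symmetric_nth: "transpose Q = Q \<Longrightarrow> Q $ i $ j = Q $ j $ i"
  by (metis transpose_def vec_lambda_beta)

text \<open>The shift direction of the regression step: \<open>axis v 1\<close> is extended outside
  \<open>insert v A\<close> so that \<open>K *v w\<close> becomes column \<open>v\<close> of
  \<open>Q\<close>, and therefore vanishes at non-neighbours of \<open>v\<close>.\<close>

lemma marginal_direction:
  assumes Q: "marginal_concentration E K (insert v A) Q" and v: "v \<notin> A" and pd: "pos_def K"
  obtains w where "\<And>k. k \<in> A \<Longrightarrow> w $ k = 0" "w $ v = 1" "\<And>i. (K *v w) $ i = Q $ i $ v" "Q $ v $ v > 0"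
proof -
  have "\<forall>i. i \<notin> insert v A \<longrightarrow> axis v (1::real) $ i = 0" by (simp add: axis_def)
  then obtain w where w: "\<forall>i\<in>insert v A. w $ i = axis v (1::real) $ i" and Kw: "K *v w = Q *v axis v 1"
    using Q unfolding marginal_concentration_def by blast
  have 1: "w $ k = 0" if "k \<in> A" for k using w that v by (auto simp: axis_def)
  have 2: "w $ v = 1" using w by (simp add: axis_def)
  have 3: "(K *v w) $ i = Q $ i $ v" for i by (simp add: Kw matrix_vector_axis)
  have "(K *v w) \<bullet> w = (K *v w) \<bullet> axis v 1"
    by (rule dot_supp_cong[of "insert v A"]) (use 3 Q w in \<open>auto simp: marginal_concentration_def\<close>)
  also have "\<dots> = Q $ v $ v" by (simp add: inner_axis 3)
  finally have "Q $ v $ v = w \<bullet> (K *v w)" by (simp add: inner_commute)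
  moreover have "w \<noteq> 0" using 2 by auto
  ultimately have 4: "Q $ v $ v > 0" using pd by (simp add: pos_def_def)
  show ?thesis by (rule that[OF 1 2 3 4])
qed

text \<open>Integrating out \<open>v\<close> is a Schur complement. Away from \<open>v\<close> its
  correction is nonzero only between neighbours of \<open>v\<close>; these are pairwise adjacent, so
  the zero pattern of the graph is preserved.\<close>

lemma marginal_step:
  assumes Q: "marginal_concentration E K (insert v A) Q" and v: "v \<notin> A"
    and sym: "\<And>u v. E u v \<Longrightarrow> E v u"
    and comp: "complete_set E {u\<in>A. E u v}" and pd: "pos_def K"
  shows "marginal_concentration E K A (\<chi> i j. Q $ i $ j - Q $ i $ v * Q $ j $ v / Q $ v $ v)"
    (is "marginal_concentration E K A ?Q")
proof -
  have pos: "Q $ v $ v > 0" using marginal_direction[OF Q v pd] by metis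
  have Qsym: "transpose Q = Q" and Q0: "\<And>i j. i \<notin> insert v A \<or> j \<notin> insert v A \<Longrightarrow> Q $ i $ j = 0"
    and QE: "\<And>i j. i \<noteq> j \<Longrightarrow> \<not> E i j \<Longrightarrow> Q $ i $ j = 0"
    and Qex: "\<And>z. (\<And>i. i \<notin> insert v A \<Longrightarrow> z $ i = 0) \<Longrightarrow> \<exists>w. (\<forall>i\<in>insert v A. w $ i = z $ i) \<and> K *v w = Q *v z"
    using Q unfolding marginal_concentration_def by blast+
  have s: "Q $ i $ j = Q $ j $ i" for i j using symmetric_nth[OF Qsym] .
  show ?thesis
    unfolding marginal_concentration_def
  proof (intro conjI allI impI)
    have "?Q $ j $ i = ?Q $ i $ j" for i j using s[of i j] by simp
    then show "transpose ?Q = ?Q" by (simp add: transpose_def vec_eq_iff)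
  next
    fix i j assume ij: "i \<notin> A \<or> j \<notin> A"
    show "?Q $ i $ j = 0"
      using ij Q0[of i j] Q0[of i v] Q0[of j v] s[of v j] pos by (cases "i = v"; cases "j = v") auto
  next
    fix i j assume ij: "i \<noteq> j" "\<not> E i j"
    have "Q $ i $ v = 0 \<or> Q $ j $ v = 0 \<or> i = v \<or> j = v"
    proof (rule ccontr)
      assume "\<not> ?thesis"
      then have n: "Q $ i $ v \<noteq> 0" "Q $ j $ v \<noteq> 0" "i \<noteq> v" "j \<noteq> v" by auto
      then have "E i v" "E j v" "i \<in> A" "j \<in> A" using QE Q0 by blast+
      then show False using comp ij by (auto simp: complete_set_def)
    qed
    then show "?Q $ i $ j = 0" using QE[OF ij] s[of v j] pos by auto
  next
    fix z :: "real^'a" assume z: "\<forall>i. i \<notin> A \<longrightarrow> z $ i = 0"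
    \<comment> \<open>Chosen so that \<open>(Q *v z') $ v = 0\<close>; the entry at \<open>v\<close>
      is free, since \<open>w\<close> is prescribed on \<open>A\<close> only.\<close>
    define z' where "z' = z - ((Q *v z) $ v / Q $ v $ v) *\<^sub>R axis v 1"
    have "z' $ i = 0" if "i \<notin> insert v A" for i using z that by (simp add: z'_def axis_def)
    then obtain w where w: "\<forall>i\<in>insert v A. w $ i = z' $ i" "K *v w = Q *v z'" using Qex by blast
    have "\<forall>i\<in>A. w $ i = z $ i" using w(1) v by (auto simp: z'_def axis_def)
    moreover have "Q *v z' = ?Q *v z"
    proof -
      have "(?Q *v z) $ i = (Q *v z') $ i" for i
      proof -
        have "(?Q *v z) $ i = (\<Sum>j\<in>UNIV. Q $ i $ j * z $ j - Q $ i $ v / Q $ v $ v * (Q $ v $ j * z $ j))"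
          unfolding matrix_vector_mult_def using s by (simp add: algebra_simps)
        also have "\<dots> = (Q *v z) $ i - Q $ i $ v / Q $ v $ v * (Q *v z) $ v"
          by (simp add: matrix_vector_mult_def sum_subtractf sum_distrib_left)
        also have "\<dots> = (Q *v z') $ i"
          by (simp add: z'_def matrix_vector_mult_diff_distrib matrix_vector_mult_scaleR matrix_vector_axis)
        finally show ?thesis .
      qed
      then show ?thesis by (simp add: vec_eq_iff)
    qed
    ultimately show "\<exists>w. (\<forall>i\<in>A. w $ i = z $ i) \<and> K *v w = ?Q *v z" using w(2) by metis
  qed
qed

lemma marginal_UNIV:
  assumes "transpose K = K" "\<And>i j. i \<noteq> j \<Longrightarrow> \<not> E i j \<Longrightarrow> K $ i $ j = 0"
  shows "marginal_concentration E K UNIV K"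
  using assms by (auto simp: marginal_concentration_def)

lemma marginal_exists:
  fixes K :: "real^'p::finite^'p"
  assumes "simplicial_ext E A UNIV" and sym: "\<And>u v. E u v \<Longrightarrow> E v u" and pd: "pos_def K"
    and "\<And>i j. i \<noteq> j \<Longrightarrow> \<not> E i j \<Longrightarrow> K $ i $ j = 0"
  shows "\<exists>Q. marginal_concentration E K A Q"
  using assms(1)
proof (induction A "UNIV :: 'p::finite set" rule: simplicial_ext.induct)
  case simplicial_ext_refl
  then show ?case using marginal_UNIV assms(4) pd unfolding pos_def_def by blast
next
  case (simplicial_ext_step v A)
  then obtain Q where "marginal_concentration E K (insert v A) Q" by blast
  then have "marginal_concentration E K A (\<chi> i j. Q $ i $ j - Q $ i $ v * Q $ j $ v / Q $ v $ v)"
    by (rule marginal_step) (use simplicial_ext_step sym pd in blast)+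
  then show ?case by blast
qed

section \<open>Measurability of the inverse blocks\<close>

lemma measurable_det:
  fixes A :: "'b \<Rightarrow> real^'p::finite^'p"
  assumes "\<And>i j. (\<lambda>y. A y $ i $ j) \<in> borel_measurable M"
  shows "(\<lambda>y. det (A y)) \<in> borel_measurable M"
  unfolding det_def by (intro borel_measurable_sum borel_measurable_times borel_measurable_prod assms borel_measurable_const)

lemma fill_identity_cong:
  assumes "\<And>i j. i \<in> a \<Longrightarrow> j \<in> a \<Longrightarrow> A $ i $ j = B $ i $ j"
  shows "fill_identity a A = fill_identity a B"
  using assms by (simp add: fill_identity_def vec_eq_iff)

lemma depends_on_mono: "depends_on n A f \<Longrightarrow> A \<subseteq> B \<Longrightarrow> depends_on n B f"
  unfolding depends_on_def by blast

lemma depends_on_compose: "depends_on n A f \<Longrightarrow> depends_on n A (\<lambda>y. g (f y))"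
  unfolding depends_on_def by metis

lemma depends_on_compose2:
  "depends_on n A f \<Longrightarrow> depends_on n A f' \<Longrightarrow> depends_on n A (\<lambda>y. g (f y) (f' y))"
  unfolding depends_on_def by metis

lemma depends_on_fill_identity: "depends_on n a (\<lambda>y. fill_identity a (sample_cov n y))"
  unfolding depends_on_def
proof (intro allI impI fill_identity_cong)
  fix y y' :: "nat \<Rightarrow> real^'a" and i j
  assume "\<forall>t\<in>{1..n}. \<forall>k\<in>a. y t $ k = y' t $ k" "i \<in> a" "j \<in> a"
  then show "sample_cov n y $ i $ j = sample_cov n y' $ i $ j"
    unfolding sample_cov_nth by (intro sum.cong refl) simp
qed

lemma depends_on_cramer_inverse: "depends_on n a (\<lambda>y. cramer_inverse a (sample_cov n y))"
  using depends_on_compose[OF depends_on_fill_identity[of n a], of "\<lambda>F. \<chi> i j. if i \<in> a \<and> j \<in> a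
     then det (\<chi> k l. if l = i then (if k = j then 1 else 0) else F $ k $ l) / det F else 0"]
  by (simp add: cramer_inverse_def)

section \<open>Square integrable random variables\<close>

definition square_integrable :: "'b measure \<Rightarrow> ('b \<Rightarrow> real) \<Rightarrow> bool" where
  "square_integrable M f \<longleftrightarrow> f \<in> borel_measurable M \<and> integrable M (\<lambda>x. (f x)\<^sup>2)"

lemma square_integrable_mult:
  assumes "square_integrable M f" "square_integrable M g"
  shows "integrable M (\<lambda>x. f x * g x)"
proof (rule Bochner_Integration.integrable_bound)
  show "integrable M (\<lambda>x. (f x)\<^sup>2 + (g x)\<^sup>2)"
    using assms by (simp add: square_integrable_def)
  show "(\<lambda>x. f x * g x) \<in> borel_measurable M"
    using assms by (intro borel_measurable_times) (simp_all add: square_integrable_def)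
  show "AE x in M. norm (f x * g x) \<le> norm ((f x)\<^sup>2 + (g x)\<^sup>2)"
  proof (rule AE_I2)
    fix x
    have "2 * (\<bar>f x\<bar> * \<bar>g x\<bar>) \<le> (f x)\<^sup>2 + (g x)\<^sup>2"
      using sum_squares_bound[of "\<bar>f x\<bar>" "\<bar>g x\<bar>"] by simp
    moreover have "0 \<le> \<bar>f x\<bar> * \<bar>g x\<bar>" by simp
    ultimately show "norm (f x * g x) \<le> norm ((f x)\<^sup>2 + (g x)\<^sup>2)"
      unfolding real_norm_def abs_mult by linarith
  qed
qed

lemma square_integrable_mono:
  assumes "square_integrable M g" "f \<in> borel_measurable M" "AE x in M. \<bar>f x\<bar> \<le> \<bar>g x\<bar>"
  shows "square_integrable M f"
  unfolding square_integrable_def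
proof (intro conjI assms(2))
  show "integrable M (\<lambda>x. (f x)\<^sup>2)"
  proof (rule Bochner_Integration.integrable_bound)
    show "integrable M (\<lambda>x. (g x)\<^sup>2)" using assms(1) by (simp add: square_integrable_def)
    show "AE x in M. norm ((f x)\<^sup>2) \<le> norm ((g x)\<^sup>2)"
      using assms(3) by eventually_elim (simp add: abs_le_square_iff)
  qed (use assms(2) in measurable)
qed

lemma square_integrable_add:
  assumes "square_integrable M f" "square_integrable M g"
  shows "square_integrable M (\<lambda>x. f x + g x)"
  using assms square_integrable_mult[OF assms]
  by (auto simp: square_integrable_def power2_sum mult.assoc)

lemma square_integrable_cmult:
  "square_integrable M f \<Longrightarrow> square_integrable M (\<lambda>x. c * f x)"
  by (auto simp: square_integrable_def power_mult_distrib)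

lemma square_integrable_diff:
  assumes "square_integrable M f" "square_integrable M g"
  shows "square_integrable M (\<lambda>x. f x - g x)"
  using square_integrable_add[OF assms(1) square_integrable_cmult[OF assms(2), of "-1"]] by simp

lemma square_integrable_const: "prob_space M \<Longrightarrow> square_integrable M (\<lambda>_. c)"
  by (simp add: square_integrable_def prob_space.prob_space finite_measure.integrable_const prob_space.finite_measure)

lemma square_integrable_integrable: "prob_space M \<Longrightarrow> square_integrable M f \<Longrightarrow> integrable M f"
  using square_integrable_mult[of M f "\<lambda>_. 1"] square_integrable_const[of M 1] by simp

section \<open>Inverse sample blocks of complete sets\<close>

locale graphical_sample = gaussian_sample K n for K :: "real^'p::finite^'p" and n +
  fixes E :: "'p \<Rightarrow> 'p \<Rightarrow> bool"
  assumes E_sym: "\<And>u v. E u v \<Longrightarrow> E v u"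
    and ext: "\<And>a. complete_set E a \<Longrightarrow> simplicial_ext E a UNIV"
    and K_zero: "\<And>u v. u \<noteq> v \<Longrightarrow> \<not> E u v \<Longrightarrow> K $ u $ v = 0"
    and card_le: "\<And>a. complete_set E a \<Longrightarrow> card a \<le> n"
begin

definition X where "X a y = cramer_inverse a (S y)"

abbreviation "nonsingular a y \<equiv> det (fill_identity a (S y)) \<noteq> 0"

definition coef where "coef a v y = axis v 1 - X a y *v (S y *v axis v 1)"
definition rss where "rss a v y = coef a v y \<bullet> (S y *v coef a v y)"
text \<open>The truncation event: it supplies the bound that the regression step asks of the inverse
  block, and as \<open>N\<close> grows these events exhaust the nonsingular samples.\<close>

definition good where "good a N y \<longleftrightarrow> nonsingular a y \<and> (\<forall>i j. \<bar>X a y $ i $ j\<bar> \<le> N)"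

lemma X_inverse: "nonsingular a y \<Longrightarrow> block_inverse a (S y) (X a y)"
  unfolding X_def by (rule block_inverse_cramer)

lemma X_insert:
  assumes "nonsingular a y" "v \<notin> a" "rss a v y \<noteq> 0"
  shows "nonsingular (insert v a) y"
    and "X (insert v a) y $ i $ j = X a y $ i $ j + coef a v y $ i * coef a v y $ j / rss a v y"
proof -
  have B: "block_inverse (insert v a) (S y) (\<chi> i j. X a y $ i $ j + coef a v y $ i * coef a v y $ j / rss a v y)"
    by (rule block_inverse_insert[OF sample_cov_sym X_inverse[OF assms(1)] assms(2) coef_def rss_def assms(3)])
  then show ns: "nonsingular (insert v a) y" by (rule block_inverse_det)
  show "X (insert v a) y $ i $ j = X a y $ i $ j + coef a v y $ i * coef a v y $ j / rss a v y"
    using block_inverse_unique[OF sample_cov_sym X_inverse[OF ns] B] by simp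
qed

lemma rss_nonneg: "0 \<le> rss a v y"
  by (simp add: rss_def sample_cov_inner sum_nonneg)

lemma fill_measurable [measurable]: "(\<lambda>y. fill_identity a (S y) $ i $ j) \<in> borel_measurable samples"
  by (auto simp: fill_identity_def)

lemma X_measurable [measurable]: "(\<lambda>y. X a y $ i $ j) \<in> borel_measurable samples"
proof (cases "i \<in> a \<and> j \<in> a")
  case True
  have "(\<lambda>y. det (\<chi> k l. if l = i then (if k = j then 1 else 0) else fill_identity a (S y) $ k $ l)
       / det (fill_identity a (S y))) \<in> borel_measurable samples"
    by (intro borel_measurable_divide measurable_det) (auto simp: if_distrib cong: if_cong)
  then show ?thesis using True by (simp add: X_def cramer_inverse_def)
next
  case False
  then have "(\<lambda>y. X a y $ i $ j) = (\<lambda>y. 0)" by (auto simp: X_def cramer_inverse_def)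
  then show ?thesis by simp
qed

lemma X_depends: "a \<subseteq> A \<Longrightarrow> depends_on n A (X a)"
  unfolding X_def[abs_def] by (rule depends_on_mono[OF depends_on_cramer_inverse])

lemma nonsingular_measurable [measurable]: "Measurable.pred samples (nonsingular a)"
  using measurable_det[of "\<lambda>y. fill_identity a (S y)" samples] by measurable

lemma good_measurable [measurable]: "Measurable.pred samples (good a N)"
  unfolding good_def[abs_def] by measurable

lemma good_depends: "a \<subseteq> A \<Longrightarrow> depends_on n A (good a N)"
  unfolding good_def[abs_def]
  by (intro depends_on_compose2[where g="(\<and>)"] depends_on_compose[OF X_depends, where g="\<lambda>M. \<forall>i j. \<bar>M $ i $ j\<bar> \<le> N"]
      depends_on_compose[where g="\<lambda>M. det M \<noteq> 0", OF depends_on_mono[OF depends_on_fill_identity]])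

lemma regression_setup:
  assumes w: "\<And>k. k \<in> A \<Longrightarrow> w $ k = 0" "w $ v = 1" "\<And>i. (K *v w) $ i = Q $ i $ v"
    and Q: "marginal_concentration E K (insert v A) Q" and v: "v \<notin> A"
    and h: "h \<in> borel_measurable samples" "\<And>y. \<bar>h y\<bar> \<le> N" "depends_on n A h"
      "\<And>y. h y \<noteq> 0 \<Longrightarrow> good {u\<in>A. E u v} N y"
  shows "regression K n {u\<in>A. E u v} A v w (\<lambda>y. if good {u\<in>A. E u v} N y then X {u\<in>A. E u v} y else 0) h N"
proof
  let ?a = "{u\<in>A. E u v}"
  let ?P = "\<lambda>y. if good ?a N y then X ?a y else 0"
  have N: "0 \<le> N" using h(2)[of undefined] by linarith
  show "?a \<subseteq> A" by auto
  show "v \<notin> A" by (rule v)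
  show "w $ k = 0" if "k \<in> A" for k using w that by auto
  show "w $ v = 1" by (rule w)
  show "(K *v w) $ i = 0" if "i \<notin> insert v ?a" for i
    using that Q unfolding w(3) marginal_concentration_def by blast
  show "(\<lambda>y. ?P y $ i $ j) \<in> borel_measurable samples" for i j
  proof -
    have "(\<lambda>y. if good ?a N y then X ?a y $ i $ j else 0) \<in> borel_measurable samples" by measurable
    also have "(\<lambda>y. if good ?a N y then X ?a y $ i $ j else 0) = (\<lambda>y. ?P y $ i $ j)" by auto
    finally show ?thesis .
  qed
  show "\<bar>?P y $ i $ j\<bar> \<le> N" for y i j using N by (auto simp: good_def)
  show "depends_on n A ?P"
    by (rule depends_on_compose2[where g="\<lambda>p M. if p then M else 0"]) (auto intro: good_depends X_depends)
  show "transpose (?P y) = ?P y" for y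
    using block_inverse_sym[OF sample_cov_sym X_inverse[of ?a y]]
    by (cases "good ?a N y") (simp_all add: good_def, simp add: transpose_def vec_eq_iff)
  show "?P y $ i $ j = 0" if "i \<notin> ?a \<or> j \<notin> ?a" for y i j
    using that by (auto simp: X_def cramer_inverse_def)
  show "h \<in> borel_measurable samples" "\<bar>h y\<bar> \<le> N" "depends_on n A h" for y by (rule h)+
  show "block_inverse ?a (S y) (?P y)" if "h y \<noteq> 0" for y
    using h(4)[OF that] X_inverse[of ?a y] by (simp add: good_def)
qed

lemma regression_b_r:
  assumes "regression K n a A v w P h N" "P y = X a y"
  shows "regression.b n v P y = coef a v y" "regression.r n v P y = rss a v y"
proof -
  interpret regression K n a A v w P h N by fact
  show "regression.b n v P y = coef a v y" by (simp add: b_def coef_def assms(2))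
  then show "regression.r n v P y = rss a v y" by (simp add: r_eq rss_def)
qed

lemma good_ex:
  assumes "nonsingular a y"
  shows "\<exists>N::nat. good a (real (Suc N)) y"
proof -
  obtain N :: nat where N: "(\<Sum>i\<in>UNIV. \<Sum>j\<in>UNIV. \<bar>X a y $ i $ j\<bar>) \<le> real N" using real_arch_simple by blast
  have "\<bar>X a y $ i $ j\<bar> \<le> real (Suc N)" for i j
  proof -
    have "\<bar>X a y $ i $ j\<bar> \<le> (\<Sum>j\<in>UNIV. \<bar>X a y $ i $ j\<bar>)" by (rule member_le_sum) auto
    also have "\<dots> \<le> (\<Sum>i\<in>UNIV. \<Sum>j\<in>UNIV. \<bar>X a y $ i $ j\<bar>)"
      by (rule member_le_sum[of i UNIV "\<lambda>i. \<Sum>j\<in>UNIV. \<bar>X a y $ i $ j\<bar>"]) (auto intro: sum_nonneg)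
    finally show ?thesis using N by linarith
  qed
  then show ?thesis using assms by (auto simp: good_def)
qed

text \<open>The weight is the indicator of \<open>good\<close>, and countably many bounds remove the
  truncation. The marginal matrix serves only to provide the direction \<open>w\<close>.\<close>

lemma rss_nonzero_AE:
  assumes ext: "simplicial_ext E (insert v A) UNIV" and v: "v \<notin> A" and card: "card {u\<in>A. E u v} < n"
  shows "AE y in samples. nonsingular {u\<in>A. E u v} y \<longrightarrow> rss {u\<in>A. E u v} v y \<noteq> 0"
proof -
  let ?a = "{u\<in>A. E u v}"
  obtain Q where Q: "marginal_concentration E K (insert v A) Q"
    using marginal_exists[OF ext E_sym pos_def K_zero] by blast
  obtain w where w: "\<And>k. k \<in> A \<Longrightarrow> w $ k = 0" "w $ v = 1" "\<And>i. (K *v w) $ i = Q $ i $ v"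
    using marginal_direction[OF Q v pos_def] by metis
  have "AE y in samples. good ?a (real (Suc N)) y \<longrightarrow> rss ?a v y \<noteq> 0" for N :: nat
  proof -
    define h where "h y = (if good ?a (real (Suc N)) y then 1 else 0 :: real)" for y
    have [measurable]: "h \<in> borel_measurable samples" unfolding h_def[abs_def] by measurable
    have h_dep: "depends_on n A h"
      unfolding h_def[abs_def]
      by (rule depends_on_compose[OF good_depends, where g="\<lambda>p. if p then 1 else 0"]) auto
    have R: "regression K n ?a A v w (\<lambda>y. if good ?a (real (Suc N)) y then X ?a y else 0) h (real (Suc N))"
      by (rule regression_setup[OF w Q v])
         (use h_dep in \<open>auto simp: h_def simp del: of_nat_Suc split: if_splits\<close>)
    from regression.residual_nonzero[OF R card]
    have "AE y in samples. h y \<noteq> 0 \<longrightarrow> regression.r n v (\<lambda>y. if good ?a (real (Suc N)) y then X ?a y else 0) y \<noteq> 0"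
      by (simp add: h_def)
    then show ?thesis
      by eventually_elim (use regression_b_r(2)[OF R] in \<open>auto simp: h_def\<close>)
  qed
  then have "AE y in samples. \<forall>N::nat. good ?a (real (Suc N)) y \<longrightarrow> rss ?a v y \<noteq> 0"
    unfolding AE_all_countable by blast
  then show ?thesis by eventually_elim (use good_ex in blast)
qed

text \<open>The block is built one vertex at a time, each new vertex having almost surely a nonzero
  residual. Inside a complete set all earlier vertices are neighbours, and \<open>card_le\<close>
  leaves a degree of freedom at each insertion.\<close>

lemma nonsingular_AE:
  assumes "complete_set E a"
  shows "AE y in samples. nonsingular a y"
  using finite[of a] assms
proof (induction a rule: finite_induct)
  case empty
  have "block_inverse {} (S y) 0" for y :: "nat \<Rightarrow> real^'p" by (simp add: block_inverse_def)
  then show ?case by (intro AE_I2 block_inverse_det)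
next
  case (insert v a)
  have c: "complete_set E a" using insert.prems complete_set_mono by blast
  have eq: "{u\<in>a. E u v} = a"
    using insert.hyps insert.prems by (auto simp: complete_set_def)
  have "card a < n" using card_le[OF insert.prems] insert.hyps by simp
  then have "AE y in samples. nonsingular a y \<longrightarrow> rss a v y \<noteq> 0"
    using rss_nonzero_AE[OF ext[OF insert.prems] insert.hyps(2)] eq by simp
  with insert.IH[OF c] show ?case
    by eventually_elim (use X_insert(1) insert.hyps in blast)
qed

end

section \<open>Conditional mean of the increment at one vertex\<close>

context graphical_sample
begin

lemma good_mono: "good a N y \<Longrightarrow> N \<le> N' \<Longrightarrow> good a N' y"
  by (auto simp: good_def intro: order.trans)

text \<open>With \<open>m = n - card a\<close>, the regression identity concerns
  \<open>m - 2\<close> times the increment of the block, minus \<open>X a\<close>. This regroups as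
  \<open>(m - 2) * X (insert v a) - (m - 1) * X a\<close>, whose factors are those of the unbiased
  estimator for the two block sizes. The constant on the right is the Schur correction in the
  marginal concentration matrix.\<close>

lemma elimination_identity:
  assumes ext: "simplicial_ext E (insert v A) UNIV" and v: "v \<notin> A"
    and comp: "complete_set E {u\<in>A. E u v}"
    and Q: "marginal_concentration E K (insert v A) Q"
    and h: "square_integrable samples h" "depends_on n A h"
    and Xfa: "square_integrable samples (\<lambda>y. X (insert v {u\<in>A. E u v}) y $ i $ j)"
    and Xpa: "square_integrable samples (\<lambda>y. X {u\<in>A. E u v} y $ i $ j)"
  shows "(\<integral>y. h y * ((real n - real (card (insert v {u\<in>A. E u v})) - 1) * X (insert v {u\<in>A. E u v}) y $ i $ j
       - (real n - real (card {u\<in>A. E u v}) - 1) * X {u\<in>A. E u v} y $ i $ j) \<partial>samples)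
     = Q $ i $ v * Q $ j $ v / Q $ v $ v * (\<integral>y. h y \<partial>samples)"
proof -
  define a where "a = {u\<in>A. E u v}"
  define m where "m = real n - real (card a)"
  define W where "W y = X (insert v a) y $ i $ j - X a y $ i $ j" for y
  have va: "v \<notin> a" using v by (simp add: a_def)
  have card: "card (insert v a) = Suc (card a)" using va by simp
  have "card (insert v a) \<le> n"
    using card_le[OF complete_insert_nbrs[of E A v, OF E_sym comp]] by (simp add: a_def)
  then have card_a: "card a < n" using card by simp
  obtain w where w: "\<And>k. k \<in> A \<Longrightarrow> w $ k = 0" "w $ v = 1" "\<And>i. (K *v w) $ i = Q $ i $ v"
    using marginal_direction[OF Q v pos_def] by metis
  have ns: "AE y in samples. nonsingular a y"
    unfolding a_def by (rule nonsingular_AE[OF comp])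
  have r0: "AE y in samples. nonsingular a y \<longrightarrow> rss a v y \<noteq> 0"
    unfolding a_def by (rule rss_nonzero_AE[OF ext v]) (use card_a in \<open>simp add: a_def\<close>)
  have Weq: "AE y in samples. W y = coef a v y $ i * coef a v y $ j / rss a v y"
    using ns r0
  proof eventually_elim
    case (elim y)
    then have "rss a v y \<noteq> 0" by blast
    from X_insert(2)[OF elim(1) va this] show ?case by (simp add: W_def)
  qed
  have W2: "square_integrable samples W"
    unfolding W_def[abs_def] using Xfa Xpa unfolding a_def[symmetric] by (rule square_integrable_diff)
  note Xa2 = Xpa[folded a_def]
  have hm [measurable]: "h \<in> borel_measurable samples" using h(1) by (simp add: square_integrable_def)
  have [measurable]: "W \<in> borel_measurable samples" using W2 by (simp add: square_integrable_def)
  \<comment> \<open>Truncated in value and to the event \<open>good\<close>: bounded, still a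
    function of the columns in \<open>A\<close>, and at almost every sample eventually equal to
    \<open>h\<close>.\<close>
  define hN where "hN N y = (if \<bar>h y\<bar> \<le> real (Suc N) \<and> good a (real (Suc N)) y then h y else 0)" for N :: nat and y
  have [measurable]: "hN N \<in> borel_measurable samples" for N unfolding hN_def[abs_def] by measurable
  have hN_le: "\<bar>hN N y\<bar> \<le> \<bar>h y\<bar>" for N y by (simp add: hN_def)
  have hN2: "square_integrable samples (hN N)" for N
    by (rule square_integrable_mono[OF h(1)]) (use hN_le in auto)
  have identity: "(\<integral>y. hN N y * ((m - 2) * W y - X a y $ i $ j) \<partial>samples)
      = Q $ i $ v * Q $ j $ v / Q $ v $ v * (\<integral>y. hN N y \<partial>samples)" for N
  proof -
    define P where "P y = (if good a (real (Suc N)) y then X a y else 0)" for y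
    have dep: "depends_on n A (hN N)"
      unfolding hN_def[abs_def]
      by (rule depends_on_compose2[OF h(2) good_depends, where g="\<lambda>u p. if \<bar>u\<bar> \<le> real (Suc N) \<and> p then u else 0"])
         (auto simp: a_def)
    have R: "regression K n a A v w P (hN N) (real (Suc N))"
      unfolding P_def[abs_def] a_def
      by (rule regression_setup[OF w Q v])
         (use dep in \<open>auto simp: hN_def a_def simp del: of_nat_Suc split: if_splits\<close>)
    have P_eq: "P y = X a y" if "hN N y \<noteq> 0" for y
      using that by (auto simp: hN_def P_def split: if_splits)
    have b_eq: "regression.b n v P y = coef a v y" "regression.r n v P y = rss a v y" if "hN N y \<noteq> 0" for y
      using regression_b_r[OF R P_eq[OF that]] by auto
    have WN: "AE y in samples. hN N y * W y = hN N y * regression.b n v P y $ i * regression.b n v P y $ j / regression.r n v P y"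
      using Weq
    proof eventually_elim
      case (elim y)
      then show ?case by (cases "hN N y = 0") (simp_all add: b_eq)
    qed
    \<comment> \<open>The integrability that the limit in \<epsilon> asks for: the quotient agrees
      almost everywhere with this product of square integrable functions.\<close>
    have int: "integrable samples (\<lambda>y. hN N y * W y)" by (rule square_integrable_mult[OF hN2 W2])
    interpret R: regression K n a A v w P "hN N" "real (Suc N)" by (rule R)
    have meas: "(\<lambda>y. hN N y * R.b y $ i * R.b y $ j / R.r y) \<in> borel_measurable samples" by measurable
    have int': "integrable samples (\<lambda>y. hN N y * R.b y $ i * R.b y $ j / R.r y)"
      using int integrable_cong_AE[OF _ meas WN] by auto
    have "AE y in samples. hN N y \<noteq> 0 \<longrightarrow> R.r y \<noteq> 0"
      using r0 by eventually_elim (auto simp: b_eq hN_def good_def split: if_splits)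
    from R.regression_identity[OF this int']
    have "(m - 2) * (\<integral>y. hN N y * W y \<partial>samples) - (\<integral>y. hN N y * P y $ i $ j \<partial>samples)
      = Q $ i $ v * Q $ j $ v / Q $ v $ v * (\<integral>y. hN N y \<partial>samples)"
      using integral_cong_AE[OF _ meas WN] by (simp add: m_def w(3))
    moreover have "(\<lambda>y. hN N y * P y $ i $ j) = (\<lambda>y. hN N y * X a y $ i $ j)"
    proof
      fix y show "hN N y * P y $ i $ j = hN N y * X a y $ i $ j"
        using P_eq[of y] by (cases "hN N y = 0") auto
    qed
    moreover have "(\<integral>y. hN N y * ((m - 2) * W y - X a y $ i $ j) \<partial>samples)
      = (\<integral>y. (m - 2) * (hN N y * W y) - hN N y * X a y $ i $ j \<partial>samples)"
      by (intro Bochner_Integration.integral_cong refl) (simp add: algebra_simps)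
    moreover have "\<dots> = (m - 2) * (\<integral>y. hN N y * W y \<partial>samples) - (\<integral>y. hN N y * X a y $ i $ j \<partial>samples)"
      by (subst Bochner_Integration.integral_diff) (use int square_integrable_mult[OF hN2 Xa2] in auto)
    ultimately show ?thesis by simp
  qed
  have hN_lim: "AE y in samples. \<forall>\<^sub>F N in sequentially. hN N y = h y"
    using ns
  proof eventually_elim
    case (elim y)
    then obtain N1 :: nat where N1: "good a (real (Suc N1)) y" using good_ex by blast
    obtain N2 :: nat where N2: "\<bar>h y\<bar> \<le> real N2" using real_arch_simple by blast
    show ?case
    proof (rule eventually_sequentiallyI[of "max N1 N2"])
      fix N assume N: "max N1 N2 \<le> N"
      then have "good a (real (Suc N)) y" by (intro good_mono[OF N1]) auto
      moreover have "\<bar>h y\<bar> \<le> real (Suc N)" using N2 N by (auto intro: order.trans)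
      ultimately show "hN N y = h y" by (simp add: hN_def)
    qed
  qed
  define V where "V y = (m - 2) * W y - X a y $ i $ j" for y
  have V2: "square_integrable samples V"
    unfolding V_def[abs_def] by (intro square_integrable_diff square_integrable_cmult W2 Xa2)
  have [measurable]: "V \<in> borel_measurable samples" using V2 by (simp add: square_integrable_def)
  have "(\<lambda>N. \<integral>y. hN N y * V y \<partial>samples) \<longlonglongrightarrow> (\<integral>y. h y * V y \<partial>samples)"
  proof (rule integral_dominated_convergence[where w="\<lambda>y. \<bar>h y * V y\<bar>"])
    show "integrable samples (\<lambda>y. \<bar>h y * V y\<bar>)"
      using square_integrable_mult[OF h(1) V2] by (rule integrable_abs)
    show "AE y in samples. (\<lambda>N. hN N y * V y) \<longlonglongrightarrow> h y * V y"
      using hN_lim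
    proof eventually_elim
      case (elim y)
      then show ?case by (intro tendsto_eventually) (auto elim: eventually_mono)
    qed
    show "AE y in samples. norm (hN N y * V y) \<le> \<bar>h y * V y\<bar>" for N
      using hN_le by (intro AE_I2) (simp add: abs_mult mult_right_mono)
  qed measurable
  moreover have "(\<lambda>N. \<integral>y. hN N y \<partial>samples) \<longlonglongrightarrow> (\<integral>y. h y \<partial>samples)"
  proof (rule integral_dominated_convergence[where w="\<lambda>y. \<bar>h y\<bar>"])
    show "integrable samples (\<lambda>y. \<bar>h y\<bar>)"
      using square_integrable_integrable[OF prob_samples h(1)] by (rule integrable_abs)
    show "AE y in samples. (\<lambda>N. hN N y) \<longlonglongrightarrow> h y"
      using hN_lim by eventually_elim (rule tendsto_eventually)
    show "AE y in samples. norm (hN N y) \<le> \<bar>h y\<bar>" for N using hN_le by auto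
  qed measurable
  then have "(\<lambda>N. \<integral>y. hN N y * V y \<partial>samples) \<longlonglongrightarrow> Q $ i $ v * Q $ j $ v / Q $ v $ v * (\<integral>y. h y \<partial>samples)"
    unfolding V_def identity by (intro tendsto_intros)
  ultimately have "(\<integral>y. h y * V y \<partial>samples) = Q $ i $ v * Q $ j $ v / Q $ v $ v * (\<integral>y. h y \<partial>samples)"
    by (rule LIMSEQ_unique)
  moreover have "V y = (real n - real (card (insert v a)) - 1) * X (insert v a) y $ i $ j
       - (real n - real (card a) - 1) * X a y $ i $ j" for y
    unfolding V_def W_def m_def card by (simp add: algebra_simps)
  ultimately show ?thesis by (simp add: a_def)
qed

end

section \<open>Comparison of the two estimators\<close>

definition moebius :: "('v::finite set \<Rightarrow> real) \<Rightarrow> 'v set \<Rightarrow> real" where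
  "moebius \<phi> = (SOME \<mu>. \<forall>c. \<phi> c = (\<Sum>a\<in>Pow c. \<mu> a))"

text \<open>The order-free form of a sum over cliques minus a sum over separators, extended to every
  vertex set so that it can be followed while vertices are added.\<close>

definition clique_sum :: "('v \<Rightarrow> 'v \<Rightarrow> bool) \<Rightarrow> ('v::finite set \<Rightarrow> real) \<Rightarrow> 'v set \<Rightarrow> real" where
  "clique_sum E \<phi> A = sum (moebius \<phi>) (complete_subsets E A)"

lemma moebius: "\<phi> c = (\<Sum>a\<in>Pow c. moebius \<phi> a)"
proof -
  obtain \<mu> where "\<And>c. \<phi> c = (\<Sum>a\<in>Pow c. \<mu> a)" using moebius_inverse by metis
  then have "\<exists>\<mu>. \<forall>c. \<phi> c = (\<Sum>a\<in>Pow c. \<mu> a)" by blast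
  from someI_ex[OF this] show ?thesis unfolding moebius_def by blast
qed

lemma clique_sum_empty [simp]: "clique_sum E \<phi> {} = 0"
proof -
  have "complete_subsets E {} = {}" by (auto simp: complete_subsets_def)
  then show ?thesis by (simp add: clique_sum_def)
qed

lemma clique_sum_complete: "complete_set E a \<Longrightarrow> clique_sum E \<phi> a = \<phi> a - \<phi> {}"
  using complete_subsets_complete[of E a "moebius \<phi>"]
  unfolding clique_sum_def moebius[of \<phi>, symmetric] by simp

lemma clique_sum_insert:
  assumes "\<And>u v. E u v \<Longrightarrow> E v u" "v \<notin> A" "complete_set E {u\<in>A. E u v}"
  shows "clique_sum E \<phi> (insert v A) = clique_sum E \<phi> A
    + (\<phi> (insert v {u\<in>A. E u v}) - \<phi> {u\<in>A. E u v})"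
  using complete_subsets_insert[of E v A "moebius \<phi>", OF assms]
  unfolding clique_sum_def moebius[of \<phi>, symmetric] by simp

context graphical_sample
begin

definition mle where
  "mle i j A y = clique_sum E (\<lambda>a. real n * X a y $ i $ j) A"

definition mvue where
  "mvue i j A y = clique_sum E (\<lambda>a. (real n - real (card a) - 1) * X a y $ i $ j) A"

lemma X_empty [simp]: "X {} y $ i $ j = 0"
  by (simp add: X_def cramer_inverse_def)

lemma mle_insert:
  assumes "v \<notin> A" "complete_set E {u\<in>A. E u v}"
  shows "mle i j (insert v A) y = mle i j A y
    + (real n * X (insert v {u\<in>A. E u v}) y $ i $ j - real n * X {u\<in>A. E u v} y $ i $ j)"
  unfolding mle_def by (rule clique_sum_insert) (use assms E_sym in blast)+

lemma mvue_insert: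
  assumes "v \<notin> A" "complete_set E {u\<in>A. E u v}"
  shows "mvue i j (insert v A) y = mvue i j A y
    + ((real n - real (card (insert v {u\<in>A. E u v})) - 1) * X (insert v {u\<in>A. E u v}) y $ i $ j
      - (real n - real (card {u\<in>A. E u v}) - 1) * X {u\<in>A. E u v} y $ i $ j)"
  unfolding mvue_def by (rule clique_sum_insert) (use assms E_sym in blast)+

lemma mle_empty [simp]: "mle i j {} y = 0" and mvue_empty [simp]: "mvue i j {} y = 0"
  by (simp_all add: mle_def mvue_def)

lemma mle_complete: "complete_set E a \<Longrightarrow> mle i j a y = real n * X a y $ i $ j"
  by (simp add: mle_def clique_sum_complete)

lemma mvue_complete:
  "complete_set E a \<Longrightarrow> mvue i j a y = (real n - real (card a) - 1) * X a y $ i $ j"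
  by (simp add: mvue_def clique_sum_complete)

lemma complete_empty: "complete_set E {}"
  by (simp add: complete_set_def)

text \<open>Transfers additive properties from one-vertex increments to the whole estimator; it
  serves measurability, almost sure nonnegativity and square integrability alike.\<close>

lemma clique_sum_induct:
  assumes zero: "R (\<lambda>y. 0)" and add: "\<And>f g. R f \<Longrightarrow> R g \<Longrightarrow> R (\<lambda>y. f y + g y)"
    and diff: "\<And>v A. simplicial_ext E (insert v A) UNIV \<Longrightarrow> v \<notin> A \<Longrightarrow> complete_set E {u\<in>A. E u v} \<Longrightarrow>
      R (\<lambda>y. \<phi> y (insert v {u\<in>A. E u v}) - \<phi> y {u\<in>A. E u v})"
    and "simplicial_ext E A UNIV"
  shows "R (\<lambda>y. clique_sum E (\<phi> y) UNIV - clique_sum E (\<phi> y) A)"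
  using assms(4)
proof (induction A "UNIV :: 'p set" rule: simplicial_ext.induct)
  case simplicial_ext_refl
  then show ?case using zero by simp
next
  case (simplicial_ext_step v A)
  have "(\<lambda>y. clique_sum E (\<phi> y) UNIV - clique_sum E (\<phi> y) A) =
    (\<lambda>y. (clique_sum E (\<phi> y) UNIV - clique_sum E (\<phi> y) (insert v A))
      + (\<phi> y (insert v {u\<in>A. E u v}) - \<phi> y {u\<in>A. E u v}))"
    using clique_sum_insert[OF E_sym simplicial_ext_step.hyps(3,4)] by (simp add: fun_eq_iff)
  then show ?case
    using add[OF simplicial_ext_step.hyps(2) diff[OF simplicial_ext_step.hyps(1,3,4)]] by simp
qed

lemma mle_measurable [measurable]: "mle i j UNIV \<in> borel_measurable samples"
proof -
  have "(\<lambda>y. clique_sum E (\<lambda>a. real n * X a y $ i $ j) UNIV - clique_sum E (\<lambda>a. real n * X a y $ i $ j) {})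
      \<in> borel_measurable samples"
    by (rule clique_sum_induct[where R="\<lambda>f. f \<in> borel_measurable samples", OF _ _ _ ext[OF complete_empty]])
       (intro borel_measurable_add borel_measurable_diff borel_measurable_times borel_measurable_const
          X_measurable | assumption)+
  then show ?thesis by (simp add: mle_def[abs_def])
qed

lemma mvue_measurable [measurable]: "mvue i j UNIV \<in> borel_measurable samples"
proof -
  have "(\<lambda>y. clique_sum E (\<lambda>a. (real n - real (card a) - 1) * X a y $ i $ j) UNIV
     - clique_sum E (\<lambda>a. (real n - real (card a) - 1) * X a y $ i $ j) {}) \<in> borel_measurable samples"
    by (rule clique_sum_induct[where R="\<lambda>f. f \<in> borel_measurable samples", OF _ _ _ ext[OF complete_empty]])
       (intro borel_measurable_add borel_measurable_diff borel_measurable_times borel_measurable_const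
          X_measurable | assumption)+
  then show ?thesis by (simp add: mvue_def[abs_def])
qed

text \<open>On its block \<open>X\<close> equals \<open>X S X\<close>, and \<open>S\<close> is a sum
  of outer products of the data, so the inverse block is a Gram matrix.\<close>

lemma X_gram:
  assumes "nonsingular a y"
  shows "X a y $ i $ j = (\<Sum>t\<in>{1..n}. (y t \<bullet> (X a y *v axis j 1)) * (y t \<bullet> (X a y *v axis i 1)))"
proof -
  note B = X_inverse[OF assms]
  have "X a y $ i $ j = axis i 1 \<bullet> (X a y *v (S y *v (X a y *v axis j 1)))"
  proof -
    have "X a y *v (S y *v (X a y *v axis j 1)) = X a y *v axis j 1"
      by (rule block_inverse_mult_left[OF sample_cov_sym B]) (rule block_inverse_mult_supp[OF B])
    then show ?thesis by (simp flip: matrix_nth)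
  qed
  also have "\<dots> = (X a y *v axis i 1) \<bullet> (S y *v (X a y *v axis j 1))"
    using block_inverse_dot[OF sample_cov_sym B B] by simp
  finally show ?thesis unfolding sample_cov_inner .
qed

lemma X_diag_nonneg: "nonsingular a y \<Longrightarrow> 0 \<le> X a y $ i $ i"
  unfolding X_gram by (rule sum_nonneg) simp

lemma X_offdiag_le:
  assumes "nonsingular a y"
  shows "\<bar>X a y $ i $ j\<bar> \<le> X a y $ i $ i + X a y $ j $ j"
proof -
  define f where "f i t = y t \<bullet> (X a y *v axis i 1)" for i t
  have X: "X a y $ i $ j = (\<Sum>t\<in>{1..n}. f j t * f i t)" for i j
    unfolding f_def by (rule X_gram[OF assms])
  have "\<bar>X a y $ i $ j\<bar> \<le> (\<Sum>t\<in>{1..n}. \<bar>f j t * f i t\<bar>)" unfolding X by (rule sum_abs)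
  also have "\<dots> \<le> (\<Sum>t\<in>{1..n}. f i t * f i t + f j t * f j t)"
  proof (rule sum_mono)
    fix t
    have "2 * (\<bar>f j t\<bar> * \<bar>f i t\<bar>) \<le> (f j t)\<^sup>2 + (f i t)\<^sup>2"
      using sum_squares_bound[of "\<bar>f j t\<bar>" "\<bar>f i t\<bar>"] by simp
    moreover have "0 \<le> \<bar>f j t\<bar> * \<bar>f i t\<bar>" by simp
    ultimately show "\<bar>f j t * f i t\<bar> \<le> f i t * f i t + f j t * f j t"
      unfolding abs_mult power2_eq_square by linarith
  qed
  finally show ?thesis unfolding X by (simp add: sum.distrib)
qed

lemma X_diag_increment:
  assumes ext: "simplicial_ext E (insert v A) UNIV" and v: "v \<notin> A" and comp: "complete_set E {u\<in>A. E u v}"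
  shows "AE y in samples. 0 \<le> X (insert v {u\<in>A. E u v}) y $ i $ i - X {u\<in>A. E u v} y $ i $ i"
proof -
  let ?a = "{u\<in>A. E u v}"
  have "card (insert v ?a) \<le> n"
    using card_le[OF complete_insert_nbrs[of E A v, OF E_sym comp]] .
  then have "card ?a < n" using v by simp
  from rss_nonzero_AE[OF ext v this] nonsingular_AE[OF comp] show ?thesis
  proof eventually_elim
    case (elim y)
    then have "rss ?a v y \<noteq> 0" by blast
    then have "X (insert v ?a) y $ i $ i - X ?a y $ i $ i = coef ?a v y $ i * coef ?a v y $ i / rss ?a v y"
      using X_insert(2)[OF elim(2), of v i i] v by simp
    then show ?case using rss_nonneg[of ?a v y] by simp
  qed
qed

text \<open>Diagonal increments are a square over a residual sum of squares, hence nonnegative.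
  Starting the vertex order at \<open>a\<close>, the diagonal of the maximum likelihood estimator
  therefore dominates that of \<open>real n * X a\<close>; the Gram form carries the bound to the
  other entries.\<close>

lemma X_square_integrable:
  assumes mle2: "\<And>i. square_integrable samples (mle i i UNIV)" and comp: "complete_set E a"
  shows "square_integrable samples (\<lambda>y. X a y $ i $ j)"
proof -
  have n: "1 \<le> n" using card_le[of "{undefined}"] by (simp add: complete_set_def)
  have increment: "AE y in samples. 0 \<le> mle i i UNIV y - mle i i a y" for i
    unfolding mle_def
  proof (rule clique_sum_induct[where R="\<lambda>f. AE y in samples. 0 \<le> f y", OF _ _ _ ext[OF comp]])
    show "AE y in samples. 0 \<le> f y + g y"
      if "AE y in samples. 0 \<le> f y" "AE y in samples. 0 \<le> g y" for f g :: "_ \<Rightarrow> real"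
      using that by eventually_elim simp
    show "AE y in samples. 0 \<le> real n * X (insert v {u\<in>A. E u v}) y $ i $ i - real n * X {u\<in>A. E u v} y $ i $ i"
      if "simplicial_ext E (insert v A) UNIV" "v \<notin> A" "complete_set E {u\<in>A. E u v}" for v A
      using X_diag_increment[OF that, of i] by eventually_elim (simp add: mult_left_mono)
  qed simp
  have diag: "AE y in samples. X a y $ i $ i \<le> mle i i UNIV y" for i
    using increment[of i] nonsingular_AE[OF comp]
  proof eventually_elim
    case (elim y)
    have "1 * X a y $ i $ i \<le> real n * X a y $ i $ i"
      using n X_diag_nonneg[OF elim(2)] by (intro mult_right_mono) auto
    then show ?case using elim(1) by (simp add: mle_complete[OF comp])
  qed
  show ?thesis
  proof (rule square_integrable_mono)
    show "square_integrable samples (\<lambda>y. mle i i UNIV y + mle j j UNIV y)"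
      by (intro square_integrable_add mle2)
    show "AE y in samples. \<bar>X a y $ i $ j\<bar> \<le> \<bar>mle i i UNIV y + mle j j UNIV y\<bar>"
      using diag[of i] diag[of j] nonsingular_AE[OF comp]
    proof eventually_elim
      case (elim y)
      then show ?case using X_offdiag_le[OF elim(3), of i j] by linarith
    qed
  qed measurable
qed

section \<open>Projections of the estimation error and comparison of risks\<close>

context
  assumes X2: "\<And>a i j. complete_set E a \<Longrightarrow> square_integrable samples (\<lambda>y. X a y $ i $ j)"
begin

lemma mvue_square_integrable_diff:
  assumes ext: "simplicial_ext E A UNIV"
  shows "square_integrable samples (\<lambda>y. mvue i j UNIV y - mvue i j A y)"
proof -
  have c: "square_integrable samples (\<lambda>y. (real n - real (card (insert v {u\<in>A. E u v})) - 1) * X (insert v {u\<in>A. E u v}) y $ i $ j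
      - (real n - real (card {u\<in>A. E u v}) - 1) * X {u\<in>A. E u v} y $ i $ j)"
    if comp: "complete_set E {u\<in>A. E u v}" for v A
  proof -
    have "complete_set E (insert v {u\<in>A. E u v})"
      using complete_insert_nbrs[of E A v, OF E_sym comp] .
    from square_integrable_diff[OF square_integrable_cmult[OF X2[OF this]] square_integrable_cmult[OF X2[OF comp]]]
    show ?thesis .
  qed
  show ?thesis
    unfolding mvue_def
    by (rule clique_sum_induct[where R="square_integrable samples" and
          \<phi>="\<lambda>y a. (real n - real (card a) - 1) * X a y $ i $ j",
          OF square_integrable_const[OF prob_samples] square_integrable_add c ext])
qed

lemma mvue_square_integrable: "square_integrable samples (mvue i j UNIV)"
  using mvue_square_integrable_diff[OF ext[OF complete_empty], of i j] by simp

text \<open>Each vertex contributes its Schur correction, and the corrections telescope to the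
  difference between \<open>K\<close> and the marginal matrix of \<open>A\<close>. A function of the
  columns in \<open>A\<close> remains an admissible test function at every larger stage.\<close>

lemma mvue_projection:
  assumes "simplicial_ext E A UNIV"
  shows "\<exists>Q. marginal_concentration E K A Q \<and> (\<forall>h. square_integrable samples h \<longrightarrow> depends_on n A h \<longrightarrow>
      (\<integral>y. h y * (mvue i j UNIV y - mvue i j A y) \<partial>samples) = (K $ i $ j - Q $ i $ j) * (\<integral>y. h y \<partial>samples))"
  using assms
proof (induction A "UNIV :: 'p set" rule: simplicial_ext.induct)
  case simplicial_ext_refl
  have "marginal_concentration E K UNIV K" by (rule marginal_UNIV[OF K_sym K_zero])
  then show ?case by (intro exI[of _ K]) auto
next
  case (simplicial_ext_step v A)
  let ?a = "{u\<in>A. E u v}"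
  obtain Q where Q: "marginal_concentration E K (insert v A) Q" and
    IH: "\<And>h. square_integrable samples h \<Longrightarrow> depends_on n (insert v A) h \<Longrightarrow>
      (\<integral>y. h y * (mvue i j UNIV y - mvue i j (insert v A) y) \<partial>samples) = (K $ i $ j - Q $ i $ j) * (\<integral>y. h y \<partial>samples)"
    using simplicial_ext_step.hyps(2) by blast
  define Q' where "Q' = (\<chi> i j. Q $ i $ j - Q $ i $ v * Q $ j $ v / Q $ v $ v)"
  have "marginal_concentration E K A Q'"
    unfolding Q'_def by (rule marginal_step[OF Q simplicial_ext_step.hyps(3) E_sym simplicial_ext_step.hyps(4) pos_def])
  moreover have "(\<integral>y. h y * (mvue i j UNIV y - mvue i j A y) \<partial>samples) = (K $ i $ j - Q' $ i $ j) * (\<integral>y. h y \<partial>samples)"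
    if h: "square_integrable samples h" "depends_on n A h" for h
  proof -
    define V where "V y = (real n - real (card (insert v ?a)) - 1) * X (insert v ?a) y $ i $ j
       - (real n - real (card ?a) - 1) * X ?a y $ i $ j" for y
    have cfa: "complete_set E (insert v ?a)"
      using complete_insert_nbrs[of E A v, OF E_sym simplicial_ext_step.hyps(4)] .
    have V2: "square_integrable samples V"
      unfolding V_def[abs_def]
      by (intro square_integrable_diff square_integrable_cmult X2 cfa simplicial_ext_step.hyps(4))
    have "h y * (mvue i j UNIV y - mvue i j A y) = h y * (mvue i j UNIV y - mvue i j (insert v A) y) + h y * V y" for y
      unfolding mvue_insert[OF simplicial_ext_step.hyps(3,4)] V_def by (simp add: algebra_simps)
    then have "(\<integral>y. h y * (mvue i j UNIV y - mvue i j A y) \<partial>samples)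
      = (\<integral>y. h y * (mvue i j UNIV y - mvue i j (insert v A) y) \<partial>samples) + (\<integral>y. h y * V y \<partial>samples)"
      using square_integrable_mult[OF h(1) V2]
        square_integrable_mult[OF h(1) mvue_square_integrable_diff[OF simplicial_ext_step.hyps(1)]] by simp
    also have "\<dots> = (K $ i $ j - Q $ i $ j) * (\<integral>y. h y \<partial>samples) + Q $ i $ v * Q $ j $ v / Q $ v $ v * (\<integral>y. h y \<partial>samples)"
      using IH[OF h(1) depends_on_mono[OF h(2)]]
        elimination_identity[OF simplicial_ext_step.hyps(1,3,4) Q h X2[OF cfa] X2[OF simplicial_ext_step.hyps(4)]]
      unfolding V_def by auto
    finally show ?thesis by (simp add: Q'_def algebra_simps)
  qed
  ultimately show ?case by blast
qed

definition centered where
  "centered i j a y = mvue i j a y - (\<integral>y. mvue i j a y \<partial>samples)"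

lemma mvue_complete_square_integrable: "complete_set E a \<Longrightarrow> square_integrable samples (mvue i j a)"
proof -
  assume a: "complete_set E a"
  then have "mvue i j a = (\<lambda>y. (real n - real (card a) - 1) * X a y $ i $ j)"
    using mvue_complete by blast
  then show ?thesis using square_integrable_cmult[OF X2[OF a]] by simp
qed

lemma centered_square_integrable: "complete_set E a \<Longrightarrow> square_integrable samples (centered i j a)"
  unfolding centered_def[abs_def]
  by (intro square_integrable_diff square_integrable_const prob_samples mvue_complete_square_integrable)

text \<open>For a complete set \<open>a\<close> the conditional expectation of the estimation error given the
  columns in \<open>a\<close> is the centered block estimator.\<close>
lemma error_projection:
  assumes comp: "complete_set E a" and h: "square_integrable samples h" "depends_on n a h"
  shows "(\<integral>y. h y * (mvue i j UNIV y - K $ i $ j) \<partial>samples) = (\<integral>y. h y * centered i j a y \<partial>samples)"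
proof -
  interpret prob_space samples by (rule prob_samples)
  note int = square_integrable_integrable[OF prob_samples]
  note M2 = mvue_square_integrable[of i j] mvue_complete_square_integrable[OF comp, of i j]
  have one: "square_integrable samples (\<lambda>_. 1)" "depends_on n b (\<lambda>_. 1 :: real)" for b
    by (simp_all add: square_integrable_const prob_samples depends_on_def)
  \<comment> \<open>For the empty set both the block estimator and the marginal matrix are zero, so
    the projection onto constants is unbiasedness.\<close>
  obtain Q0 where "marginal_concentration E K {} Q0" and
    "(\<integral>y. 1 * (mvue i j UNIV y - mvue i j {} y) \<partial>samples) = (K $ i $ j - Q0 $ i $ j) * (\<integral>y. 1 \<partial>samples)"
    using mvue_projection[OF ext[OF complete_empty], of i j] one by blast
  then have unbiased: "(\<integral>y. mvue i j UNIV y \<partial>samples) = K $ i $ j"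
    by (simp add: marginal_concentration_def prob_space)
  obtain Q where Q: "\<And>h. square_integrable samples h \<Longrightarrow> depends_on n a h \<Longrightarrow>
      (\<integral>y. h y * (mvue i j UNIV y - mvue i j a y) \<partial>samples) = (K $ i $ j - Q $ i $ j) * (\<integral>y. h y \<partial>samples)"
    using mvue_projection[OF ext[OF comp], of i j] by blast
  \<comment> \<open>Testing against 1 identifies the constant \<open>Q $ i $ j\<close> as the mean
    of the block estimator.\<close>
  have "(\<integral>y. 1 * (mvue i j UNIV y - mvue i j a y) \<partial>samples) = K $ i $ j - Q $ i $ j"
    using Q[OF one] by (simp add: prob_space)
  then have Qeq: "(\<integral>y. mvue i j a y \<partial>samples) = Q $ i $ j"
    using int[OF M2(1)] int[OF M2(2)] unbiased by simp
  have i1: "integrable samples (\<lambda>y. h y * mvue i j UNIV y)" "integrable samples (\<lambda>y. h y * mvue i j a y)"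
    "integrable samples h"
    using square_integrable_mult[OF h(1)] M2 int[OF h(1)] by auto
  have "(\<integral>y. h y * mvue i j UNIV y \<partial>samples) - (\<integral>y. h y * mvue i j a y \<partial>samples) = (K $ i $ j - Q $ i $ j) * (\<integral>y. h y \<partial>samples)"
    using Q[OF h] i1 by (simp add: right_diff_distrib)
  then show ?thesis
    using i1 by (simp add: centered_def Qeq algebra_simps)
qed

text \<open>Removing \<open>v\<close> from \<open>a\<close> leaves a block with zero entry at
  \<open>v\<close>, so the elimination identity equates \<open>n - card a - 1\<close> times the mean
  of \<open>X a y $ v $ v\<close> with \<open>Q $ v $ v > 0\<close>. As that mean is nonnegative,
  the factor is positive: finite second moments force the sample to be large enough.\<close>

lemma dof_pos:
  assumes comp: "complete_set E a" and "a \<noteq> {}"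
  shows "real n - real (card a) - 1 > 0"
proof -
  interpret prob_space samples by (rule prob_samples)
  obtain v where v: "v \<in> a" using assms(2) by blast
  define A where "A = a - {v}"
  have a: "a = insert v A" "v \<notin> A" using v by (auto simp: A_def)
  have nb: "{u\<in>A. E u v} = A" using comp a by (auto simp: complete_set_def)
  have cA: "complete_set E A" using comp a complete_set_mono by blast
  obtain Q where Q: "marginal_concentration E K (insert v A) Q"
    using marginal_exists[OF ext[OF comp] E_sym pos_def K_zero] a by auto
  have Qv: "Q $ v $ v > 0" using marginal_direction[OF Q a(2) pos_def] by metis
  have one: "square_integrable samples (\<lambda>_. 1)" "depends_on n A (\<lambda>_. 1 :: real)"
    by (simp_all add: square_integrable_const prob_samples depends_on_def)
  have XA: "X A y $ v $ v = 0" for y using a(2) by (simp add: X_def cramer_inverse_def)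
  have "(\<integral>y. 1 * ((real n - real (card a) - 1) * X a y $ v $ v - (real n - real (card A) - 1) * X A y $ v $ v) \<partial>samples)
    = Q $ v $ v * Q $ v $ v / Q $ v $ v * (\<integral>y. 1 \<partial>samples)"
    using elimination_identity[of v A Q "\<lambda>_. 1" v v] ext[OF comp] Q one X2[OF comp] X2[OF cA] cA a
    by (simp add: nb)
  then have *: "(real n - real (card a) - 1) * (\<integral>y. X a y $ v $ v \<partial>samples) > 0"
    using Qv by (simp add: XA prob_space)
  have "0 \<le> (\<integral>y. X a y $ v $ v \<partial>samples)"
    using nonsingular_AE[OF comp] by (intro integral_nonneg_AE) (auto elim: eventually_mono intro: X_diag_nonneg)
  then show ?thesis using * by (simp add: zero_less_mult_iff)
qed

text \<open>Up to scale and shift \<open>X a\<close> is the centered block estimator, and the shift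
  drops out because that estimator has mean zero.\<close>

lemma X_error:
  assumes comp: "complete_set E a" and pos: "0 < real n - real (card a) - 1"
  shows "(\<integral>y. X a y $ i $ j * (mvue i j UNIV y - K $ i $ j) \<partial>samples)
    = (\<integral>y. (centered i j a y)\<^sup>2 \<partial>samples) / (real n - real (card a) - 1)"
proof -
  interpret prob_space samples by (rule prob_samples)
  define c where "c = real n - real (card a) - 1"
  note int = square_integrable_integrable[OF prob_samples]
  note Y2 = centered_square_integrable[OF comp, of i j]
  have Y0: "(\<integral>y. centered i j a y \<partial>samples) = 0"
    using int[OF mvue_complete_square_integrable[OF comp, of i j]] by (simp add: centered_def prob_space)
  define \<kappa> where "\<kappa> = (\<integral>y. mvue i j a y \<partial>samples)"
  have "X a y $ i $ j = (centered i j a y + \<kappa>) / c" for y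
    using pos by (simp add: centered_def \<kappa>_def mvue_complete[OF comp] c_def)
  then have "X a y $ i $ j * centered i j a y = (1 / c) * ((centered i j a y)\<^sup>2 + \<kappa> * centered i j a y)" for y
    by (simp add: power2_eq_square algebra_simps add_divide_distrib)
  then have "(\<integral>y. X a y $ i $ j * centered i j a y \<partial>samples)
    = (1 / c) * ((\<integral>y. (centered i j a y)\<^sup>2 \<partial>samples) + \<kappa> * (\<integral>y. centered i j a y \<partial>samples))"
    using int[OF Y2] Y2 by (simp add: square_integrable_def)
  then show ?thesis
    using error_projection[OF comp X2[OF comp], of i j i j] depends_on_compose[OF X_depends[of a a], of "\<lambda>M. M $ i $ j"]
    by (simp add: Y0 c_def)
qed

text \<open>Projecting the error onto the columns in \<open>b\<close> and then onto those in
  \<open>a\<close> gives the projection onto the latter. So \<open>centered i j a\<close> is the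
  projection of \<open>centered i j b\<close>, and projections do not increase the norm.\<close>

lemma centered_mono:
  assumes b: "complete_set E b" and "a \<subseteq> b"
  shows "(\<integral>y. (centered i j a y)\<^sup>2 \<partial>samples) \<le> (\<integral>y. (centered i j b y)\<^sup>2 \<partial>samples)"
proof -
  have a: "complete_set E a" using complete_set_mono[OF b assms(2)] .
  note A2 = centered_square_integrable[OF a, of i j] and B2 = centered_square_integrable[OF b, of i j]
  have dep: "depends_on n a (centered i j a)"
    unfolding centered_def[abs_def] mvue_complete[OF a]
    by (rule depends_on_compose[OF X_depends[of a a]]) simp
  have "(\<integral>y. centered i j a y * centered i j b y \<partial>samples) = (\<integral>y. (centered i j a y)\<^sup>2 \<partial>samples)"
    using error_projection[OF a A2 dep, of i j] error_projection[OF b A2 depends_on_mono[OF dep assms(2)], of i j]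
    by (simp add: power2_eq_square)
  moreover have "0 \<le> (\<integral>y. (centered i j b y - centered i j a y)\<^sup>2 \<partial>samples)" by simp
  moreover have "(\<integral>y. (centered i j b y - centered i j a y)\<^sup>2 \<partial>samples)
    = (\<integral>y. (centered i j b y)\<^sup>2 \<partial>samples) + (\<integral>y. (centered i j a y)\<^sup>2 \<partial>samples)
      - 2 * (\<integral>y. centered i j a y * centered i j b y \<partial>samples)"
    using A2 B2 square_integrable_mult[OF A2 B2]
    by (simp add: power2_diff square_integrable_def mult.assoc mult.commute[of "centered i j b _"])
  ultimately show ?thesis by linarith
qed

text \<open>The coefficient \<open>card + 1\<close> is what remains of \<open>real n\<close> after
  subtracting the unbiased factor. The larger block has the larger coefficient, the larger second
  moment and the smaller positive denominator, so all three comparisons favour the sign.\<close>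

lemma bias_step:
  assumes v: "v \<notin> A" and comp: "complete_set E {u\<in>A. E u v}"
  defines "a \<equiv> {u\<in>A. E u v}"
  shows "0 \<le> (\<integral>y. ((real (card (insert v a)) + 1) * X (insert v a) y $ i $ j - (real (card a) + 1) * X a y $ i $ j)
     * (mvue i j UNIV y - K $ i $ j) \<partial>samples)"
proof -
  have ca: "complete_set E a" using comp by (simp add: a_def)
  have cb: "complete_set E (insert v a)"
    using complete_insert_nbrs[of E A v, OF E_sym comp] by (simp add: a_def)
  have card: "card (insert v a) = Suc (card a)" using v by (simp add: a_def)
  define c where "c = real n - real (card (insert v a)) - 1"
  have c: "c > 0" unfolding c_def by (rule dof_pos[OF cb]) simp
  have ca1: "real n - real (card a) - 1 = c + 1" by (simp add: c_def card)
  define q where "q = real (card a)"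
  define U where "U = (\<integral>y. (centered i j a y)\<^sup>2 \<partial>samples)"
  define V where "V = (\<integral>y. (centered i j (insert v a) y)\<^sup>2 \<partial>samples)"
  have UV: "U \<le> V" unfolding U_def V_def by (rule centered_mono[OF cb]) auto
  have U: "0 \<le> U" unfolding U_def by simp
  have prob_space_const: "square_integrable samples (\<lambda>y. mvue i j UNIV y - K $ i $ j)"
    by (intro square_integrable_diff mvue_square_integrable square_integrable_const prob_samples)
  have int: "integrable samples (\<lambda>y. X b y $ i $ j * (mvue i j UNIV y - K $ i $ j))" if "complete_set E b" for b
    by (rule square_integrable_mult[OF X2[OF that] prob_space_const])
  have "(\<integral>y. ((q + 2) * X (insert v a) y $ i $ j - (q + 1) * X a y $ i $ j) * (mvue i j UNIV y - K $ i $ j) \<partial>samples)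
    = (\<integral>y. (q + 2) * (X (insert v a) y $ i $ j * (mvue i j UNIV y - K $ i $ j))
        - (q + 1) * (X a y $ i $ j * (mvue i j UNIV y - K $ i $ j)) \<partial>samples)"
    by (intro Bochner_Integration.integral_cong refl) (simp add: algebra_simps)
  also have "\<dots> = (q + 2) * (V / c) - (q + 1) * (U / (c + 1))"
    using int[OF ca] int[OF cb] X_error[OF cb, of i j] X_error[OF ca, of i j] c
    by (simp add: U_def V_def ca1 flip: c_def)
  also have "\<dots> \<ge> 0"
  proof -
    have "U / (c + 1) \<le> V / c" using UV U c by (intro frac_le) auto
    then have "(q + 1) * (U / (c + 1)) \<le> (q + 2) * (V / c)"
      using U c by (intro mult_mono) (auto simp: q_def)
    then show ?thesis by simp
  qed
  finally show ?thesis by (simp add: q_def card add.commute)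
qed

lemma bias_nonneg:
  assumes "simplicial_ext E A UNIV"
  shows "0 \<le> (\<integral>y. ((mle i j UNIV y - mvue i j UNIV y) - (mle i j A y - mvue i j A y)) * (mvue i j UNIV y - K $ i $ j) \<partial>samples)
    \<and> square_integrable samples (\<lambda>y. (mle i j UNIV y - mvue i j UNIV y) - (mle i j A y - mvue i j A y))"
  using assms
proof (induction A "UNIV :: 'p set" rule: simplicial_ext.induct)
  case simplicial_ext_refl
  then show ?case by (simp add: square_integrable_const prob_samples)
next
  case (simplicial_ext_step v A)
  define a where "a = {u\<in>A. E u v}"
  note hyps = simplicial_ext_step.hyps(3,4)
  have ca: "complete_set E a" using hyps by (simp add: a_def)
  have cb: "complete_set E (insert v a)"
    using complete_insert_nbrs[of E A v, OF E_sym hyps(2)] by (simp add: a_def)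
  define V where "V y = (real (card (insert v a)) + 1) * X (insert v a) y $ i $ j - (real (card a) + 1) * X a y $ i $ j" for y
  define D where "D y = (mle i j UNIV y - mvue i j UNIV y) - (mle i j (insert v A) y - mvue i j (insert v A) y)" for y
  have eq: "(mle i j UNIV y - mvue i j UNIV y) - (mle i j A y - mvue i j A y) = D y + V y" for y
    unfolding D_def mle_insert[OF hyps] mvue_insert[OF hyps] V_def a_def by (simp add: algebra_simps)
  have V2: "square_integrable samples V"
    unfolding V_def[abs_def] by (intro square_integrable_diff square_integrable_cmult X2 ca cb)
  have D2: "square_integrable samples D" using simplicial_ext_step.hyps(2) by (simp add: D_def[abs_def])
  have Z2: "square_integrable samples (\<lambda>y. mvue i j UNIV y - K $ i $ j)"
    by (intro square_integrable_diff mvue_square_integrable square_integrable_const prob_samples)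
  have "(\<integral>y. (D y + V y) * (mvue i j UNIV y - K $ i $ j) \<partial>samples)
    = (\<integral>y. D y * (mvue i j UNIV y - K $ i $ j) + V y * (mvue i j UNIV y - K $ i $ j) \<partial>samples)"
    by (simp add: distrib_right)
  also have "\<dots> = (\<integral>y. D y * (mvue i j UNIV y - K $ i $ j) \<partial>samples) + (\<integral>y. V y * (mvue i j UNIV y - K $ i $ j) \<partial>samples)"
    by (intro Bochner_Integration.integral_add square_integrable_mult D2 V2 Z2)
  also have "\<dots> \<ge> 0"
    using simplicial_ext_step.hyps(2) bias_step[OF hyps, of i j] unfolding D_def V_def a_def by linarith
  finally show ?case unfolding eq using square_integrable_add[OF D2 V2] by simp
qed

lemma entry_risk:
  "(\<integral>y. (mvue i j UNIV y - K $ i $ j)\<^sup>2 \<partial>samples) \<le> (\<integral>y. (mle i j UNIV y - K $ i $ j)\<^sup>2 \<partial>samples)"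
proof -
  define D where "D y = mle i j UNIV y - mvue i j UNIV y" for y
  define Z where "Z y = mvue i j UNIV y - K $ i $ j" for y
  have D: "0 \<le> (\<integral>y. D y * Z y \<partial>samples)" "square_integrable samples D"
    using bias_nonneg[OF ext[OF complete_empty], of i j] by (simp_all add: D_def[abs_def] Z_def)
  have Z: "square_integrable samples Z"
    unfolding Z_def[abs_def]
    by (intro square_integrable_diff mvue_square_integrable square_integrable_const prob_samples)
  have "(mle i j UNIV y - K $ i $ j)\<^sup>2 = (Z y)\<^sup>2 + (2 * (D y * Z y) + (D y)\<^sup>2)" for y
    by (simp add: D_def Z_def power2_eq_square algebra_simps)
  then have "(\<integral>y. (mle i j UNIV y - K $ i $ j)\<^sup>2 \<partial>samples)
    = (\<integral>y. (Z y)\<^sup>2 \<partial>samples) + (2 * (\<integral>y. D y * Z y \<partial>samples) + (\<integral>y. (D y)\<^sup>2 \<partial>samples))"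
    using D(2) Z square_integrable_mult[OF D(2) Z] by (simp add: square_integrable_def)
  moreover have "0 \<le> (\<integral>y. (D y)\<^sup>2 \<partial>samples)" by simp
  ultimately show ?thesis using D(1) unfolding Z_def by linarith
qed

end

theorem risk_le:
  "(\<integral>\<^sup>+y. ennreal (\<Sum>i\<in>UNIV. \<Sum>j\<in>UNIV. (mvue i j UNIV y - K $ i $ j)\<^sup>2) \<partial>samples)
   \<le> (\<integral>\<^sup>+y. ennreal (\<Sum>i\<in>UNIV. \<Sum>j\<in>UNIV. (mle i j UNIV y - K $ i $ j)\<^sup>2) \<partial>samples)"
proof (cases "(\<integral>\<^sup>+y. ennreal (\<Sum>i\<in>UNIV. \<Sum>j\<in>UNIV. (mle i j UNIV y - K $ i $ j)\<^sup>2) \<partial>samples) = \<infinity>")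
  case False
  let ?f = "\<lambda>y. \<Sum>i\<in>UNIV. \<Sum>j\<in>UNIV. (mle i j UNIV y - K $ i $ j)\<^sup>2"
  let ?g = "\<lambda>y. \<Sum>i\<in>UNIV. \<Sum>j\<in>UNIV. (mvue i j UNIV y - K $ i $ j)\<^sup>2"
  have f: "integrable samples ?f"
    using False by (intro integrableI_nonneg) (auto intro!: sum_nonneg simp: less_top)
  have le: "(mle i j UNIV y - K $ i $ j)\<^sup>2 \<le> ?f y" for i j y
  proof -
    have "(mle i j UNIV y - K $ i $ j)\<^sup>2 \<le> (\<Sum>j\<in>UNIV. (mle i j UNIV y - K $ i $ j)\<^sup>2)"
      by (rule member_le_sum[of j UNIV "\<lambda>j. (mle i j UNIV y - K $ i $ j)\<^sup>2"]) auto
    also have "\<dots> \<le> ?f y"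
      by (rule member_le_sum[of i UNIV "\<lambda>i. \<Sum>j\<in>UNIV. (mle i j UNIV y - K $ i $ j)\<^sup>2"]) (auto intro: sum_nonneg)
    finally show ?thesis .
  qed
  have mleK: "square_integrable samples (\<lambda>y. mle i j UNIV y - K $ i $ j)" for i j
    unfolding square_integrable_def
  proof
    show "integrable samples (\<lambda>y. (mle i j UNIV y - K $ i $ j)\<^sup>2)"
    proof (rule Bochner_Integration.integrable_bound[OF f])
      show "AE y in samples. norm ((mle i j UNIV y - K $ i $ j)\<^sup>2) \<le> norm (?f y)"
        by (intro AE_I2) (simp add: order.trans[OF le abs_ge_self])
    qed measurable
  qed measurable
  \<comment> \<open>Finite risk makes every entry of the maximum likelihood estimator square
    integrable; this is the source of all second moments of the blocks.\<close>
  have "square_integrable samples (mle i j UNIV)" for i j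
    using square_integrable_add[OF mleK[of i j] square_integrable_const[OF prob_samples, of "K $ i $ j"]] by simp
  note X2 = X_square_integrable[OF this]
  have mvueK: "square_integrable samples (\<lambda>y. mvue i j UNIV y - K $ i $ j)" for i j
    by (intro square_integrable_diff mvue_square_integrable square_integrable_const prob_samples X2)
  have int: "integrable samples (\<lambda>y. (mle i j UNIV y - K $ i $ j)\<^sup>2)"
     "integrable samples (\<lambda>y. (mvue i j UNIV y - K $ i $ j)\<^sup>2)" for i j
    using mleK mvueK by (auto simp: square_integrable_def)
  have "(\<integral>y. ?g y \<partial>samples) \<le> (\<integral>y. ?f y \<partial>samples)"
    using int entry_risk[OF X2] by (simp add: sum_mono)
  moreover have "integrable samples ?g" using int by simp
  ultimately show ?thesis
    using f by (subst (1 2) nn_integral_eq_integral) (auto intro!: sum_nonneg ennreal_leI)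
qed simp

end

section \<open>Transfer to the given random vectors\<close>

lemma frob_norm_square: "(frob_norm A)\<^sup>2 = (\<Sum>i\<in>UNIV. \<Sum>j\<in>UNIV. (A $ i $ j)\<^sup>2)"
  unfolding frob_norm_def by (intro real_sqrt_pow2 sum_nonneg) simp

context graphical_sample
begin

lemma pad_inv_X: "nonsingular a y \<Longrightarrow> pad_inv a (S y) = X a y"
  by (rule pad_inv_eq[OF sample_cov_sym X_inverse])

context
  fixes Cs y
  assumes cliques: "set Cs = {C. is_clique E UNIV C}" and peo: "perfect_elim_order E Cs"
    and ns: "\<And>a. complete_set E a \<Longrightarrow> nonsingular a y"
begin

lemma clique_pad_inv: "k \<in> {1..length Cs} \<Longrightarrow> pad_inv (clq Cs k) (S y) = X (clq Cs k) y"
  using clq_in_set[of k Cs] cliques by (intro pad_inv_X ns) (auto simp: is_clique_def)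

lemma separator_pad_inv:
  assumes "k \<in> {2..length Cs}"
  shows "pad_inv (sepr Cs k) (S y) = X (sepr Cs k) y"
proof (intro pad_inv_X ns)
  have "complete_set E (clq Cs k)"
    using assms clq_in_set[of k Cs] cliques by (auto simp: is_clique_def)
  then show "complete_set E (sepr Cs k)"
    by (rule complete_set_mono) (auto simp: sepr_def)
qed

lemma clique_sum_estimator:
  assumes "f {} * X {} y $ i $ j = 0"
  shows "((\<Sum>k\<in>{1..length Cs}. f (clq Cs k) *\<^sub>R pad_inv (clq Cs k) (S y))
     - (\<Sum>k\<in>{2..length Cs}. f (sepr Cs k) *\<^sub>R pad_inv (sepr Cs k) (S y))) $ i $ j
   = clique_sum E (\<lambda>a. f a * X a y $ i $ j) UNIV"
proof -
  have "(\<Sum>k\<in>{1..length Cs}. f (clq Cs k) * pad_inv (clq Cs k) (S y) $ i $ j)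
      = (\<Sum>k\<in>{1..length Cs}. f (clq Cs k) * X (clq Cs k) y $ i $ j)"
    by (intro sum.cong refl) (simp add: clique_pad_inv)
  moreover have "(\<Sum>k\<in>{2..length Cs}. f (sepr Cs k) * pad_inv (sepr Cs k) (S y) $ i $ j)
      = (\<Sum>k\<in>{2..length Cs}. f (sepr Cs k) * X (sepr Cs k) y $ i $ j)"
    by (intro sum.cong refl) (simp add: separator_pad_inv)
  ultimately show ?thesis
    unfolding clique_sum_def
    using clique_sum_eq[OF cliques peo, of "\<lambda>a. f a * X a y $ i $ j", OF assms moebius] by simp
qed

end

end

theorem theorem3:
  fixes E :: "'p::finite \<Rightarrow> 'p \<Rightarrow> bool"
    and Cs :: "'p set list"
    and M :: "'a measure"
    and x :: "nat \<Rightarrow> 'a \<Rightarrow> real^'p"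
    and K :: "real^'p^'p"
    and n :: nat
  assumes sym: "\<And>u v. E u v \<Longrightarrow> E v u"
    and irrefl: "\<And>u. \<not> E u u"
    and decomp: "decomposable E UNIV"
    and cliques: "set Cs = {C. is_clique E UNIV C}"
    and dist: "distinct Cs"
    and peo: "perfect_elim_order E Cs"
    and n_ge: "\<forall>C\<in>set Cs. card C \<le> n"
    and prob: "prob_space M"
    and indep: "prob_space.indep_vars M (\<lambda>_. borel) x {1..n}"
    and gauss: "\<forall>i\<in>{1..n}. distributed M lborel (x i) (\<lambda>v. ennreal (gauss_density K v))"
    and Kpd: "pos_def K"
    and KK: "K \<in> conc_class Cs"
  shows "(\<integral>\<^sup>+ \<omega>. ennreal ((frob_norm (K_mvue Cs n (\<lambda>i. x i \<omega>) - K))^2) \<partial>M)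
         \<le> (\<integral>\<^sup>+ \<omega>. ennreal ((frob_norm (K_mle Cs n (\<lambda>i. x i \<omega>) - K))^2) \<partial>M)"
proof -
  interpret M: prob_space M by (rule prob)
  have card_le: "card a \<le> n" if "complete_set E a" for a
  proof -
    obtain C where "is_clique E UNIV C" "a \<subseteq> C" using complete_subset_clique[OF \<open>complete_set E a\<close>] .
    then show ?thesis using n_ge cliques card_mono[of C a] by fastforce
  qed
  \<comment> \<open>Index types are nonempty and singletons are complete, so there is an
    observation, whose law shows that the density has mass one.\<close>
  have n: "1 \<le> n" using card_le[of "{undefined}"] by (simp add: complete_set_def)
  have x_measurable: "x i \<in> M \<rightarrow>\<^sub>M borel" and x_distr: "distr M borel (x i) = density lborel (\<lambda>v. ennreal (gauss_density K v))"
    if "i \<in> {1..n}" for i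
  proof -
    have d: "distributed M lborel (x i) (\<lambda>v. ennreal (gauss_density K v))" using gauss that by blast
    then show "x i \<in> M \<rightarrow>\<^sub>M borel" using distributed_measurable[OF d] by simp
    have "distr M borel (x i) = distr M lborel (x i)" by (rule distr_cong) auto
    then show "distr M borel (x i) = density lborel (\<lambda>v. ennreal (gauss_density K v))"
      using distributed_distr_eq_density[OF d] by simp
  qed
  have prob_gauss: "prob_space (density lborel (\<lambda>v. ennreal (gauss_density K v)))"
    using M.prob_space_distr[OF x_measurable[of 1]] x_distr[of 1] n by simp
  have ext: "simplicial_ext E a UNIV" if "complete_set E a" for a
    using decomposable_simplicial_ext[OF _ decomp that] sym by blast
  have K_zero: "K $ u $ v = 0" if "u \<noteq> v" "\<not> E u v" for u v
    by (rule conc_class_zero[OF _ cliques KK that]) (rule sym)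
  interpret graphical_sample K n E
    by (intro graphical_sample.intro gaussian_sample.intro graphical_sample_axioms.intro
        Kpd prob_gauss ext K_zero card_le) (rule sym)
  \<comment> \<open>Restriction to \<open>{1..n}\<close> lands in the space of the product measure,
    and the sample covariance reads only these indices.\<close>
  define \<Phi> where "\<Phi> \<omega> = (\<lambda>i\<in>{1..n}. x i \<omega>)" for \<omega>
  have \<Phi>_measurable: "\<Phi> \<in> M \<rightarrow>\<^sub>M PiM {1..n} (\<lambda>_. borel)"
    unfolding \<Phi>_def[abs_def] by (intro measurable_restrict x_measurable)
  have "distr M (PiM {1..n} (\<lambda>_. borel)) \<Phi> = PiM {1..n} (\<lambda>i. distr M borel (x i))"
    using M.indep_vars_iff_distr_eq_PiM'[of "{1..n}" x "\<lambda>_. borel"] x_measurable indep n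
    by (simp add: \<Phi>_def[abs_def])
  also have "\<dots> = samples"
    unfolding samples_def by (intro PiM_cong refl) (simp add: x_distr gauss_def)
  finally have samples_eq: "samples = distr M (PiM {1..n} (\<lambda>_. borel)) \<Phi>" ..
  have S_eq: "sample_cov n (\<lambda>i. x i \<omega>) = S (\<Phi> \<omega>)" for \<omega>
    unfolding sample_cov_def by (intro sum.cong refl) (simp add: \<Phi>_def)
  \<comment> \<open>Finitely many complete sets have nonsingular blocks simultaneously, almost
    surely; on that event the definite description in \<open>pad_inv\<close> agrees with Cramer's
    formula.\<close>
  have "AE y in samples. \<forall>a\<in>{a. complete_set E a}. nonsingular a y"
    by (intro AE_finite_allI nonsingular_AE) auto
  then have ns: "AE \<omega> in M. \<forall>a\<in>{a. complete_set E a}. nonsingular a (\<Phi> \<omega>)"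
    unfolding samples_eq by (rule AE_distrD[OF \<Phi>_measurable])
  have mvue: "AE \<omega> in M. ennreal ((frob_norm (K_mvue Cs n (\<lambda>i. x i \<omega>) - K))^2)
      = ennreal (\<Sum>i\<in>UNIV. \<Sum>j\<in>UNIV. (mvue i j UNIV (\<Phi> \<omega>) - K $ i $ j)\<^sup>2)"
    using ns
  proof eventually_elim
    case (elim \<omega>)
    have "K_mvue Cs n (\<lambda>i. x i \<omega>) $ i $ j = mvue i j UNIV (\<Phi> \<omega>)" for i j
      unfolding K_mvue_def S_eq mvue_def
      by (rule clique_sum_estimator[OF cliques peo, where f="\<lambda>a. real n - real (card a) - 1"])
         (use elim in auto)
    then show ?case by (simp add: frob_norm_square)
  qed
  have mle: "AE \<omega> in M. ennreal ((frob_norm (K_mle Cs n (\<lambda>i. x i \<omega>) - K))^2)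
      = ennreal (\<Sum>i\<in>UNIV. \<Sum>j\<in>UNIV. (mle i j UNIV (\<Phi> \<omega>) - K $ i $ j)\<^sup>2)"
    using ns
  proof eventually_elim
    case (elim \<omega>)
    have "K_mle Cs n (\<lambda>i. x i \<omega>) $ i $ j = mle i j UNIV (\<Phi> \<omega>)" for i j
      unfolding K_mle_def S_eq mle_def
      by (rule clique_sum_estimator[OF cliques peo, where f="\<lambda>a. real n"])
         (use elim in auto)
    then show ?case by (simp add: frob_norm_square)
  qed
  have transfer: "(\<integral>\<^sup>+\<omega>. f (\<Phi> \<omega>) \<partial>M) = (\<integral>\<^sup>+y. f y \<partial>samples)" if "f \<in> borel_measurable samples" for f
    using that unfolding samples_eq by (subst nn_integral_distr[OF \<Phi>_measurable]) simp_all
  show ?thesis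
    unfolding nn_integral_cong_AE[OF mvue] nn_integral_cong_AE[OF mle]
    using risk_le
    by (subst (1 2) transfer) measurable
qed

end
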